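(* Let $k$ be a field of characteristic $0$, $R = k[t_1, \dots, t_n]$, and $x_1, \dots, x_m \in (k^* )^n$. For $1 \le n' \le n$ let $m'_{n'}$ be the maximum of $\operatorname{rank}(\operatorname{Stab}_X(\mathfrak{p}))$ over prime ideals $\mathfrak{p} \subset \mathfrak{m}$ of height $n'$, assume $m'_{n'} < m$ for every $n'$, and set $\eta_{n'} = n'/(m - m'_{n'})$. Let $f \in R$ be nonzero of total degree $D$ and let $N = D^{\eta_1} + D^{\eta_2} + \cdots + D^{\eta_n}$. Then there exists $z \in X(N)$ with $f(z) \neq 0$.
   Context: $X(N) = \{\prod_{i=1}^m x_i^{a_i} : a_i \in \mathbf{Z},\ 0 \le a_i \le N\} \subset (k^* )^n$, products taken coordinatewise; for $a \in \mathbf{Z}^m$ write $x^a = \prod_i x_i^{a_i}$. $\mathfrak{m} = (t_1 - 1, \dots, t_n - 1)$. An element $z \in (k^* )^n$ acts on $R$ by $(z \cdot g)(t) = g(z_1t_1, \dots, z_nt_n)$, and $\operatorname{Stab}_X(\mathfrak{p}) = \{a \in \mathbf{Z}^m : x^a \cdot \mathfrak{p} = \mathfrak{p}\}$. *)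

theory Defs
  imports "HOL-Library.Poly_Mapping" "HOL-Library.Extended_Nat" "HOL-Library.Cardinality" Complex_Main
begin

text \<open>Polynomials in the variables t_i, i :: 'n (a finite type, n = CARD('n)),
  over a field 'k, are represented as finitely supported maps from monomials
  (exponent vectors) to coefficients.  This type is a commutative ring.\<close>

type_synonym ('n, 'k) mpoly = "('n \<Rightarrow>\<^sub>0 nat) \<Rightarrow>\<^sub>0 'k"

definition mvar :: "'n \<Rightarrow> ('n, 'k::comm_ring_1) mpoly" where
  "mvar i = Poly_Mapping.single (Poly_Mapping.single i 1) 1"

definition mono_val :: "('n::finite \<Rightarrow> 'k::comm_ring_1) \<Rightarrow> ('n \<Rightarrow>\<^sub>0 nat) \<Rightarrow> 'k" where
  "mono_val z \<alpha> = (\<Prod>i\<in>UNIV. z i ^ Poly_Mapping.lookup \<alpha> i)"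

definition meval :: "('n::finite, 'k::comm_ring_1) mpoly \<Rightarrow> ('n \<Rightarrow> 'k) \<Rightarrow> 'k" where
  "meval g z = (\<Sum>\<alpha>\<in>Poly_Mapping.keys g. Poly_Mapping.lookup g \<alpha> * mono_val z \<alpha>)"

definition total_degree :: "('n::finite, 'k::zero) mpoly \<Rightarrow> nat" where
  "total_degree g = Max (insert 0 ((\<lambda>\<alpha>. \<Sum>i\<in>UNIV. Poly_Mapping.lookup \<alpha> i) ` Poly_Mapping.keys g))"

text \<open>Action of z on R: (z \<cdot> g)(t) = g(z_1 t_1, ..., z_n t_n).\<close>
definition act :: "('n::finite \<Rightarrow> 'k::comm_ring_1) \<Rightarrow> ('n, 'k) mpoly \<Rightarrow> ('n, 'k) mpoly" where
  "act z g = Poly_Mapping.mapp (\<lambda>\<alpha> c. c * mono_val z \<alpha>) g"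

definition is_ideal :: "'a::comm_ring_1 set \<Rightarrow> bool" where
  "is_ideal I \<longleftrightarrow> 0 \<in> I \<and> (\<forall>a\<in>I. \<forall>b\<in>I. a + b \<in> I) \<and> (\<forall>r. \<forall>a\<in>I. r * a \<in> I)"

definition is_prime_ideal :: "'a::comm_ring_1 set \<Rightarrow> bool" where
  "is_prime_ideal P \<longleftrightarrow> is_ideal P \<and> P \<noteq> UNIV \<and> (\<forall>a b. a * b \<in> P \<longrightarrow> a \<in> P \<or> b \<in> P)"

definition ideal_gen :: "'a::comm_ring_1 set \<Rightarrow> 'a set" where
  "ideal_gen S = \<Inter>{I. is_ideal I \<and> S \<subseteq> I}"

definition prime_chain_to :: "'a::comm_ring_1 set \<Rightarrow> nat \<Rightarrow> bool" where
  "prime_chain_to P h \<longleftrightarrow> (\<exists>c :: nat \<Rightarrow> 'a set.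
      (\<forall>i\<le>h. is_prime_ideal (c i)) \<and> (\<forall>i<h. c i \<subset> c (Suc i)) \<and> c h = P)"

definition height :: "'a::comm_ring_1 set \<Rightarrow> enat" where
  "height P = (SUP h\<in>{h. prime_chain_to P h}. enat h)"

definition max_ideal_one :: "('n::finite, 'k::comm_ring_1) mpoly set" where
  "max_ideal_one = ideal_gen (range (\<lambda>i. mvar i - 1))"

definition xpow :: "('m::finite \<Rightarrow> 'n \<Rightarrow> 'k::field) \<Rightarrow> ('m \<Rightarrow> int) \<Rightarrow> 'n \<Rightarrow> 'k" where
  "xpow x a = (\<lambda>j. \<Prod>i\<in>UNIV. x i j powi a i)"

definition Stab :: "('m::finite \<Rightarrow> 'n::finite \<Rightarrow> 'k::field) \<Rightarrow> ('n, 'k) mpoly set \<Rightarrow> ('m \<Rightarrow> int) set" where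
  "Stab x P = {a. act (xpow x a) ` P = P}"

definition int_lin_indep :: "('m::finite \<Rightarrow> int) set \<Rightarrow> bool" where
  "int_lin_indep B \<longleftrightarrow> (\<forall>c :: ('m \<Rightarrow> int) \<Rightarrow> int.
      (\<forall>i. (\<Sum>b\<in>B. c b * b i) = 0) \<longrightarrow> (\<forall>b\<in>B. c b = 0))"

definition zrank :: "('m::finite \<Rightarrow> int) set \<Rightarrow> nat" where
  "zrank S = (GREATEST r. \<exists>B\<subseteq>S. finite B \<and> card B = r \<and> int_lin_indep B)"

definition mprime :: "('m::finite \<Rightarrow> 'n::finite \<Rightarrow> 'k::field) \<Rightarrow> nat \<Rightarrow> nat" where
  "mprime x n' = Max {zrank (Stab x P) | P. is_prime_ideal P \<and> P \<subseteq> max_ideal_one \<and> height P = enat n'}"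

end

theory Submission
  imports Defs "HOL-Library.FuncSet"
begin

text \<open>Suppose \<open>f\<close> vanishes on the box of side \<open>T\<^sub>1 + \<dots> + T\<^sub>n\<close>, where \<open>T\<^sub>d\<close> is the integer part of
  \<open>D powr \<eta>\<^sub>d\<close>, and let \<open>I\<^sub>j\<close> be generated by the translates of \<open>f\<close> by the box of side \<open>T\<^sub>1 + \<dots> + T\<^sub>j\<close>.
  Comparing the least heights of primes over the \<open>I\<^sub>j\<close> through points of the remaining box yields an index
  \<open>j\<close> and a prime of height \<open>j\<close> over \<open>I\<^sub>j\<close> all of whose translates by the box of side \<open>T\<^sub>j\<close> are minimal
  over the previous ideal. There are more than \<open>D ^ j\<close> of these translates, because the stabilizer
  has rank at most \<open>m'\<^sub>j\<close>; this contradicts a Bezout bound.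

  The Bezout bound is obtained by counting dimensions. If \<open>Q\<close> is minimal of height \<open>j\<close> over an ideal \<open>I\<close>,
  then \<open>j\<close> of the generators of \<open>I\<close> are analytically independent at \<open>Q\<close>; otherwise rewriting would show
  that polynomials of degree less than \<open>S\<close> modulo the \<open>S\<close>-th symbolic power of \<open>Q\<close> have dimension
  \<open>O(S ^ (n - 1))\<close>, whereas in characteristic zero no nonzero polynomial of degree less than \<open>S\<close> lies in
  that power. Power products of such generators and of independent variables, multiplied by elements
  separating the primes, are linearly independent, and their number up to a given degree is the number
  of primes divided by \<open>D ^ j\<close> times the number of all monomials, up to lower order terms.

  Heights are read off maximal sets of variables that are independent modulo the prime.\<close>

section \<open>Polynomials as a vector space over the coefficient field\<close>

text \<open>The exponents are the threshold of one comparison: \<open>(T j + 1) ^ (m - m'_j)\<close>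
  translates against at most \<open>D ^ j\<close> primes. Taking \<open>T j\<close> to be an integer
  part suffices, because \<open>T j + 1\<close> already exceeds \<open>D powr \<eta>_j\<close>. The
  shape of the proof comes from never inverting anything: neither the localization at
  \<open>Q\<close> nor the fraction field of k[Y] is formed. Every relation instead carries a
  multiplier \<open>A\<close> in k[Y] and a multiplier \<open>H\<close> outside \<open>Q\<close>.
  Rewriting uses a controlled number of each, and primality of \<open>Q\<close> disposes of them at
  the end. This is why symbolic rather than ordinary powers of \<open>Q\<close> appear. One
  rewriting lemma serves twice. With order 1 it shows that an element outside \<open>Q\<close>
  divides a nonzero element of k[Y] modulo \<open>Q\<close>; with large order it bounds dimensions
  modulo a power of \<open>I\<close>. In the Bezout bound the separating elements shift the degree
  by a constant \<open>E\<close>. The resulting inequality is iterated, so that an exponential is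
  played against a polynomial and leading coefficients of Hilbert functions never have to be
  compared.\<close>

abbreviation lk :: "('a \<Rightarrow>\<^sub>0 'b::zero) \<Rightarrow> 'a \<Rightarrow> 'b" where
  "lk \<equiv> Poly_Mapping.lookup"

abbreviation ks :: "('a \<Rightarrow>\<^sub>0 'b::zero) \<Rightarrow> 'a set" where
  "ks \<equiv> Poly_Mapping.keys"

abbreviation sgl :: "'a \<Rightarrow> 'b \<Rightarrow> 'a \<Rightarrow>\<^sub>0 'b::zero" where
  "sgl \<equiv> Poly_Mapping.single"

definition cst :: "'k::comm_ring_1 \<Rightarrow> ('n, 'k) mpoly" where
  "cst c = sgl 0 c"

definition mon :: "('n \<Rightarrow>\<^sub>0 nat) \<Rightarrow> ('n, 'k::comm_ring_1) mpoly" where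
  "mon \<gamma> = sgl \<gamma> 1"

definition psc :: "'k::comm_ring_1 \<Rightarrow> ('n, 'k) mpoly \<Rightarrow> ('n, 'k) mpoly" where
  "psc c p = cst c * p"

lemma mon_add: "mon (\<alpha> + \<beta>) = (mon \<alpha> * mon \<beta> :: ('n, 'k::comm_ring_1) mpoly)"
  by (simp add: mon_def mult_single)

lemma mon_0 [simp]: "mon 0 = 1"
  by (simp add: mon_def)

lemma keys_mon [simp]: "ks (mon \<gamma> :: ('n, 'k::comm_ring_1) mpoly) = {\<gamma>}"
  by (simp add: mon_def)

lemma psc_mon: "psc c (mon \<gamma>) = sgl \<gamma> c"
  by (simp add: psc_def cst_def mon_def mult_single)

lemma mpoly_expand: "p = (\<Sum>\<gamma>\<in>ks p. psc (lk p \<gamma>) (mon \<gamma>))"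
  for p :: "('n, 'k::comm_ring_1) mpoly"
  by (rule poly_mapping_eqI)
     (auto simp: psc_mon lookup_sum lookup_single when_def in_keys_iff)

lemma mpoly_induct [case_names single add]:
  fixes p :: "('n, 'k::comm_ring_1) mpoly"
  assumes s: "\<And>\<gamma> c. P (sgl \<gamma> c)" and a: "\<And>p q. P p \<Longrightarrow> P q \<Longrightarrow> P (p + q)"
  shows "P p"
proof -
  have "P (\<Sum>\<gamma>\<in>F. psc (lk p \<gamma>) (mon \<gamma>))" if "finite F" for F
    using that
  proof induction
    case empty
    then show ?case using s[of 0 0] by simp
  next
    case (insert x F)
    then show ?case by (auto simp: psc_mon intro: s a)
  qed
  then show ?thesis using mpoly_expand[of p] by (metis finite_keys)
qed

global_interpretation mp: vector_space "psc :: 'k::field \<Rightarrow> ('n, 'k) mpoly \<Rightarrow> _"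
  by unfold_locales
     (auto simp: psc_def cst_def algebra_simps single_add mult_single mult.assoc[symmetric])

lemma psc_mult_left: "psc c p * q = psc c (p * q)"
  by (simp add: psc_def mult.assoc)

text \<open>The target sets of the rewriting are subspaces but not ideals, so a product with a
  polynomial has to be handled one monomial at a time.\<close>

lemma subspace_mult_memI:
  fixes T :: "('n, 'k::field) mpoly set"
  assumes "mp.subspace T" "\<And>\<kappa>. \<kappa> \<in> ks p \<Longrightarrow> mon \<kappa> * x \<in> T"
  shows "p * x \<in> T"
proof -
  have "p * x = (\<Sum>\<gamma>\<in>ks p. psc (lk p \<gamma>) (mon \<gamma> * x))"
    by (subst mpoly_expand[of p]) (simp add: sum_distrib_right psc_mult_left)
  also have "\<dots> \<in> T"
    by (intro mp.subspace_sum mp.subspace_scale assms)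
  finally show ?thesis .
qed

text \<open>Every counting argument below ends here. The vectors are an indexed family, so two equal
  vectors count as dependent; since the library notion concerns sets, that case is settled
  separately with coefficients 1 and -1.\<close>

lemma linear_dependence_mod_subspace:
  fixes v :: "'i \<Rightarrow> ('n, 'k::field) mpoly"
  assumes fin: "finite Z" "finite \<Omega>" and card: "card Z < card \<Omega>" and U: "mp.subspace U"
    and v: "\<And>i. i \<in> \<Omega> \<Longrightarrow> \<exists>z\<in>mp.span Z. v i - z \<in> U"
  shows "\<exists>c. (\<exists>i\<in>\<Omega>. c i \<noteq> 0) \<and> (\<Sum>i\<in>\<Omega>. psc (c i) (v i)) \<in> U"
proof -
  obtain z where z: "\<And>i. i \<in> \<Omega> \<Longrightarrow> z i \<in> mp.span Z" "\<And>i. i \<in> \<Omega> \<Longrightarrow> v i - z i \<in> U"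
    using v by metis
  have "\<exists>c. (\<exists>i\<in>\<Omega>. c i \<noteq> 0) \<and> (\<Sum>i\<in>\<Omega>. psc (c i) (z i)) = 0"
  proof (cases "inj_on z \<Omega>")
    case True
    have "mp.dependent (z ` \<Omega>)"
    proof (rule ccontr)
      assume "\<not> mp.dependent (z ` \<Omega>)"
      then have "card (z ` \<Omega>) \<le> card Z"
        using mp.independent_span_bound[OF fin(1)] z(1) by blast
      then show False using card card_image[OF True] by simp
    qed
    then obtain u w where u: "w \<in> z ` \<Omega>" "u w \<noteq> 0" "(\<Sum>v\<in>z ` \<Omega>. psc (u v) v) = 0"
      using fin(2) by (auto simp: mp.dependent_finite)
    then have "(\<Sum>i\<in>\<Omega>. psc (u (z i)) (z i)) = 0"
      by (simp add: sum.reindex[OF True])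
    then show ?thesis using u by (intro exI[of _ "\<lambda>i. u (z i)"]) auto
  next
    case False
    then obtain i j where ij: "i \<in> \<Omega>" "j \<in> \<Omega>" "i \<noteq> j" "z i = z j"
      by (auto simp: inj_on_def)
    define c :: "'i \<Rightarrow> 'k" where "c = (\<lambda>l. if l = i then 1 else if l = j then -1 else 0)"
    have "(\<Sum>l\<in>\<Omega>. psc (c l) (z l)) = (\<Sum>l\<in>{i,j}. psc (c l) (z l))"
      using ij fin by (intro sum.mono_neutral_right) (auto simp: c_def)
    also have "\<dots> = 0" using ij by (simp add: c_def)
    finally show ?thesis using ij by (intro exI[of _ c]) (auto simp: c_def)
  qed
  then obtain c where c: "\<exists>i\<in>\<Omega>. c i \<noteq> 0" "(\<Sum>i\<in>\<Omega>. psc (c i) (z i)) = 0" by blast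
  have "(\<Sum>i\<in>\<Omega>. psc (c i) (v i)) = (\<Sum>i\<in>\<Omega>. psc (c i) (v i - z i)) + (\<Sum>i\<in>\<Omega>. psc (c i) (z i))"
    by (simp add: sum.distrib[symmetric] mp.scale_right_diff_distrib)
  also have "\<dots> \<in> U" unfolding c(2) add_0_right
    using U z(2) by (intro mp.subspace_sum mp.subspace_scale) auto
  finally show ?thesis using c by blast
qed

section \<open>Partial degrees\<close>

definition vdeg :: "'n set \<Rightarrow> ('n::finite \<Rightarrow>\<^sub>0 nat) \<Rightarrow> nat" where
  "vdeg V \<gamma> = (\<Sum>i\<in>V. lk \<gamma> i)"

lemma vdeg_0 [simp]: "vdeg V 0 = 0"
  by (simp add: vdeg_def)

lemma vdeg_add [simp]: "vdeg V (\<alpha> + \<beta>) = vdeg V \<alpha> + vdeg V \<beta>"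
  by (simp add: vdeg_def lookup_add sum.distrib)

lemma vdeg_mono: "V \<subseteq> W \<Longrightarrow> vdeg V \<gamma> \<le> vdeg W \<gamma>"
  by (simp add: vdeg_def sum_mono2)

lemma vdeg_split: "vdeg UNIV \<gamma> = vdeg V \<gamma> + vdeg (- V) \<gamma>"
  unfolding vdeg_def by (metis Compl_eq_Diff_UNIV finite sum.subset_diff top_greatest add.commute)

lemma lookup_le_vdeg: "i \<in> V \<Longrightarrow> lk \<gamma> i \<le> vdeg V \<gamma>"
  unfolding vdeg_def by (rule member_le_sum) auto

lemma vdeg_single [simp]: "vdeg V (sgl i e) = (if i \<in> V then e else 0)"
  by (auto simp: vdeg_def lookup_single when_def sum.delta)

text \<open>With \<open>V = - Y\<close> and bound 0 this expresses membership in the subring k[Y];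
  it is used in this way throughout.\<close>

definition deg_le :: "'n set \<Rightarrow> nat \<Rightarrow> ('n::finite, 'k::zero) mpoly \<Rightarrow> bool" where
  "deg_le V d p \<longleftrightarrow> (\<forall>\<gamma>\<in>ks p. vdeg V \<gamma> \<le> d)"

lemma deg_le_weaken: "deg_le V d p \<Longrightarrow> d \<le> e \<Longrightarrow> deg_le V e p"
  by (auto simp: deg_le_def)

lemma deg_le_subset: "deg_le V d p \<Longrightarrow> W \<subseteq> V \<Longrightarrow> deg_le W d p"
  by (meson deg_le_def le_trans vdeg_mono)

lemma deg_le_0 [simp]: "deg_le V d 0"
  by (simp add: deg_le_def)

lemma deg_le_1 [simp]: "deg_le V d (1 :: ('n::finite, 'k::comm_ring_1) mpoly)"
  by (simp add: deg_le_def)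

lemma deg_le_mon: "deg_le V d (mon \<gamma>) \<longleftrightarrow> vdeg V \<gamma> \<le> d"
  by (simp add: deg_le_def)

lemma deg_le_add: "deg_le V d p \<Longrightarrow> deg_le V d q \<Longrightarrow> deg_le V d (p + q)"
  using keys_add[of p q] by (auto simp: deg_le_def)

lemma deg_le_mult: "deg_le V d p \<Longrightarrow> deg_le V e q \<Longrightarrow> deg_le V (d + e) (p * q)"
  for p :: "('n::finite, 'k::comm_ring_1) mpoly"
  using keys_mult[of p q] by (fastforce simp: deg_le_def intro: add_mono)

lemma deg_le_power: "deg_le V d p \<Longrightarrow> deg_le V (m * d) (p ^ m)"
  for p :: "('n::finite, 'k::comm_ring_1) mpoly"
  by (induction m) (auto intro: deg_le_mult)

lemma deg_le_sum: "(\<And>i. i \<in> F \<Longrightarrow> deg_le V d (p i)) \<Longrightarrow> deg_le V d (sum p F)"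
  by (induction F rule: infinite_finite_induct) (auto intro: deg_le_add)

lemma deg_le_prod:
  fixes p :: "'i \<Rightarrow> ('n::finite, 'k::comm_ring_1) mpoly"
  assumes "\<And>i. i \<in> F \<Longrightarrow> deg_le V (d i) (p i)"
  shows "deg_le V (sum d F) (prod p F)"
  using assms by (induction F rule: infinite_finite_induct) (auto intro: deg_le_mult)

lemma deg_le_psc: "deg_le V d p \<Longrightarrow> deg_le V d (psc c p)"
  for p :: "('n::finite, 'k::comm_ring_1) mpoly"
  using deg_le_mult[of V 0 "cst c" d p] by (auto simp: psc_def cst_def deg_le_def split: if_splits)

lemma deg_le_total_degree: "deg_le UNIV (total_degree p) p"
  by (auto simp: deg_le_def total_degree_def vdeg_def intro: Max_ge)

lemma finite_deg_bound:
  assumes "finite F"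
  shows "\<exists>E. \<forall>p\<in>F. deg_le UNIV E p"
  by (meson assms deg_le_weaken deg_le_total_degree finite_imageI finite_nat_set_iff_bounded_le imageI)

lemma mem_span_mon:
  fixes p :: "('n::finite, 'k::field) mpoly"
  assumes "deg_le UNIV d p"
  shows "p \<in> mp.span (mon ` {\<gamma>. vdeg UNIV \<gamma> \<le> d})"
proof -
  have "(\<Sum>\<gamma>\<in>ks p. psc (lk p \<gamma>) (mon \<gamma>)) \<in> mp.span (mon ` {\<gamma>. vdeg UNIV \<gamma> \<le> d})"
    by (rule mp.span_sum, rule mp.span_scale, rule mp.span_base) (use assms in \<open>auto simp: deg_le_def\<close>)
  then show ?thesis using mpoly_expand[of p] by simp
qed

section \<open>Ideals\<close>

lemma is_ideal_ideal_gen: "is_ideal (ideal_gen S)"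
  unfolding ideal_gen_def is_ideal_def by auto

lemma ideal_gen_superset: "S \<subseteq> ideal_gen S"
  by (auto simp: ideal_gen_def)

lemma ideal_gen_least: "is_ideal I \<Longrightarrow> S \<subseteq> I \<Longrightarrow> ideal_gen S \<subseteq> I"
  by (auto simp: ideal_gen_def)

lemma ideal_add: "is_ideal I \<Longrightarrow> a \<in> I \<Longrightarrow> b \<in> I \<Longrightarrow> a + b \<in> I"
  and ideal_zero: "is_ideal I \<Longrightarrow> 0 \<in> I"
  and ideal_mult_left: "is_ideal I \<Longrightarrow> a \<in> I \<Longrightarrow> r * a \<in> I"
  by (auto simp: is_ideal_def)

lemma ideal_mult_right: "is_ideal I \<Longrightarrow> a \<in> I \<Longrightarrow> a * r \<in> I"
  by (metis ideal_mult_left mult.commute)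

lemma ideal_uminus: "is_ideal I \<Longrightarrow> a \<in> I \<Longrightarrow> - a \<in> I"
  using ideal_mult_left[of I a "-1"] by simp

lemma ideal_diff: "is_ideal I \<Longrightarrow> a \<in> I \<Longrightarrow> b \<in> I \<Longrightarrow> a - b \<in> I"
  using ideal_add[of I a "- b"] ideal_uminus[of I b] by simp

lemma ideal_sum: "is_ideal I \<Longrightarrow> (\<And>i. i \<in> F \<Longrightarrow> p i \<in> I) \<Longrightarrow> sum p F \<in> I"
  by (induction F rule: infinite_finite_induct) (auto intro: ideal_add ideal_zero)

lemma subspace_ideal: "is_ideal I \<Longrightarrow> mp.subspace (I :: ('n, 'k::field) mpoly set)"
  unfolding mp.subspace_def by (auto simp: psc_def ideal_add ideal_zero ideal_mult_left)

fun ipow :: "'a::comm_ring_1 set \<Rightarrow> nat \<Rightarrow> 'a set" where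
  "ipow I 0 = UNIV"
| "ipow I (Suc s) = ideal_gen {a * b | a b. a \<in> I \<and> b \<in> ipow I s}"

lemma is_ideal_ipow: "is_ideal (ipow I s)"
  by (cases s) (auto simp: is_ideal_ideal_gen, simp add: is_ideal_def)

declare ipow.simps(2) [simp del]

lemma ipow_Suc_mult: "a \<in> I \<Longrightarrow> b \<in> ipow I s \<Longrightarrow> a * b \<in> ipow I (Suc s)"
  unfolding ipow.simps by (rule ideal_gen_superset[THEN subsetD]) blast

lemma ipow_Suc_least:
  assumes "is_ideal J" "\<And>a b. a \<in> I \<Longrightarrow> b \<in> ipow I s \<Longrightarrow> a * b \<in> J"
  shows "ipow I (Suc s) \<subseteq> J"
  unfolding ipow.simps by (rule ideal_gen_least) (use assms in blast)+

lemma ipow_1: "is_ideal I \<Longrightarrow> ipow I (Suc 0) = I"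
proof
  assume I: "is_ideal I"
  show "ipow I (Suc 0) \<subseteq> I"
    by (rule ipow_Suc_least[OF I]) (rule ideal_mult_right[OF I])
  show "I \<subseteq> ipow I (Suc 0)"
  proof
    fix a assume "a \<in> I"
    then have "a * 1 \<in> ipow I (Suc 0)" by (rule ipow_Suc_mult) simp
    then show "a \<in> ipow I (Suc 0)" by (simp only: mult_1_right)
  qed
qed

lemma ideal_colon: "is_ideal J \<Longrightarrow> is_ideal {a. a * b \<in> J}"
  by (auto simp: is_ideal_def algebra_simps)

lemma ipow_mult: "a \<in> ipow I s \<Longrightarrow> b \<in> ipow I r \<Longrightarrow> a * b \<in> ipow I (s + r)"
proof (induction s arbitrary: a)
  case 0
  then show ?case by (simp add: ideal_mult_left is_ideal_ipow)
next
  case (Suc s)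
  have "ipow I (Suc s) \<subseteq> {a. a * b \<in> ipow I (Suc s + r)}"
  proof (rule ipow_Suc_least[OF ideal_colon[OF is_ideal_ipow]])
    fix u v assume "u \<in> I" "v \<in> ipow I s"
    then have "u * (v * b) \<in> ipow I (Suc (s + r))"
      using Suc by (intro ipow_Suc_mult) auto
    then show "u * v \<in> {a. a * b \<in> ipow I (Suc s + r)}"
      by (simp only: mult.assoc mem_Collect_eq add_Suc)
  qed
  then show ?case using Suc.prems by blast
qed

lemma ipow_mono: "I \<subseteq> J \<Longrightarrow> ipow I s \<subseteq> ipow J s"
proof (induction s)
  case (Suc s)
  show ?case
    by (rule ipow_Suc_least[OF is_ideal_ipow]) (use Suc in \<open>blast intro: ipow_Suc_mult\<close>)
qed simp

lemma ipow_Suc_subset: "ipow I (Suc s) \<subseteq> ipow I s"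
  by (rule ipow_Suc_least[OF is_ideal_ipow]) (rule ideal_mult_left[OF is_ideal_ipow])

lemma ipow_antimono: "s \<le> r \<Longrightarrow> ipow I r \<subseteq> ipow I s"
proof (induction r rule: dec_induct)
  case (step r)
  then show ?case using ipow_Suc_subset[of I r] by (meson subset_trans)
qed simp

lemma ipow_power: "a \<in> ipow I s \<Longrightarrow> a ^ e \<in> ipow I (e * s)"
  by (induction e) (auto intro: ipow_mult)

lemma prime_ideal_power: "is_prime_ideal P \<Longrightarrow> a ^ e \<in> P \<Longrightarrow> a \<in> P"
proof (induction e)
  case 0
  then have "is_ideal P" "1 \<in> P" by (auto simp: is_prime_ideal_def)
  then have "P = UNIV" using ideal_mult_left[of P 1] by auto
  then show ?case using 0 by (simp add: is_prime_ideal_def)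
qed (auto simp: is_prime_ideal_def)

lemma prime_ideal_one: "is_prime_ideal P \<Longrightarrow> 1 \<notin> P"
  unfolding is_prime_ideal_def using ideal_mult_left[of P 1] by auto

lemma prime_ideal_mult: "is_prime_ideal P \<Longrightarrow> a * b \<in> P \<longleftrightarrow> a \<in> P \<or> b \<in> P"
  unfolding is_prime_ideal_def using ideal_mult_left ideal_mult_right by blast

lemma prime_ideal_prod:
  assumes "is_prime_ideal P" "finite F"
  shows "prod h F \<in> P \<longleftrightarrow> (\<exists>i\<in>F. h i \<in> P)"
  using assms(2,1) by (induction F rule: finite_induct) (auto simp: prime_ideal_one prime_ideal_mult)

lemma prime_is_ideal: "is_prime_ideal P \<Longrightarrow> is_ideal P"
  by (simp add: is_prime_ideal_def)

section \<open>Rewriting power products of generators\<close>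

definition gp :: "'b set \<Rightarrow> ('b \<Rightarrow> 'a::comm_ring_1) \<Rightarrow> ('b \<Rightarrow> nat) \<Rightarrow> 'a" where
  "gp J g \<alpha> = (\<Prod>i\<in>J. g i ^ \<alpha> i)"

definition wt :: "'b set \<Rightarrow> ('b \<Rightarrow> nat) \<Rightarrow> ('b \<Rightarrow> nat) \<Rightarrow> nat" where
  "wt J w \<alpha> = (\<Sum>i\<in>J. w i * \<alpha> i)"

abbreviation lev :: "'b set \<Rightarrow> ('b \<Rightarrow> nat) \<Rightarrow> nat" where
  "lev J \<equiv> wt J (\<lambda>_. 1)"

text \<open>Exponents are total functions; fixing them to be 0 off \<open>J\<close> makes them
  unique, so that sets of power products can be counted.\<close>

definition exps :: "'b set \<Rightarrow> ('b \<Rightarrow> nat) set" where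
  "exps J = {\<alpha>. \<forall>i. i \<notin> J \<longrightarrow> \<alpha> i = 0}"

lemma gp_add: "gp J g (\<lambda>i. \<alpha> i + \<beta> i) = gp J g \<alpha> * gp J g \<beta>"
  by (simp add: gp_def power_add prod.distrib)

lemma gp_zero [simp]: "gp J g (\<lambda>_. 0) = 1"
  by (simp add: gp_def)

lemma gp_unit:
  assumes "finite J" "j \<in> J"
  shows "gp J g (\<lambda>i. if i = j then 1 else 0) = g j"
proof -
  have "gp J g (\<lambda>i. if i = j then 1 else 0) = (\<Prod>i\<in>J. if i = j then g i else 1)"
    unfolding gp_def by (rule prod.cong) auto
  then show ?thesis using assms by simp
qed

lemma wt_add: "wt J w (\<lambda>i. \<alpha> i + \<beta> i) = wt J w \<alpha> + wt J w \<beta>"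
  by (simp add: wt_def sum.distrib algebra_simps)

lemma wt_zero [simp]: "wt J w (\<lambda>_. 0) = 0"
  by (simp add: wt_def)

lemma wt_unit: "finite J \<Longrightarrow> j \<in> J \<Longrightarrow> wt J w (\<lambda>i. if i = j then 1 else 0) = w j"
  by (simp add: wt_def if_distrib[of "\<lambda>x. _ * x"] cong: if_cong)

lemma exps_add: "\<alpha> \<in> exps J \<Longrightarrow> \<beta> \<in> exps J \<Longrightarrow> (\<lambda>i. \<alpha> i + \<beta> i) \<in> exps J"
  by (simp add: exps_def)

lemma gp_mem_ipow:
  assumes "finite J"
  shows "gp J g \<alpha> \<in> ipow (ideal_gen (g ` J)) (lev J \<alpha>)"
proof -
  let ?I = "ideal_gen (g ` J)"
  have "(\<Prod>i\<in>F. g i ^ \<alpha> i) \<in> ipow ?I (\<Sum>i\<in>F. \<alpha> i)" if "finite F" "F \<subseteq> J" for F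
    using that
  proof induction
    case (insert j F)
    have "g j \<in> ipow ?I (Suc 0)"
      unfolding ipow_1[OF is_ideal_ideal_gen]
      by (rule ideal_gen_superset[THEN subsetD]) (use insert in simp)
    from ipow_power[OF this, of "\<alpha> j"] show ?case
      using insert by (auto intro: ipow_mult)
  qed simp
  from this[OF assms order_refl] show ?thesis by (simp add: gp_def wt_def)
qed

text \<open>The head is rewritten, after multiplication by A H, into terms of the same order with respect
  to the generators but of smaller weight, plus terms of higher order.\<close>

definition rwrule :: "'n set \<Rightarrow> 'b set \<Rightarrow> ('b \<Rightarrow> ('n::finite, 'k::comm_ring_1) mpoly) \<Rightarrow> ('b \<Rightarrow> nat)
    \<Rightarrow> ('n, 'k) mpoly \<Rightarrow> ('n, 'k) mpoly \<Rightarrow> ('n \<Rightarrow>\<^sub>0 nat) \<times> ('b \<Rightarrow> nat) \<Rightarrow> bool" where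
  "rwrule Y J g w A H h \<longleftrightarrow> (\<exists>V1 c1 V2 c2. finite V1 \<and> finite V2 \<and> V1 \<subseteq> exps J \<and> V2 \<subseteq> exps J \<and>
     A * H * (mon (fst h) * gp J g (snd h)) =
       H * (\<Sum>\<nu>\<in>V1. c1 \<nu> * gp J g \<nu>) + (\<Sum>\<nu>\<in>V2. c2 \<nu> * gp J g \<nu>) \<and>
     (\<forall>\<nu>\<in>V1. lev J \<nu> = lev J (snd h) \<and>
        (\<forall>\<kappa>\<in>ks (c1 \<nu>). vdeg (- Y) \<kappa> + wt J w \<nu> < vdeg (- Y) (fst h) + wt J w (snd h))) \<and>
     (\<forall>\<nu>\<in>V2. lev J \<nu> = Suc (lev J (snd h))))"

definition reducible ::
  "(('n \<Rightarrow>\<^sub>0 nat) \<times> ('b \<Rightarrow> nat)) set \<Rightarrow> ('n \<Rightarrow>\<^sub>0 nat) \<Rightarrow> ('b \<Rightarrow> nat) \<Rightarrow> bool" where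
  "reducible heads \<gamma> \<alpha> \<longleftrightarrow>
     (\<exists>h\<in>heads. (\<forall>i. lk (fst h) i \<le> lk \<gamma> i) \<and> (\<forall>i. snd h i \<le> \<alpha> i))"

text \<open>Only the \<open>Y\<close>-degree of \<open>\<gamma>\<close> is bounded explicitly; in
  the applications the heads bound the other exponents. The factor
  \<open>H ^ (S - lev J \<alpha>)\<close> holds one \<open>H\<close> for each order still missing up
  to \<open>S\<close>, which is what the order-raising part of the rules consumes.\<close>

definition normal_forms where
  "normal_forms Y J g heads H S d =
     {H ^ (S - lev J \<alpha>) * (mon \<gamma> * gp J g \<alpha>) | \<gamma> \<alpha>.
        \<alpha> \<in> exps J \<and> lev J \<alpha> < S \<and> vdeg Y \<gamma> \<le> d \<and> \<not> reducible heads \<gamma> \<alpha>}"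

lemma normal_forms_mono: "d \<le> d' \<Longrightarrow> normal_forms Y J g heads H S d \<subseteq> normal_forms Y J g heads H S d'"
  unfolding normal_forms_def by fastforce

lemma subspace_span_plus:
  fixes U :: "('n, 'k::field) mpoly set"
  assumes U: "mp.subspace U"
  shows "mp.subspace {x. \<exists>z\<in>mp.span Z. x - z \<in> U}"
  unfolding mp.subspace_def
proof (intro conjI ballI allI)
  show "0 \<in> {x. \<exists>z\<in>mp.span Z. x - z \<in> U}"
    using mp.span_zero mp.subspace_0[OF U] by force
next
  fix x y assume "x \<in> {x. \<exists>z\<in>mp.span Z. x - z \<in> U}" "y \<in> {x. \<exists>z\<in>mp.span Z. x - z \<in> U}"
  then obtain z z' where z: "z \<in> mp.span Z" "x - z \<in> U" "z' \<in> mp.span Z" "y - z' \<in> U" by auto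
  have "x + y - (z + z') = (x - z) + (y - z')" by simp
  with z show "x + y \<in> {x. \<exists>z\<in>mp.span Z. x - z \<in> U}"
    using mp.span_add mp.subspace_add[OF U] by (metis (mono_tags, lifting) mem_Collect_eq)
next
  fix c x assume "x \<in> {x. \<exists>z\<in>mp.span Z. x - z \<in> U}"
  then obtain z where z: "z \<in> mp.span Z" "x - z \<in> U" by auto
  then have "psc c x - psc c z \<in> U" "psc c z \<in> mp.span Z"
    using mp.subspace_scale[OF U] mp.span_scale by (auto simp: mp.scale_right_diff_distrib[symmetric])
  then show "psc c x \<in> {x. \<exists>z\<in>mp.span Z. x - z \<in> U}" by blast
qed

lemma poly_mapping_nat_le_split:
  fixes \<beta> \<gamma> :: "'n \<Rightarrow>\<^sub>0 nat"
  assumes "\<forall>i. lk \<beta> i \<le> lk \<gamma> i"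
  shows "\<gamma> = \<beta> + (\<gamma> - \<beta>)"
  by (rule poly_mapping_eqI) (use assms in \<open>simp add: lookup_add lookup_minus\<close>)

text \<open>\<open>N\<close> is both the exponent of \<open>A\<close> and the fuel: one rule
  application consumes one \<open>A\<close> and lowers \<open>vdeg (- Y) \<gamma> + wt J w \<alpha>
  + C * (S - lev J \<alpha>)\<close> by at least one. Terms of order \<open>S\<close> or more vanish
  modulo the \<open>S\<close>-th power of the ideal. The \<open>Y\<close>-degree grows only linearly
  in \<open>N\<close>, which is what the counts rely on.\<close>

lemma rewriting:
  fixes g :: "'b \<Rightarrow> ('n::finite, 'k::field) mpoly"
  assumes fin: "finite J" "finite heads"
    and A: "deg_le (- Y) 0 A"
    and hY: "\<And>h. h \<in> heads \<Longrightarrow> vdeg Y (fst h) = 0"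
    and rules: "\<And>h. h \<in> heads \<Longrightarrow> rwrule Y J g w A H h"
  shows "\<exists>C>0. \<forall>N S \<gamma> \<alpha>. \<alpha> \<in> exps J \<longrightarrow> vdeg (- Y) \<gamma> + wt J w \<alpha> + C * (S - lev J \<alpha>) \<le> N \<longrightarrow>
     (\<exists>z\<in>mp.span (normal_forms Y J g heads H S (vdeg Y \<gamma> + C * N)).
        A ^ N * (H ^ (S - lev J \<alpha>) * (mon \<gamma> * gp J g \<alpha>)) - z \<in> ipow (ideal_gen (g ` J)) S)"
proof -
  let ?G = "gp J g" and ?l = "lev J" and ?w = "wt J w"
  define P where "P = (\<lambda>h V1 c1 V2 c2. finite V1 \<and> finite V2 \<and> V1 \<subseteq> exps J \<and> V2 \<subseteq> exps J \<and>
     A * H * (mon (fst h) * ?G (snd h)) = H * (\<Sum>\<nu>\<in>V1. c1 \<nu> * ?G \<nu>) + (\<Sum>\<nu>\<in>V2. c2 \<nu> * ?G \<nu>) \<and>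
     (\<forall>\<nu>\<in>V1. ?l \<nu> = ?l (snd h) \<and>
        (\<forall>\<kappa>\<in>ks (c1 \<nu>). vdeg (- Y) \<kappa> + ?w \<nu> < vdeg (- Y) (fst h) + ?w (snd h))) \<and>
     (\<forall>\<nu>\<in>V2. ?l \<nu> = Suc (?l (snd h))))"
  have "\<forall>h\<in>heads. \<exists>V1 c1 V2 c2. P h V1 c1 V2 c2"
    using rules unfolding rwrule_def P_def by blast
  from bchoice[OF this] obtain V1 where "\<forall>h\<in>heads. \<exists>c1 V2 c2. P h (V1 h) c1 V2 c2" ..
  from bchoice[OF this] obtain c1 where "\<forall>h\<in>heads. \<exists>V2 c2. P h (V1 h) (c1 h) V2 c2" ..
  from bchoice[OF this] obtain V2 where "\<forall>h\<in>heads. \<exists>c2. P h (V1 h) (c1 h) (V2 h) c2" ..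
  from bchoice[OF this] obtain c2 where P: "\<forall>h\<in>heads. P h (V1 h) (c1 h) (V2 h) (c2 h)" ..
  have
    V: "\<And>h. h \<in> heads \<Longrightarrow> finite (V1 h) \<and> finite (V2 h) \<and> V1 h \<subseteq> exps J \<and> V2 h \<subseteq> exps J"
    and eq: "\<And>h. h \<in> heads \<Longrightarrow> A * H * (mon (fst h) * ?G (snd h)) =
       H * (\<Sum>\<nu>\<in>V1 h. c1 h \<nu> * ?G \<nu>) + (\<Sum>\<nu>\<in>V2 h. c2 h \<nu> * ?G \<nu>)"
    and V1: "\<And>h \<nu>. h \<in> heads \<Longrightarrow> \<nu> \<in> V1 h \<Longrightarrow> ?l \<nu> = ?l (snd h)"
      "\<And>h \<nu> \<kappa>. h \<in> heads \<Longrightarrow> \<nu> \<in> V1 h \<Longrightarrow> \<kappa> \<in> ks (c1 h \<nu>) \<Longrightarrow>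
         vdeg (- Y) \<kappa> + ?w \<nu> < vdeg (- Y) (fst h) + ?w (snd h)"
    and V2: "\<And>h \<nu>. h \<in> heads \<Longrightarrow> \<nu> \<in> V2 h \<Longrightarrow> ?l \<nu> = Suc (?l (snd h))"
    using P unfolding P_def by blast+
  have "finite (insert A ((\<Union>h\<in>heads. c1 h ` V1 h) \<union> (\<Union>h\<in>heads. c2 h ` V2 h)))"
    using fin V by auto
  then obtain E where E: "deg_le UNIV E A"
     "\<And>h \<nu>. h \<in> heads \<Longrightarrow> \<nu> \<in> V1 h \<Longrightarrow> deg_le UNIV E (c1 h \<nu>)"
     "\<And>h \<nu>. h \<in> heads \<Longrightarrow> \<nu> \<in> V2 h \<Longrightarrow> deg_le UNIV E (c2 h \<nu>)"
    by (drule_tac finite_deg_bound) blast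
  have "finite (\<Union>h\<in>heads. ?w ` V2 h)" using fin V by auto
  then obtain W where W: "\<And>h \<nu>. h \<in> heads \<Longrightarrow> \<nu> \<in> V2 h \<Longrightarrow> ?w \<nu> \<le> W"
    unfolding finite_nat_set_iff_bounded_le by blast
  \<comment> \<open>Raising the order by one releases \<open>C\<close> units of the measure:
    \<open>E\<close> pays for the degree of the new coefficient, \<open>W\<close> for the weight of
    the new exponent, and 1 is the actual decrease.\<close>
  define C where "C = E + W + 1"
  let ?I = "ideal_gen (g ` J)"
  define T where "T = (\<lambda>S d. {x. \<exists>z\<in>mp.span (normal_forms Y J g heads H S d). x - z \<in> ipow ?I S})"
  have subT: "mp.subspace (T S d)" for S d
    unfolding T_def by (intro subspace_span_plus subspace_ideal is_ideal_ipow)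
  have Tmono: "T S d \<subseteq> T S d'" if "d \<le> d'" for S d d'
    unfolding T_def using mp.span_mono[OF normal_forms_mono[OF that]] by blast
  have vY: "vdeg Y \<kappa> \<le> vdeg UNIV \<kappa>" "vdeg (- Y) \<kappa> \<le> vdeg UNIV \<kappa>" for \<kappa>
    by (simp_all add: vdeg_mono)
  have main: "A ^ N * (H ^ (S - ?l \<alpha>) * (mon \<gamma> * ?G \<alpha>)) \<in> T S (vdeg Y \<gamma> + C * N)"
    if "\<alpha> \<in> exps J" "vdeg (- Y) \<gamma> + ?w \<alpha> + C * (S - ?l \<alpha>) \<le> N" for N S \<gamma> \<alpha>
    using that
  proof (induction N arbitrary: \<gamma> \<alpha> rule: less_induct)
    case (less N)
    consider "S \<le> ?l \<alpha>" | "?l \<alpha> < S" "\<not> reducible heads \<gamma> \<alpha>" | "?l \<alpha> < S" "reducible heads \<gamma> \<alpha>"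
      by linarith
    then show ?case
    proof cases
      case 1
      have "?G \<alpha> \<in> ipow ?I S"
        using gp_mem_ipow[OF fin(1), of g \<alpha>] ipow_antimono[OF 1, of ?I] by blast
      then have "A ^ N * (H ^ (S - ?l \<alpha>) * (mon \<gamma> * ?G \<alpha>)) - 0 \<in> ipow ?I S"
        by (simp add: ideal_mult_left is_ideal_ipow)
      then show ?thesis unfolding T_def using mp.span_zero by blast
    next
      case 2
      show ?thesis
      proof (rule subspace_mult_memI[OF subT])
        fix \<kappa> assume \<kappa>: "\<kappa> \<in> ks (A ^ N)"
        have "vdeg UNIV \<kappa> \<le> N * E" "vdeg (- Y) \<kappa> = 0"
          using deg_le_power[OF E(1), of N] deg_le_power[OF A, of N] \<kappa> by (auto simp: deg_le_def)
        moreover have "N * E \<le> C * N" by (simp add: C_def algebra_simps)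
        ultimately have k: "vdeg Y \<kappa> \<le> C * N" "\<And>i. i \<notin> Y \<Longrightarrow> lk \<kappa> i = 0"
          using vY(1)[of \<kappa>] lookup_le_vdeg[of _ "- Y" \<kappa>] by (linarith, fastforce)
        \<comment> \<open>The monomials of \<open>A ^ N\<close> involve only \<open>Y\<close>, the
          heads involve no variable of \<open>Y\<close>; so multiplication by \<open>A ^ N\<close>
          cannot make an irreducible term reducible.\<close>
        have "\<not> reducible heads (\<kappa> + \<gamma>) \<alpha>"
        proof
          assume "reducible heads (\<kappa> + \<gamma>) \<alpha>"
          then obtain h where h: "h \<in> heads" "\<forall>i. lk (fst h) i \<le> lk \<kappa> i + lk \<gamma> i" "\<forall>i. snd h i \<le> \<alpha> i"
            by (auto simp: reducible_def lookup_add)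
          have "lk (fst h) i \<le> lk \<gamma> i" for i
            using h(2)[rule_format, of i] k(2)[of i] hY[OF h(1)] lookup_le_vdeg[of i Y "fst h"]
            by (cases "i \<in> Y") auto
          then show False using 2(2) h by (auto simp: reducible_def)
        qed
        then have "H ^ (S - ?l \<alpha>) * (mon (\<kappa> + \<gamma>) * ?G \<alpha>) \<in> normal_forms Y J g heads H S (vdeg Y \<gamma> + C * N)"
          unfolding normal_forms_def using less.prems 2 k by fastforce
        moreover have "mon \<kappa> * (H ^ (S - ?l \<alpha>) * (mon \<gamma> * ?G \<alpha>)) = H ^ (S - ?l \<alpha>) * (mon (\<kappa> + \<gamma>) * ?G \<alpha>)"
          by (simp add: mon_add algebra_simps)
        ultimately show "mon \<kappa> * (H ^ (S - ?l \<alpha>) * (mon \<gamma> * ?G \<alpha>)) \<in> T S (vdeg Y \<gamma> + C * N)"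
          unfolding T_def using mp.span_base ideal_zero[OF is_ideal_ipow, of ?I S]
          by (metis (mono_tags, lifting) diff_self mem_Collect_eq)
      qed
    next
      case 3
      then obtain h where h: "h \<in> heads" "\<forall>i. lk (fst h) i \<le> lk \<gamma> i" "\<forall>i. snd h i \<le> \<alpha> i"
        by (auto simp: reducible_def)
      define \<gamma>' where "\<gamma>' = \<gamma> - fst h"
      have \<gamma>: "\<gamma> = fst h + \<gamma>'" unfolding \<gamma>'_def by (rule poly_mapping_nat_le_split) (rule h)
      define \<alpha>' where "\<alpha>' = (\<lambda>i. \<alpha> i - snd h i)"
      have \<alpha>: "\<alpha> = (\<lambda>i. snd h i + \<alpha>' i)" using h by (auto simp: \<alpha>'_def)
      have \<alpha>'e: "\<alpha>' \<in> exps J" using less.prems by (auto simp: exps_def \<alpha>'_def)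
      have l\<alpha>: "?l \<alpha> = ?l (snd h) + ?l \<alpha>'" and w\<alpha>: "?w \<alpha> = ?w (snd h) + ?w \<alpha>'"
        unfolding \<alpha> wt_add by simp_all
      obtain s where s: "S - ?l \<alpha> = Suc s" using 3(1) by (metis Suc_diff_Suc)
      have Np: "N > 0" using less.prems(2) s by (simp add: C_def)
      then obtain M where M: "N = Suc M" by (cases N) auto
      have "A ^ N * (H ^ (S - ?l \<alpha>) * (mon \<gamma> * ?G \<alpha>)) =
        A ^ M * (H ^ s * (mon \<gamma>' * ?G \<alpha>')) * (A * H * (mon (fst h) * ?G (snd h)))"
      proof -
        have "?G \<alpha> = ?G (snd h) * ?G \<alpha>'" by (subst \<alpha>) (rule gp_add)
        then show ?thesis unfolding s M by (simp add: \<gamma> mon_add algebra_simps)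
      qed
      \<comment> \<open>The first sum still contains the factor \<open>H\<close> of the rule and
        keeps its order; the second has lost one \<open>H\<close> and gained one order. In both the
        power of \<open>H\<close> remains \<open>S\<close> minus the order.\<close>
      also have "\<dots> = (\<Sum>\<nu>\<in>V1 h. c1 h \<nu> * (A ^ M * (H ^ Suc s * (mon \<gamma>' * ?G (\<lambda>i. \<nu> i + \<alpha>' i))))) +
          (\<Sum>\<nu>\<in>V2 h. c2 h \<nu> * (A ^ M * (H ^ s * (mon \<gamma>' * ?G (\<lambda>i. \<nu> i + \<alpha>' i)))))"
        unfolding eq[OF h(1)] gp_add
        by (simp add: sum_distrib_left sum_distrib_right algebra_simps)
      also have "\<dots> \<in> T S (vdeg Y \<gamma> + C * N)"
      proof (rule mp.subspace_add[OF subT]; rule mp.subspace_sum[OF subT]; rule subspace_mult_memI[OF subT])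
        fix \<nu> \<kappa> assume \<nu>: "\<nu> \<in> V1 h" "\<kappa> \<in> ks (c1 h \<nu>)"
        have ex: "(\<lambda>i. \<nu> i + \<alpha>' i) \<in> exps J" using V[OF h(1)] \<nu> \<alpha>'e by (blast intro: exps_add)
        have lv: "S - ?l (\<lambda>i. \<nu> i + \<alpha>' i) = Suc s" using s V1(1)[OF h(1) \<nu>(1)] l\<alpha> by (simp add: wt_add)
        have "vdeg (- Y) (\<kappa> + \<gamma>') + ?w (\<lambda>i. \<nu> i + \<alpha>' i) + C * Suc s \<le> M"
          using V1(2)[OF h(1) \<nu>] less.prems(2) unfolding s w\<alpha> M wt_add by (simp add: \<gamma>)
        then have "A ^ M * (H ^ Suc s * (mon (\<kappa> + \<gamma>') * ?G (\<lambda>i. \<nu> i + \<alpha>' i))) \<in> T S (vdeg Y (\<kappa> + \<gamma>') + C * M)"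
          using less.IH[of M, OF _ ex, of "\<kappa> + \<gamma>'"] unfolding lv M by simp
        moreover have "vdeg Y \<kappa> \<le> E"
          using E(2)[OF h(1) \<nu>(1)] \<nu>(2) vY(1)[of \<kappa>] unfolding deg_le_def by (meson le_trans)
        then have "vdeg Y (\<kappa> + \<gamma>') + C * M \<le> vdeg Y \<gamma> + C * N" by (simp add: M C_def \<gamma>)
        ultimately show "mon \<kappa> * (A ^ M * (H ^ Suc s * (mon \<gamma>' * ?G (\<lambda>i. \<nu> i + \<alpha>' i)))) \<in> T S (vdeg Y \<gamma> + C * N)"
          using Tmono by (auto simp: mon_add mult.left_commute mult.assoc)
      next
        fix \<nu> \<kappa> assume \<nu>: "\<nu> \<in> V2 h" "\<kappa> \<in> ks (c2 h \<nu>)"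
        have ex: "(\<lambda>i. \<nu> i + \<alpha>' i) \<in> exps J" using V[OF h(1)] \<nu> \<alpha>'e by (blast intro: exps_add)
        have lv: "S - ?l (\<lambda>i. \<nu> i + \<alpha>' i) = s" using s V2[OF h(1) \<nu>(1)] l\<alpha> by (simp add: wt_add)
        have uE: "vdeg UNIV \<kappa> \<le> E" using E(3)[OF h(1) \<nu>(1)] \<nu>(2) unfolding deg_le_def by blast
        have "vdeg (- Y) (\<kappa> + \<gamma>') + ?w (\<lambda>i. \<nu> i + \<alpha>' i) + C * s \<le> M"
          using uE vY(2)[of \<kappa>] W[OF h(1) \<nu>(1)] less.prems(2) unfolding s w\<alpha> M wt_add by (simp add: \<gamma> C_def)
        then have "A ^ M * (H ^ s * (mon (\<kappa> + \<gamma>') * ?G (\<lambda>i. \<nu> i + \<alpha>' i))) \<in> T S (vdeg Y (\<kappa> + \<gamma>') + C * M)"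
          using less.IH[of M, OF _ ex, of "\<kappa> + \<gamma>'"] unfolding lv M by simp
        moreover have "vdeg Y (\<kappa> + \<gamma>') + C * M \<le> vdeg Y \<gamma> + C * N"
          using uE vY(1)[of \<kappa>] by (simp add: M C_def \<gamma>)
        ultimately show "mon \<kappa> * (A ^ M * (H ^ s * (mon \<gamma>' * ?G (\<lambda>i. \<nu> i + \<alpha>' i)))) \<in> T S (vdeg Y \<gamma> + C * N)"
          using Tmono by (auto simp: mon_add mult.left_commute mult.assoc)
      qed
      finally show ?thesis .
    qed
  qed
  show ?thesis
    by (rule exI[of _ C]) (use main in \<open>auto simp: T_def C_def\<close>)
qed

text \<open>A factor from k[Y] does not change degrees outside \<open>Y\<close>, and an extra
  \<open>H'\<close> passes through both sides. Finitely many rules can therefore share their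
  multipliers.\<close>

lemma rwrule_mult:
  assumes r: "rwrule Y J g w A H h" and A': "deg_le (- Y) 0 A'"
  shows "rwrule Y J g w (A * A') (H * H') h"
proof -
  obtain V1 c1 V2 c2 where V: "finite V1" "finite V2" "V1 \<subseteq> exps J" "V2 \<subseteq> exps J"
    and eq: "A * H * (mon (fst h) * gp J g (snd h)) =
       H * (\<Sum>\<nu>\<in>V1. c1 \<nu> * gp J g \<nu>) + (\<Sum>\<nu>\<in>V2. c2 \<nu> * gp J g \<nu>)"
    and V1: "\<forall>\<nu>\<in>V1. lev J \<nu> = lev J (snd h) \<and>
        (\<forall>\<kappa>\<in>ks (c1 \<nu>). vdeg (- Y) \<kappa> + wt J w \<nu> < vdeg (- Y) (fst h) + wt J w (snd h))"
    and V2: "\<forall>\<nu>\<in>V2. lev J \<nu> = Suc (lev J (snd h))"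
    using r unfolding rwrule_def by blast
  have k: "\<exists>\<kappa>'\<in>ks p. vdeg (- Y) \<kappa> = vdeg (- Y) \<kappa>'" if \<kappa>: "\<kappa> \<in> ks (A' * p)" for \<kappa> p
  proof -
    obtain a b where "a \<in> ks A'" "b \<in> ks p" "\<kappa> = a + b" using keys_mult[of A' p] \<kappa> by blast
    then show ?thesis using A' by (auto simp: deg_le_def)
  qed
  have "A * A' * (H * H') * (mon (fst h) * gp J g (snd h)) = A' * H' * (A * H * (mon (fst h) * gp J g (snd h)))"
    by (simp add: algebra_simps)
  also have "\<dots> = H * H' * (\<Sum>\<nu>\<in>V1. (A' * c1 \<nu>) * gp J g \<nu>) + (\<Sum>\<nu>\<in>V2. (A' * H' * c2 \<nu>) * gp J g \<nu>)"
    unfolding eq by (simp add: algebra_simps sum_distrib_left)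
  finally have eq': "A * A' * (H * H') * (mon (fst h) * gp J g (snd h)) =
      H * H' * (\<Sum>\<nu>\<in>V1. (A' * c1 \<nu>) * gp J g \<nu>) + (\<Sum>\<nu>\<in>V2. (A' * H' * c2 \<nu>) * gp J g \<nu>)" .
  have V1': "\<forall>\<nu>\<in>V1. lev J \<nu> = lev J (snd h) \<and>
        (\<forall>\<kappa>\<in>ks (A' * c1 \<nu>). vdeg (- Y) \<kappa> + wt J w \<nu> < vdeg (- Y) (fst h) + wt J w (snd h))"
    using V1 k by metis
  show ?thesis unfolding rwrule_def
    using V eq' V1' V2 by (intro exI conjI) assumption+
qed

section \<open>Independent sets of variables\<close>

text \<open>The variables in \<open>Y\<close> are algebraically independent modulo \<open>Q\<close>:
  the intersection of \<open>Q\<close> with k[Y] is zero.\<close>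

definition indep_mod :: "('n::finite, 'k::comm_ring_1) mpoly set \<Rightarrow> 'n set \<Rightarrow> bool" where
  "indep_mod Q Y \<longleftrightarrow> (\<forall>p\<in>Q. deg_le (- Y) 0 p \<longrightarrow> p = 0)"

text \<open>Maximality is stated through the polynomials that witness it, because their leading
  terms become the heads of rewriting rules.\<close>

definition maxindep_mod :: "('n::finite, 'k::comm_ring_1) mpoly set \<Rightarrow> 'n set \<Rightarrow> bool" where
  "maxindep_mod Q Y \<longleftrightarrow> indep_mod Q Y \<and>
     (\<forall>i. i \<notin> Y \<longrightarrow> (\<exists>p\<in>Q. p \<noteq> 0 \<and> deg_le (- insert i Y) 0 p))"

lemma maxindep_mod_iff: "maxindep_mod Q Y \<longleftrightarrow> indep_mod Q Y \<and> (\<forall>i. i \<notin> Y \<longrightarrow> \<not> indep_mod Q (insert i Y))"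
  by (auto simp: maxindep_mod_def indep_mod_def)

text \<open>The common multipliers are the products of the individual ones; primality keeps them
  outside \<open>Q\<close>.\<close>

lemma common_rules:
  assumes Q: "is_prime_ideal Q" and ind: "indep_mod Q Y" and fin: "finite heads"
    and r: "\<And>h. h \<in> heads \<Longrightarrow>
       \<exists>A H. deg_le (- Y) 0 A \<and> A \<notin> Q \<and> H \<notin> Q \<and> rwrule Y J g w A H h"
  shows "\<exists>A H. deg_le (- Y) 0 A \<and> A \<notin> Q \<and> H \<notin> Q \<and> (\<forall>h\<in>heads. rwrule Y J g w A H h)"
  using fin r
proof (induction heads rule: finite_induct)
  case empty
  then show ?case using prime_ideal_one[OF Q] by (auto intro!: exI[of _ 1])
next
  case (insert h F)
  obtain A H where 1: "deg_le (- Y) 0 A" "A \<notin> Q" "H \<notin> Q" "\<forall>h\<in>F. rwrule Y J g w A H h"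
    using insert by (metis insertCI)
  obtain A' H' where 2: "deg_le (- Y) 0 A'" "A' \<notin> Q" "H' \<notin> Q" "rwrule Y J g w A' H' h"
    using insert.prems by blast
  have "rwrule Y J g w (A * A') (H * H') h"
    using rwrule_mult[OF 2(4) 1(1), of H] by (simp add: mult.commute)
  then show ?case
    using 1 2 deg_le_mult[OF 1(1) 2(1)] rwrule_mult[OF _ 2(1), of J g w A H _ H']
    by (rule_tac exI[of _ "A * A'"], rule_tac exI[of _ "H * H'"]) (auto simp: prime_ideal_mult[OF Q])
qed

definition deg_lt :: "'n set \<Rightarrow> nat \<Rightarrow> ('n::finite, 'k::zero) mpoly \<Rightarrow> bool" where
  "deg_lt V d p \<longleftrightarrow> (\<forall>\<gamma>\<in>ks p. vdeg V \<gamma> < d)"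

lemma deg_lt_add: "deg_lt V d p \<Longrightarrow> deg_lt V d q \<Longrightarrow> deg_lt V d (p + q)"
  using keys_add[of p q] by (auto simp: deg_lt_def)

lemma deg_lt_uminus: "deg_lt V d p \<Longrightarrow> deg_lt V d (- p :: ('n::finite, 'k::comm_ring_1) mpoly)"
  by (auto simp: deg_lt_def in_keys_iff)

lemma deg_lt_mult: "deg_le V d p \<Longrightarrow> deg_lt V e q \<Longrightarrow> deg_lt V (d + e) (p * q)"
  for p :: "('n::finite, 'k::comm_ring_1) mpoly"
  using keys_mult[of p q] by (fastforce simp: deg_lt_def deg_le_def intro: add_le_less_mono)

lemma deg_lt_imp_le: "deg_lt V d p \<Longrightarrow> deg_le V d p"
  by (auto simp: deg_lt_def deg_le_def intro: less_imp_le)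

text \<open>The polynomial involves only \<open>i\<close> and \<open>Y\<close>, so it is a
  polynomial in one variable over k[Y]; \<open>e\<close> is its degree and \<open>a\<close> its
  leading coefficient.\<close>

lemma leading_term:
  fixes p :: "('n::finite, 'k::comm_ring_1) mpoly"
  assumes p: "p \<noteq> 0" "deg_le (- insert i Y) 0 p" and i: "i \<notin> Y"
  shows "\<exists>e a l. p = a * mon (sgl i e) + l \<and> a \<noteq> 0 \<and> deg_le (- Y) 0 a \<and> deg_lt (- Y) e l"
proof -
  define e where "e = Max ((\<lambda>\<kappa>. lk \<kappa> i) ` ks p)"
  have ne: "ks p \<noteq> {}" using p by simp
  have e_ge: "lk \<kappa> i \<le> e" if "\<kappa> \<in> ks p" for \<kappa> unfolding e_def using that by (auto intro: Max_ge)
  obtain \<kappa>0 where \<kappa>0: "\<kappa>0 \<in> ks p" "lk \<kappa>0 i = e"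
    using Max_in[of "(\<lambda>\<kappa>. lk \<kappa> i) ` ks p"] ne unfolding e_def by fastforce
  define F where "F = {\<kappa>\<in>ks p. lk \<kappa> i = e}"
  define a where "a = (\<Sum>\<kappa>\<in>F. psc (lk p \<kappa>) (mon (\<kappa> - sgl i e)))"
  define l where "l = (\<Sum>\<kappa>\<in>ks p - F. psc (lk p \<kappa>) (mon \<kappa>))"
  have FF: "finite F" "F \<subseteq> ks p" by (auto simp: F_def)
  have nd: "vdeg (- Y) \<kappa> = lk \<kappa> i" if "\<kappa> \<in> ks p" for \<kappa>
  proof -
    have "- Y = insert i (- insert i Y)" using i by auto
    then have "vdeg (- Y) \<kappa> = lk \<kappa> i + vdeg (- insert i Y) \<kappa>"
      unfolding vdeg_def by (metis ComplD finite insertI1 sum.insert)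
    then show ?thesis using p(2) that by (simp add: deg_le_def)
  qed
  have sp: "\<kappa> = sgl i e + (\<kappa> - sgl i e)" if "\<kappa> \<in> F" for \<kappa>
    by (rule poly_mapping_nat_le_split) (use that in \<open>auto simp: F_def lookup_single when_def\<close>)
  have aF: "a * mon (sgl i e) = (\<Sum>\<kappa>\<in>F. psc (lk p \<kappa>) (mon \<kappa>))"
    unfolding a_def sum_distrib_right
  proof (rule sum.cong)
    fix \<kappa> assume "\<kappa> \<in> F"
    then have "mon \<kappa> = mon (sgl i e) * (mon (\<kappa> - sgl i e) :: ('n,'k) mpoly)"
      using sp mon_add by metis
    then show "psc (lk p \<kappa>) (mon (\<kappa> - sgl i e)) * mon (sgl i e) = psc (lk p \<kappa>) (mon \<kappa>)"
      unfolding psc_mult_left by (simp add: mult.commute)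
  qed simp
  have "p = a * mon (sgl i e) + l"
    unfolding aF l_def using mpoly_expand[of p]
      sum.subset_diff[OF FF(2) finite_keys, of "\<lambda>\<kappa>. psc (lk p \<kappa>) (mon \<kappa>)"] by (simp add: add.commute)
  moreover have "a \<noteq> 0"
  proof
    assume "a = 0"
    then have "lk (\<Sum>\<kappa>\<in>F. psc (lk p \<kappa>) (mon \<kappa>)) \<kappa>0 = 0" using aF by simp
    then have "(\<Sum>\<kappa>\<in>F. lk p \<kappa> when \<kappa> = \<kappa>0) = 0" by (simp add: lookup_sum psc_mon lookup_single)
    then have "lk p \<kappa>0 = 0" using \<kappa>0 FF by (simp add: when_def F_def)
    then show False using \<kappa>0 by (simp add: in_keys_iff)
  qed
  moreover have "deg_le (- Y) 0 a"
    unfolding a_def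
  proof (intro deg_le_sum deg_le_psc)
    fix \<kappa> assume \<kappa>: "\<kappa> \<in> F"
    then have "vdeg (- Y) \<kappa> = e" using nd by (auto simp: F_def)
    moreover have "vdeg (- Y) \<kappa> = e + vdeg (- Y) (\<kappa> - sgl i e)"
      by (subst sp[OF \<kappa>], subst vdeg_add) (simp add: i)
    ultimately show "deg_le (- Y) 0 (mon (\<kappa> - sgl i e) :: ('n,'k) mpoly)"
      by (simp add: deg_le_mon)
  qed
  moreover have "deg_lt (- Y) e l"
  proof -
    have "ks l \<subseteq> ks p - F"
      unfolding l_def using keys_sum[of "\<lambda>\<kappa>. psc (lk p \<kappa>) (mon \<kappa>)" "ks p - F"]
      by (auto simp: psc_mon split: if_splits)
    then show ?thesis using nd e_ge by (fastforce simp: deg_lt_def F_def)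
  qed
  ultimately show ?thesis by blast
qed

lemma leading_term_power:
  fixes a l :: "('n::finite, 'k::comm_ring_1) mpoly"
  assumes "deg_le (- Y) 0 a" "deg_lt (- Y) e l" "i \<notin> Y"
  shows "\<exists>l'. (a * mon (sgl i e) + l) ^ m = a ^ m * mon (sgl i (m * e)) + l'
     \<and> deg_lt (- Y) (m * e) l'"
proof (induction m)
  case 0
  show ?case by (rule exI[of _ 0]) (simp add: deg_lt_def)
next
  case (Suc m)
  let ?X = "\<lambda>e. mon (sgl i e) :: ('n, 'k) mpoly"
  obtain l' where l': "(a * ?X e + l) ^ m = a ^ m * ?X (m * e) + l'" "deg_lt (- Y) (m * e) l'"
    using Suc by blast
  have X: "?X e * ?X (m * e) = ?X (Suc m * e)" by (simp add: mon_add[symmetric] single_add[symmetric])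
  have "(a * ?X e + l) ^ Suc m = (a * ?X e + l) * (a ^ m * ?X (m * e) + l')" using l' by simp
  also have "\<dots> = a ^ Suc m * (?X e * ?X (m * e)) + ((a * ?X e + l) * l' + a ^ m * ?X (m * e) * l)"
    by (simp add: algebra_simps)
  finally have "(a * ?X e + l) ^ Suc m = a ^ Suc m * ?X (Suc m * e) + ((a * ?X e + l) * l' + a ^ m * ?X (m * e) * l)"
    unfolding X .
  moreover have "deg_lt (- Y) (Suc m * e) ((a * ?X e + l) * l' + a ^ m * ?X (m * e) * l)"
  proof (rule deg_lt_add)
    have Xd: "deg_le (- Y) e (?X e)" for e by (simp add: deg_le_mon)
    have "deg_le (- Y) e (a * ?X e + l)"
      using deg_le_mult[OF assms(1) Xd[of e]] deg_lt_imp_le[OF assms(2)] by (auto intro: deg_le_add)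
    from deg_lt_mult[OF this l'(2)] show "deg_lt (- Y) (Suc m * e) ((a * ?X e + l) * l')" by simp
    have "deg_le (- Y) (m * e) (a ^ m * ?X (m * e))"
      using deg_le_mult[OF deg_le_power[OF assms(1), of m] Xd[of "m * e"]] by simp
    from deg_lt_mult[OF this assms(2)] show "deg_lt (- Y) (Suc m * e) (a ^ m * ?X (m * e) * l)"
      by (simp add: add.commute)
  qed
  ultimately show ?case by blast
qed

section \<open>Counting exponent vectors\<close>

lemma box_card:
  fixes b :: "'n::finite \<Rightarrow> nat"
  shows "finite {\<gamma> :: 'n \<Rightarrow>\<^sub>0 nat. \<forall>i. lk \<gamma> i < b i}"
    and "card {\<gamma> :: 'n \<Rightarrow>\<^sub>0 nat. \<forall>i. lk \<gamma> i < b i} = (\<Prod>i\<in>UNIV. b i)"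
proof -
  let ?B = "{\<gamma> :: 'n \<Rightarrow>\<^sub>0 nat. \<forall>i. lk \<gamma> i < b i}"
  have bij: "bij_betw lk ?B (PiE UNIV (\<lambda>i. {..<b i}))"
  proof (rule bij_betw_imageI)
    show "inj_on lk ?B" by (rule inj_onI) (simp only: poly_mapping_eq_iff)
    show "lk ` ?B = PiE UNIV (\<lambda>i. {..<b i})"
    proof
      show "PiE UNIV (\<lambda>i. {..<b i}) \<subseteq> lk ` ?B"
      proof
        fix f assume f: "f \<in> PiE UNIV (\<lambda>i. {..<b i})"
        have "lk (Abs_poly_mapping f) = f" by simp
        moreover have "f i < b i" for i using PiE_mem[OF f, of i] by simp
        ultimately show "f \<in> lk ` ?B" by (intro image_eqI[of _ _ "Abs_poly_mapping f"]) simp_all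
      qed
    qed auto
  qed
  show "finite ?B" using bij_betw_finite[OF bij] by (simp add: finite_PiE)
  show "card ?B = (\<Prod>i\<in>UNIV. b i)" using bij_betw_same_card[OF bij] by (simp add: card_PiE)
qed

lemma finite_vdeg_le: "finite {\<gamma> :: 'n::finite \<Rightarrow>\<^sub>0 nat. vdeg UNIV \<gamma> \<le> d}"
  and card_vdeg_le: "card {\<gamma> :: 'n::finite \<Rightarrow>\<^sub>0 nat. vdeg UNIV \<gamma> \<le> d} \<le> (d + 1) ^ CARD('n)"
proof -
  have sub: "{\<gamma> :: 'n \<Rightarrow>\<^sub>0 nat. vdeg UNIV \<gamma> \<le> d} \<subseteq> {\<gamma>. \<forall>i. lk \<gamma> i < (\<lambda>_. d + 1) i}"
    using lookup_le_vdeg[of _ UNIV] by (auto simp: less_Suc_eq_le intro: le_trans)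
  show "finite {\<gamma> :: 'n::finite \<Rightarrow>\<^sub>0 nat. vdeg UNIV \<gamma> \<le> d}"
    by (rule finite_subset[OF sub box_card(1)])
  show "card {\<gamma> :: 'n::finite \<Rightarrow>\<^sub>0 nat. vdeg UNIV \<gamma> \<le> d} \<le> (d + 1) ^ CARD('n)"
    using card_mono[OF box_card(1) sub] unfolding box_card(2) by simp
qed

lemma prod_if_split:
  fixes P :: "'n::finite \<Rightarrow> nat"
  shows "(\<Prod>i\<in>UNIV. if i \<in> Y then c else P i) = c ^ card Y * (\<Prod>i\<in>-Y. P i)"
proof -
  have "(\<Prod>i\<in>UNIV. if i \<in> Y then c else P i) =
     (\<Prod>i\<in>Y. if i \<in> Y then c else P i) * (\<Prod>i\<in>-Y. if i \<in> Y then c else P i)"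
    using prod.subset_diff[OF subset_UNIV[of Y] finite, of "\<lambda>i. if i \<in> Y then c else P i"]
    by (simp add: Compl_eq_Diff_UNIV mult.commute)
  then show ?thesis by simp
qed

lemma lev_eq_0: "finite J \<Longrightarrow> \<alpha> \<in> exps J \<Longrightarrow> lev J \<alpha> = 0 \<Longrightarrow> \<alpha> = (\<lambda>_. 0)"
  by (rule ext) (auto simp: wt_def exps_def)

text \<open>The residue class of \<open>a\<close> is algebraic over k(Y), since each variable is. A
  relation between its powers with nonzero constant term exhibits a multiple of \<open>a\<close>
  lying in k[Y] modulo \<open>Q\<close>. The relation is found by counting: monomials in
  \<open>Y\<close> times powers of \<open>a\<close> outnumber the normal forms.\<close>

lemma algebraic_mod_prime:
  fixes a :: "('n::finite, 'k::field) mpoly"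
  assumes Q: "is_prime_ideal Q" and Y: "maxindep_mod Q Y" and a: "a \<notin> Q"
  shows "\<exists>c a'. deg_le (- Y) 0 c \<and> c \<noteq> 0 \<and> c + a * a' \<in> Q"
proof -
  have ind: "indep_mod Q Y" using Y by (simp add: maxindep_mod_def)
  have nQ: "c \<notin> Q" if "deg_le (- Y) 0 c" "c \<noteq> 0" for c using ind that by (auto simp: indep_mod_def)
  have QI: "is_ideal Q" by (rule prime_is_ideal[OF Q])
  have "\<forall>i\<in>-Y. \<exists>p. p \<in> Q \<and> (\<exists>e a l. p = a * mon (sgl i e) + l \<and> a \<noteq> 0 \<and>
      deg_le (- Y) 0 a \<and> deg_lt (- Y) e l)"
    using Y leading_term unfolding maxindep_mod_def by (metis ComplD)
  then obtain p where p: "\<And>i. i \<in> -Y \<Longrightarrow> p i \<in> Q"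
    and "\<forall>i\<in>-Y. \<exists>e a l. p i = a * mon (sgl i e) + l \<and> a \<noteq> 0 \<and>
      deg_le (- Y) 0 a \<and> deg_lt (- Y) e l" by metis
  then obtain e b l where pe: "\<And>i. i \<in> -Y \<Longrightarrow> p i = b i * mon (sgl i (e i)) + l i"
      "\<And>i. i \<in> -Y \<Longrightarrow> b i \<noteq> 0" "\<And>i. i \<in> -Y \<Longrightarrow> deg_le (- Y) 0 (b i)"
      "\<And>i. i \<in> -Y \<Longrightarrow> deg_lt (- Y) (e i) (l i)" by metis
  define heads :: "(('n \<Rightarrow>\<^sub>0 nat) \<times> ('n \<Rightarrow> nat)) set"
    where "heads = (\<lambda>i. (sgl i (e i), \<lambda>_. 0)) ` (- Y)"
  \<comment> \<open>Rewriting is used here with \<open>S = 1\<close>. The generators only stand for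
    relations that vanish modulo \<open>Q\<close>, so their weights may all be 0 and the degree
    outside \<open>Y\<close> alone decreases.\<close>
  let ?w = "\<lambda>_::'n. 0::nat" and ?J = "- Y"
  let ?I = "ideal_gen (p ` ?J)"
  have IQ: "?I \<subseteq> Q" by (rule ideal_gen_least[OF QI]) (use p in blast)
  have "\<exists>A H. deg_le (- Y) 0 A \<and> A \<notin> Q \<and> H \<notin> Q \<and> (\<forall>h\<in>heads. rwrule Y ?J p ?w A H h)"
  proof (rule common_rules[OF Q ind])
    show "finite heads" by (simp add: heads_def)
    fix h assume "h \<in> heads"
    then obtain i where i: "i \<in> -Y" "h = (sgl i (e i), \<lambda>_. 0)" by (auto simp: heads_def)
    have "rwrule Y ?J p ?w (b i) 1 h"
      unfolding rwrule_def
    proof (intro exI conjI)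
      show "finite {\<lambda>_::'n. 0::nat}" "finite {\<lambda>j. if j = i then 1 else 0::nat}" by auto
      show "{\<lambda>_::'n. 0::nat} \<subseteq> exps ?J" "{\<lambda>j. if j = i then 1 else 0} \<subseteq> exps ?J"
        using i by (auto simp: exps_def)
      show "b i * 1 * (mon (fst h) * gp ?J p (snd h)) =
        1 * (\<Sum>\<nu>\<in>{\<lambda>_::'n. 0::nat}. (- l i) * gp ?J p \<nu>) + (\<Sum>\<nu>\<in>{\<lambda>j. if j = i then 1 else 0}. 1 * gp ?J p \<nu>)"
        using i gp_unit[of ?J i p] pe(1)[OF i(1)] by simp
      show "\<forall>\<nu>\<in>{\<lambda>_. 0}. lev ?J \<nu> = lev ?J (snd h) \<and>
        (\<forall>\<kappa>\<in>ks (- l i). vdeg (- Y) \<kappa> + wt ?J ?w \<nu> < vdeg (- Y) (fst h) + wt ?J ?w (snd h))"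
        using i deg_lt_uminus[OF pe(4)[OF i(1)]] by (auto simp: deg_lt_def)
      show "\<forall>\<nu>\<in>{\<lambda>j. if j = i then 1 else 0}. lev ?J \<nu> = Suc (lev ?J (snd h))"
        using i wt_unit[of ?J i "\<lambda>_. 1"] by simp
    qed
    then show "\<exists>A H. deg_le (- Y) 0 A \<and> A \<notin> Q \<and> H \<notin> Q \<and> rwrule Y ?J p ?w A H h"
      using pe(2,3)[OF i(1)] nQ prime_ideal_one[OF Q] by blast
  qed
  then obtain A H where A: "deg_le (- Y) 0 A" "A \<notin> Q" "H \<notin> Q"
     and rw: "\<And>h. h \<in> heads \<Longrightarrow> rwrule Y ?J p ?w A H h" by blast
  have hY: "vdeg Y (fst h) = 0" if "h \<in> heads" for h using that by (auto simp: heads_def)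
  have "finite heads" by (simp add: heads_def)
  from rewriting[OF finite this A(1) hY rw]
  obtain C where C: "\<forall>N S \<gamma> \<alpha>. \<alpha> \<in> exps ?J \<longrightarrow> vdeg (- Y) \<gamma> + wt ?J ?w \<alpha> + C * (S - lev ?J \<alpha>) \<le> N \<longrightarrow>
     (\<exists>z\<in>mp.span (normal_forms Y ?J p heads H S (vdeg Y \<gamma> + C * N)).
        A ^ N * (H ^ (S - lev ?J \<alpha>) * (mon \<gamma> * gp ?J p \<alpha>)) - z \<in> ipow ?I S)"
    by blast
  obtain E where E: "deg_le UNIV E a" using deg_le_total_degree by blast
  define P where "P = (\<Prod>i\<in>-Y. e i)"
  define K where "K = CARD('n) + E + C * E + C * C + 1"
  \<comment> \<open>\<open>K\<close> collects the constants so that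
    \<open>d + 1 \<le> K * \<tau>\<close>. There are then at most
    \<open>(K ^ card Y * P) * \<tau> ^ card Y\<close> normal forms, and \<open>\<tau>\<close> is
    chosen one above the bracket.\<close>
  define \<tau> where "\<tau> = K ^ card Y * P + 1"
  define N where "N = \<tau> * E + C"
  define d where "d = CARD('n) * \<tau> + \<tau> * E + C * N"
  define Z where "Z = normal_forms Y ?J p heads H 1 d"
  let ?B = "{\<gamma> :: 'n \<Rightarrow>\<^sub>0 nat. \<forall>i. lk \<gamma> i < (if i \<in> Y then d + 1 else e i)}"
  have "Z \<subseteq> (\<lambda>\<gamma>. H ^ 1 * (mon \<gamma> * 1)) ` ?B"
  proof
    fix z assume "z \<in> Z"
    then obtain \<gamma> \<alpha> where z: "z = H ^ (1 - lev ?J \<alpha>) * (mon \<gamma> * gp ?J p \<alpha>)" "\<alpha> \<in> exps ?J" "lev ?J \<alpha> < 1"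
      "vdeg Y \<gamma> \<le> d" "\<not> reducible heads \<gamma> \<alpha>" unfolding Z_def normal_forms_def by blast
    have \<alpha>: "\<alpha> = (\<lambda>_. 0)" using lev_eq_0[of ?J \<alpha>] z by simp
    have "lk \<gamma> i < e i" if "i \<notin> Y" for i
    proof (rule ccontr)
      assume "\<not> lk \<gamma> i < e i"
      then have "reducible heads \<gamma> \<alpha>"
        using that unfolding reducible_def heads_def \<alpha> by (auto simp: lookup_single when_def intro!: bexI[of _ i])
      then show False using z by simp
    qed
    moreover have "lk \<gamma> i < d + 1" if "i \<in> Y" for i
      using lookup_le_vdeg[OF that, of \<gamma>] z by simp
    ultimately show "z \<in> (\<lambda>\<gamma>. H ^ 1 * (mon \<gamma> * 1)) ` ?B" using z(1) by (auto simp: \<alpha>)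
  qed
  note Zsub = this
  have finZ: "finite Z" by (rule finite_subset[OF Zsub]) (simp only: finite_imageI box_card)
  have "card Z \<le> card ?B" by (rule surj_card_le[OF box_card(1) Zsub])
  also have "\<dots> = (d + 1) ^ card Y * P" unfolding box_card(2) prod_if_split P_def ..
  also have "d + 1 \<le> K * \<tau>"
  proof -
    have "\<tau> \<ge> 1" by (simp add: \<tau>_def)
    then have "C * C \<le> C * C * \<tau>" "1 \<le> \<tau>" by simp_all
    moreover have "K * \<tau> = CARD('n) * \<tau> + E * \<tau> + C * E * \<tau> + C * C * \<tau> + \<tau>" by (simp add: K_def algebra_simps)
    moreover have "d = CARD('n) * \<tau> + E * \<tau> + C * E * \<tau> + C * C" by (simp add: d_def N_def algebra_simps)
    ultimately show ?thesis by linarith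
  qed
  then have "(d + 1) ^ card Y * P \<le> (K * \<tau>) ^ card Y * P" by (intro mult_right_mono power_mono) auto
  also have "\<dots> = (K ^ card Y * P) * \<tau> ^ card Y" by (simp add: power_mult_distrib)
  also have "\<dots> < \<tau> * \<tau> ^ card Y" by (intro mult_strict_right_mono) (auto simp: \<tau>_def)
  finally have cardZ: "card Z < \<tau> * \<tau> ^ card Y" .
  define D where "D = {\<gamma> :: 'n \<Rightarrow>\<^sub>0 nat. \<forall>i. lk \<gamma> i < (if i \<in> Y then \<tau> else 1)}"
  have D: "finite D" "card D = \<tau> ^ card Y"
    unfolding D_def box_card(2) prod_if_split by (rule box_card, simp)
  have DY: "vdeg (- Y) \<delta> = 0" "vdeg UNIV \<delta> \<le> CARD('n) * \<tau>" if "\<delta> \<in> D" for \<delta>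
  proof -
    show "vdeg (- Y) \<delta> = 0" using that by (auto simp: D_def vdeg_def split: if_splits)
    have "lk \<delta> i \<le> \<tau>" for i using that by (auto simp: D_def \<tau>_def split: if_splits dest!: spec[of _ i])
    then show "vdeg UNIV \<delta> \<le> CARD('n) * \<tau>" unfolding vdeg_def using sum_bounded_above[of UNIV "lk \<delta>" \<tau>] by simp
  qed
  define v where "v = (\<lambda>(\<delta>, u). A ^ N * (H * (mon \<delta> * a ^ u)))"
  have "\<exists>c. (\<exists>i\<in>D \<times> {..<\<tau>}. c i \<noteq> 0) \<and> (\<Sum>i\<in>D \<times> {..<\<tau>}. psc (c i) (v i)) \<in> Q"
  proof (rule linear_dependence_mod_subspace[OF finZ])
    show "finite (D \<times> {..<\<tau>})" "card Z < card (D \<times> {..<\<tau>})"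
      using D cardZ by (simp_all add: mult.commute)
    show "mp.subspace Q" by (rule subspace_ideal[OF QI])
    fix x assume "x \<in> D \<times> {..<\<tau>}"
    then obtain \<delta> u where x: "x = (\<delta>, u)" "\<delta> \<in> D" "u < \<tau>" by auto
    let ?T = "{x. \<exists>z\<in>mp.span Z. x - z \<in> Q}"
    have "(mon \<delta> * a ^ u) * (A ^ N * H) \<in> ?T"
    proof (rule subspace_mult_memI[OF subspace_span_plus[OF subspace_ideal[OF QI]]])
      fix \<kappa> assume "\<kappa> \<in> ks (mon \<delta> * a ^ u)"
      then obtain k1 where k1: "k1 \<in> ks (a ^ u)" "\<kappa> = \<delta> + k1" using keys_mult[of "mon \<delta>" "a ^ u"] by auto
      have "vdeg UNIV k1 \<le> u * E" using deg_le_power[OF E, of u] k1 by (auto simp: deg_le_def)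
      also have "\<dots> \<le> \<tau> * E" using x by simp
      finally have k: "vdeg UNIV k1 \<le> \<tau> * E" .
      have "vdeg (- Y) \<kappa> \<le> \<tau> * E" "vdeg Y \<kappa> \<le> CARD('n) * \<tau> + \<tau> * E"
        using k DY[OF x(2)] vdeg_mono[of Y UNIV k1] vdeg_mono[of "-Y" UNIV k1] vdeg_mono[of Y UNIV \<delta>] k1 by auto
      then have "vdeg (- Y) \<kappa> + C \<le> N" and dd: "vdeg Y \<kappa> + C * N \<le> d" by (auto simp: N_def d_def)
      then have "\<exists>z\<in>mp.span (normal_forms Y ?J p heads H 1 (vdeg Y \<kappa> + C * N)).
          A ^ N * (H ^ 1 * (mon \<kappa> * 1)) - z \<in> ipow ?I 1"
        using C[rule_format, of "\<lambda>_. 0" \<kappa> 1 N] by (simp add: exps_def)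
      moreover have "mp.span (normal_forms Y ?J p heads H 1 (vdeg Y \<kappa> + C * N)) \<subseteq> mp.span Z"
        unfolding Z_def by (intro mp.span_mono normal_forms_mono dd)
      moreover have "ipow ?I 1 \<subseteq> Q" using IQ by (simp add: ipow_1 is_ideal_ideal_gen)
      ultimately have "A ^ N * (H ^ 1 * (mon \<kappa> * 1)) \<in> ?T" by blast
      moreover have "A ^ N * (H ^ 1 * (mon \<kappa> * 1)) = mon \<kappa> * (A ^ N * H)" by (simp add: algebra_simps)
      ultimately show "mon \<kappa> * (A ^ N * H) \<in> ?T" by (simp only:)
    qed
    then show "\<exists>z\<in>mp.span Z. v x - z \<in> Q" by (simp add: x v_def algebra_simps)
  qed
  then obtain c where c: "\<exists>i\<in>D \<times> {..<\<tau>}. c i \<noteq> 0" "(\<Sum>i\<in>D \<times> {..<\<tau>}. psc (c i) (v i)) \<in> Q" by blast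
  define q where "q = (\<lambda>u. \<Sum>\<delta>\<in>D. psc (c (\<delta>, u)) (mon \<delta>))"
  have "(\<Sum>i\<in>D \<times> {..<\<tau>}. psc (c i) (v i)) = (\<Sum>\<delta>\<in>D. \<Sum>u<\<tau>. psc (c (\<delta>, u)) (v (\<delta>, u)))"
    by (simp add: sum.cartesian_product)
  also have "\<dots> = (\<Sum>u<\<tau>. \<Sum>\<delta>\<in>D. psc (c (\<delta>, u)) (v (\<delta>, u)))"
    by (rule sum.swap)
  also have "\<dots> = A ^ N * H * (\<Sum>u<\<tau>. q u * a ^ u)"
    unfolding q_def v_def
    by (simp add: sum_distrib_left sum_distrib_right psc_def algebra_simps)
  finally have "A ^ N * H * (\<Sum>u<\<tau>. q u * a ^ u) \<in> Q" using c by simp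
  then have sQ: "(\<Sum>u<\<tau>. q u * a ^ u) \<in> Q"
    using A prime_ideal_mult[OF Q] prime_ideal_power[OF Q] by metis
  have qY: "deg_le (- Y) 0 (q u)" for u
    unfolding q_def by (intro deg_le_sum deg_le_psc) (simp add: deg_le_mon DY)
  have "\<exists>u<\<tau>. q u \<noteq> 0"
  proof -
    obtain \<delta> u where du: "\<delta> \<in> D" "u < \<tau>" "c (\<delta>, u) \<noteq> 0" using c by auto
    have "lk (q u) \<delta> = c (\<delta>, u)"
      unfolding q_def using du D by (simp add: lookup_sum psc_mon lookup_single when_def)
    then show ?thesis using du by (metis lookup_zero)
  qed
  \<comment> \<open>As \<open>a\<close> is not in \<open>Q\<close>, the relation may be divided by
    \<open>a ^ u0\<close>; the lowest nonzero coefficient then becomes its constant term.\<close>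
  then obtain u0 where u0: "u0 < \<tau>" "q u0 \<noteq> 0" "\<And>u. u < u0 \<Longrightarrow> q u = 0"
    using exists_least_iff[of "\<lambda>u. u < \<tau> \<and> q u \<noteq> 0"] by (metis order.strict_trans)
  define r where "r = (\<Sum>u\<in>{Suc u0..<\<tau>}. q u * a ^ (u - Suc u0))"
  have "{..<\<tau>} = {..<u0} \<union> {u0} \<union> {Suc u0..<\<tau>}" using u0 by auto
  then have "(\<Sum>u<\<tau>. q u * a ^ u) = (\<Sum>u\<in>{..<u0} \<union> {u0} \<union> {Suc u0..<\<tau>}. q u * a ^ u)" by simp
  also have "\<dots> = q u0 * a ^ u0 + (\<Sum>u\<in>{Suc u0..<\<tau>}. q u * a ^ u)"
    using u0 by (subst sum.union_disjoint; auto)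
  also have "(\<Sum>u\<in>{Suc u0..<\<tau>}. q u * a ^ u) = a ^ u0 * (a * r)"
    unfolding r_def sum_distrib_left
  proof (rule sum.cong)
    fix u assume "u \<in> {Suc u0..<\<tau>}"
    then have "a ^ u = a ^ (u0 + (1 + (u - Suc u0)))" by simp
    then show "q u * a ^ u = a ^ u0 * (a * (q u * a ^ (u - Suc u0)))"
      unfolding power_add by (simp add: algebra_simps)
  qed simp
  also have "q u0 * a ^ u0 + a ^ u0 * (a * r) = a ^ u0 * (q u0 + a * r)" by (simp add: algebra_simps)
  finally have "q u0 + a * r \<in> Q"
    using sQ prime_ideal_mult[OF Q] prime_ideal_power[OF Q] a by metis
  then show ?thesis using qY u0(2) by blast
qed

section \<open>Height and independent variables\<close>

text \<open>If \<open>Y\<close> were maximal for \<open>P\<close>, an element of \<open>Q\<close>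
  outside \<open>P\<close> would divide a nonzero element of k[Y] modulo \<open>P\<close>. That
  element would lie in \<open>Q\<close>.\<close>

lemma indep_mod_not_max_of_subset:
  fixes P Q :: "('n::finite, 'k::field) mpoly set"
  assumes P: "is_prime_ideal P" and Q: "is_prime_ideal Q" and PQ: "P \<subset> Q"
    and Y: "indep_mod Q Y"
  shows "indep_mod P Y" "\<not> maxindep_mod P Y"
proof -
  show "indep_mod P Y" using Y PQ by (auto simp: indep_mod_def)
  show "\<not> maxindep_mod P Y"
  proof
    assume m: "maxindep_mod P Y"
    obtain a where a: "a \<in> Q" "a \<notin> P" using PQ by auto
    obtain c a' where c: "deg_le (- Y) 0 c" "c \<noteq> 0" "c + a * a' \<in> P"
      using algebraic_mod_prime[OF P m a(2)] by blast
    have "c + a * a' - a * a' \<in> Q"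
      using c PQ a prime_is_ideal[OF Q] by (intro ideal_diff ideal_mult_right) auto
    then show False using Y c by (auto simp: indep_mod_def)
  qed
qed

lemma indep_mod_empty: "is_prime_ideal Q \<Longrightarrow> indep_mod Q {}"
  for Q :: "('n::finite, 'k::field) mpoly set"
proof (unfold indep_mod_def, intro ballI impI)
  fix p assume Q: "is_prime_ideal Q" and p: "p \<in> Q" "deg_le (- {}) 0 p"
  have "\<gamma> = 0" if "\<gamma> \<in> ks p" for \<gamma>
  proof (rule poly_mapping_eqI)
    fix i
    have "vdeg UNIV \<gamma> = 0" using p that by (auto simp: deg_le_def)
    then show "lk \<gamma> i = lk 0 i" using lookup_le_vdeg[of i UNIV \<gamma>] by simp
  qed
  then have "ks p \<subseteq> {0}" by auto
  then have p0: "p = cst (lk p 0)"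
    by (intro poly_mapping_eqI) (auto simp: cst_def lookup_single when_def in_keys_iff)
  show "p = 0"
  proof (rule ccontr)
    assume "p \<noteq> 0"
    then have "lk p 0 \<noteq> 0" using p0 by (metis cst_def single_zero)
    then have "cst (inverse (lk p 0)) * p = 1"
      by (subst p0) (simp add: cst_def mult_single)
    then have "1 \<in> Q" using p ideal_mult_left[OF prime_is_ideal[OF Q]] by metis
    then show False using prime_ideal_one[OF Q] by simp
  qed
qed

text \<open>For a prime \<open>Q\<close> this is the transcendence degree of the fraction field of
  R/Q, read off the variables.\<close>

definition vdim :: "('n::finite, 'k::comm_ring_1) mpoly set \<Rightarrow> nat" where
  "vdim Q = Max (card ` {Y. indep_mod Q Y})"

lemma vdim_ge: "indep_mod Q Y \<Longrightarrow> card Y \<le> vdim Q"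
  unfolding vdim_def by (intro Max_ge) auto

lemma vdim_attained:
  fixes Q :: "('n::finite, 'k::field) mpoly set"
  assumes "is_prime_ideal Q"
  shows "\<exists>Y. maxindep_mod Q Y \<and> card Y = vdim Q"
proof -
  have "card ` {Y. indep_mod Q Y} \<noteq> {}" using indep_mod_empty[OF assms] by auto
  then have "vdim Q \<in> card ` {Y. indep_mod Q Y}" unfolding vdim_def by (intro Max_in) auto
  then obtain Y where Y: "indep_mod Q Y" "card Y = vdim Q" by auto
  moreover have "\<not> indep_mod Q (insert i Y)" if "i \<notin> Y" for i
    using vdim_ge[of Q "insert i Y"] Y that by auto
  ultimately show ?thesis by (auto simp: maxindep_mod_iff)
qed

lemma vdim_le: "is_prime_ideal (Q :: ('n::finite, 'k::field) mpoly set) \<Longrightarrow> vdim Q \<le> CARD('n)"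
  using vdim_attained by (metis card_mono finite top_greatest)

text \<open>A largest independent set for \<open>Q\<close> stays independent for \<open>P\<close>
  but is no longer maximal there, so it can be enlarged.\<close>

lemma vdim_strict_mono:
  fixes P Q :: "('n::finite, 'k::field) mpoly set"
  assumes P: "is_prime_ideal P" and Q: "is_prime_ideal Q" and PQ: "P \<subset> Q"
  shows "vdim Q < vdim P"
proof -
  obtain Y where Y: "maxindep_mod Q Y" "card Y = vdim Q" using vdim_attained[OF Q] by blast
  have "indep_mod P Y" "\<not> maxindep_mod P Y"
    using indep_mod_not_max_of_subset[OF P Q PQ] Y by (auto simp: maxindep_mod_iff)
  then obtain i where "i \<notin> Y" "indep_mod P (insert i Y)" by (auto simp: maxindep_mod_iff)
  then show ?thesis using vdim_ge[of P "insert i Y"] Y by simp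
qed

section \<open>Expanding along one variable and eliminating it from a prime\<close>

definition var_coeff :: "'n \<Rightarrow> nat \<Rightarrow> ('n, 'k::comm_ring_1) mpoly \<Rightarrow> ('n, 'k) mpoly" where
  "var_coeff i a p = (\<Sum>\<gamma>\<in>ks p. if lk \<gamma> i = a then psc (lk p \<gamma>) (mon (\<gamma> - sgl i a)) else 0)"

lemma var_coeff_superset:
  assumes "finite F" "ks p \<subseteq> F"
  shows "var_coeff i a p = (\<Sum>\<gamma>\<in>F. if lk \<gamma> i = a then psc (lk p \<gamma>) (mon (\<gamma> - sgl i a)) else 0)"
  unfolding var_coeff_def using assms
  by (intro sum.mono_neutral_left) (auto simp: in_keys_iff psc_def cst_def)

lemma var_coeff_add: "var_coeff i a (p + q) = var_coeff i a p + var_coeff i a q"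
proof -
  let ?F = "ks p \<union> ks q"
  have "finite ?F" "ks (p + q) \<subseteq> ?F" "ks p \<subseteq> ?F" "ks q \<subseteq> ?F" using keys_add[of p q] by auto
  then show ?thesis
    by (simp add: var_coeff_superset[of ?F] sum.distrib[symmetric] lookup_add psc_def cst_def single_add algebra_simps
        cong: if_cong, intro sum.cong) auto
qed

lemma var_coeff_0 [simp]: "var_coeff i a 0 = 0"
  by (simp add: var_coeff_def)

lemma var_coeff_single:
  "var_coeff i a (sgl \<gamma> c) =
     (if lk \<gamma> i = a then sgl (\<gamma> - sgl i a) c else 0)"
  by (auto simp: var_coeff_def psc_mon)

lemma var_coeff_mult: "var_coeff i n (p * q) = (\<Sum>a\<le>n. var_coeff i a p * var_coeff i (n - a) q)"
  for p q :: "('n, 'k::comm_ring_1) mpoly"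
proof (induction p arbitrary: q rule: mpoly_induct)
  case (add p p')
  then show ?case by (simp add: distrib_right var_coeff_add sum.distrib)
next
  case (single \<gamma> c)
  note 1 = this
  show ?case
  proof (induction q rule: mpoly_induct)
    case (add p p')
    then show ?case by (simp add: distrib_left var_coeff_add sum.distrib)
  next
    case (single \<delta> d)
    let ?s = "\<lambda>e. sgl i e :: 'n \<Rightarrow>\<^sub>0 nat"
    have "(\<Sum>a\<le>n. var_coeff i a (sgl \<gamma> c) * var_coeff i (n - a) (sgl \<delta> d)) =
      (\<Sum>a\<le>n. if a = lk \<gamma> i then var_coeff i (lk \<gamma> i) (sgl \<gamma> c) * var_coeff i (n - lk \<gamma> i) (sgl \<delta> d) else 0)"
      by (intro sum.cong) (auto simp: var_coeff_single)
    also have "\<dots> = (if lk \<gamma> i \<le> n \<and> lk \<delta> i = n - lk \<gamma> i then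
        sgl ((\<gamma> - ?s (lk \<gamma> i)) + (\<delta> - ?s (n - lk \<gamma> i))) (c * d) else 0)"
      by (simp add: var_coeff_single mult_single)
    also have "\<dots> = var_coeff i n (sgl \<gamma> c * sgl \<delta> d)"
    proof (cases "lk \<gamma> i \<le> n \<and> lk \<delta> i = n - lk \<gamma> i")
      case True
      then have "(\<gamma> - ?s (lk \<gamma> i)) + (\<delta> - ?s (n - lk \<gamma> i)) = \<gamma> + \<delta> - ?s n"
        by (intro poly_mapping_eqI) (auto simp: lookup_add lookup_minus lookup_single when_def)
      then show ?thesis using True by (simp add: var_coeff_single mult_single lookup_add)
    next
      case False
      then show ?thesis by (auto simp: var_coeff_single mult_single lookup_add)
    qed
    finally show ?case ..
  qed
qed

lemma var_coeff_expand: "p = (\<Sum>a\<in>(\<lambda>\<gamma>. lk \<gamma> i) ` ks p. var_coeff i a p * mon (sgl i a))"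
  for p :: "('n, 'k::comm_ring_1) mpoly"
proof -
  have m: "mon (\<gamma> - sgl i a) * mon (sgl i a) = (mon \<gamma> :: ('n, 'k) mpoly)"
    if "lk \<gamma> i = a" for \<gamma> a
    unfolding mon_add[symmetric]
    by (rule arg_cong[of _ _ mon], rule poly_mapping_eqI)
       (use that in \<open>auto simp: lookup_add lookup_minus lookup_single when_def\<close>)
  have "(\<Sum>a\<in>(\<lambda>\<gamma>. lk \<gamma> i) ` ks p. var_coeff i a p * mon (sgl i a)) =
    (\<Sum>a\<in>(\<lambda>\<gamma>. lk \<gamma> i) ` ks p. \<Sum>\<gamma>\<in>ks p. if lk \<gamma> i = a then psc (lk p \<gamma>) (mon \<gamma>) else 0)"
    unfolding var_coeff_def sum_distrib_right
    by (intro sum.cong refl) (simp add: psc_mult_left m)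
  also have "\<dots> = (\<Sum>\<gamma>\<in>ks p. \<Sum>a\<in>(\<lambda>\<gamma>. lk \<gamma> i) ` ks p. if lk \<gamma> i = a then psc (lk p \<gamma>) (mon \<gamma>) else 0)"
    by (rule sum.swap)
  also have "\<dots> = (\<Sum>\<gamma>\<in>ks p. psc (lk p \<gamma>) (mon \<gamma>))"
    by (intro sum.cong) auto
  finally show ?thesis using mpoly_expand[of p] by simp
qed

lemma var_coeff_free:
  assumes "\<And>\<gamma>. \<gamma> \<in> ks p \<Longrightarrow> lk \<gamma> i = 0"
  shows "var_coeff i a p = (if a = 0 then p else 0)"
proof -
  have "var_coeff i a p = (\<Sum>\<gamma>\<in>ks p. if a = 0 then psc (lk p \<gamma>) (mon \<gamma>) else 0)"
    unfolding var_coeff_def using assms by (intro sum.cong) auto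
  then show ?thesis using mpoly_expand[of p] by auto
qed

text \<open>The contraction of \<open>P\<close> to the polynomials free of the variable
  \<open>i\<close>, extended back to the full ring when \<open>P\<close> is an ideal.\<close>

definition drop_var :: "'n \<Rightarrow> ('n, 'k::comm_ring_1) mpoly set \<Rightarrow> ('n, 'k) mpoly set" where
  "drop_var i P = {p. \<forall>a. var_coeff i a p \<in> P}"

text \<open>Primality follows as in Gauss's lemma, by looking at the lowest coefficients outside
  \<open>P\<close> of both factors.\<close>

lemma prime_drop_var:
  assumes P: "is_prime_ideal P"
  shows "is_prime_ideal (drop_var i P)" "drop_var i P \<subseteq> P"
proof -
  have PI: "is_ideal P" by (rule prime_is_ideal[OF P])
  show sub: "drop_var i P \<subseteq> P"
  proof
    fix p assume "p \<in> drop_var i P"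
    then have "(\<Sum>a\<in>(\<lambda>\<gamma>. lk \<gamma> i) ` ks p. var_coeff i a p * mon (sgl i a)) \<in> P"
      by (intro ideal_sum[OF PI] ideal_mult_right[OF PI]) (simp add: drop_var_def)
    then show "p \<in> P" using var_coeff_expand[of p i] by simp
  qed
  have "is_ideal (drop_var i P)"
    unfolding is_ideal_def drop_var_def
    by (auto simp: var_coeff_add var_coeff_mult ideal_zero[OF PI]
        intro!: ideal_add[OF PI] ideal_sum[OF PI] ideal_mult_left[OF PI])
  moreover have "drop_var i P \<noteq> UNIV" using sub P by (auto simp: is_prime_ideal_def)
  moreover have "p \<in> drop_var i P \<or> q \<in> drop_var i P" if pq: "p * q \<in> drop_var i P" for p q
  proof (rule ccontr)
    assume n: "\<not> (p \<in> drop_var i P \<or> q \<in> drop_var i P)"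
    then obtain a b where ab: "var_coeff i a p \<notin> P" "\<And>a'. a' < a \<Longrightarrow> var_coeff i a' p \<in> P"
       "var_coeff i b q \<notin> P" "\<And>b'. b' < b \<Longrightarrow> var_coeff i b' q \<in> P"
      using exists_least_iff[of "\<lambda>a. var_coeff i a p \<notin> P"] exists_least_iff[of "\<lambda>a. var_coeff i a q \<notin> P"]
      unfolding drop_var_def by blast
    \<comment> \<open>In the coefficient of degree \<open>a + b\<close> every term other than the
      product of the two chosen coefficients has a factor of smaller index, hence in
      \<open>P\<close>.\<close>
    have "(\<Sum>c\<in>{..a + b} - {a}. var_coeff i c p * var_coeff i (a + b - c) q) \<in> P"
    proof (rule ideal_sum[OF PI])
      fix c assume c: "c \<in> {..a + b} - {a}"
      then have "c < a \<or> a + b - c < b" by auto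
      then show "var_coeff i c p * var_coeff i (a + b - c) q \<in> P"
        using ab ideal_mult_left[OF PI] ideal_mult_right[OF PI] by blast
    qed
    moreover have "var_coeff i (a + b) (p * q) =
       var_coeff i a p * var_coeff i b q + (\<Sum>c\<in>{..a + b} - {a}. var_coeff i c p * var_coeff i (a + b - c) q)"
      unfolding var_coeff_mult by (subst sum.remove[of _ a]) auto
    moreover have "var_coeff i (a + b) (p * q) \<in> P" using pq by (simp add: drop_var_def)
    ultimately have "var_coeff i a p * var_coeff i b q \<in> P"
      using ideal_diff[OF PI, of "var_coeff i (a + b) (p * q)" "\<Sum>c\<in>{..a + b} - {a}. var_coeff i c p * var_coeff i (a + b - c) q"]
      by simp
    then show False using ab prime_ideal_mult[OF P] by blast
  qed
  ultimately show "is_prime_ideal (drop_var i P)" unfolding is_prime_ideal_def by blast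
qed

lemma deg_le_0_iff: "deg_le V 0 p \<longleftrightarrow> (\<forall>\<gamma>\<in>ks p. \<forall>i\<in>V. lk \<gamma> i = 0)"
  by (simp add: deg_le_def vdeg_def)

lemma var_coeff_insert:
  assumes "deg_le (- insert i Y) 0 p"
  shows "deg_le (- Y) 0 (var_coeff i a p)"
  unfolding var_coeff_def
proof (rule deg_le_sum)
  fix \<gamma> assume "\<gamma> \<in> ks p"
  then show "deg_le (- Y) 0 (if lk \<gamma> i = a then psc (lk p \<gamma>) (mon (\<gamma> - sgl i a)) else 0)"
    using assms by (auto intro!: deg_le_psc deg_le_mon[THEN iffD2]
        simp: vdeg_def lookup_minus lookup_single when_def deg_le_0_iff[of "- insert i Y"])
qed

text \<open>The step frees the variable \<open>i\<close>. For an element in the variables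
  \<open>insert i Y\<close>, the coefficients with respect to \<open>i\<close> lie in both
  \<open>P\<close> and k[Y], hence vanish. The relations showing maximality for the remaining
  variables do not involve \<open>i\<close> and survive.\<close>

lemma drop_var_step:
  fixes P :: "('n::finite, 'k::field) mpoly set"
  assumes P: "is_prime_ideal P" and Y: "maxindep_mod P Y" and i: "i \<notin> Y"
  shows "drop_var i P \<subset> P" "maxindep_mod (drop_var i P) (insert i Y)"
proof -
  have ind: "indep_mod P Y" using Y by (simp add: maxindep_mod_def)
  have van: "p = 0" if "p \<in> drop_var i P" "deg_le (- insert i Y) 0 p" for p
  proof -
    have "var_coeff i a p = 0" for a
      using that ind var_coeff_insert[OF that(2), of a] by (auto simp: drop_var_def indep_mod_def)
    then show ?thesis using var_coeff_expand[of p i] by simp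
  qed
  obtain p where p: "p \<in> P" "p \<noteq> 0" "deg_le (- insert i Y) 0 p" using Y i by (auto simp: maxindep_mod_def)
  then have "p \<notin> drop_var i P" using van by blast
  then show "drop_var i P \<subset> P" using p prime_drop_var(2)[OF P, of i] by blast
  show "maxindep_mod (drop_var i P) (insert i Y)"
    unfolding maxindep_mod_def
  proof (intro conjI allI impI)
    show "indep_mod (drop_var i P) (insert i Y)" using van by (auto simp: indep_mod_def)
    fix j assume j: "j \<notin> insert i Y"
    then obtain q where q: "q \<in> P" "q \<noteq> 0" "deg_le (- insert j Y) 0 q" using Y by (auto simp: maxindep_mod_def)
    have "lk \<gamma> i = 0" if "\<gamma> \<in> ks q" for \<gamma> using q(3) that i j by (auto simp: deg_le_0_iff)
    then have "q \<in> drop_var i P"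
      using q(1) ideal_zero[OF prime_is_ideal[OF P]] by (auto simp: drop_var_def var_coeff_free)
    moreover have "deg_le (- insert j (insert i Y)) 0 q" by (rule deg_le_subset[OF q(3)]) auto
    ultimately show "\<exists>p\<in>drop_var i P. p \<noteq> 0 \<and> deg_le (- insert j (insert i Y)) 0 p" using q by blast
  qed
qed

lemma prime_chain_to_Suc:
  assumes "prime_chain_to P h" "P \<subset> Q" "is_prime_ideal Q"
  shows "prime_chain_to Q (Suc h)"
proof -
  obtain c where c: "\<forall>i\<le>h. is_prime_ideal (c i)" "\<forall>i<h. c i \<subset> c (Suc i)" "c h = P"
    using assms by (auto simp: prime_chain_to_def)
  show ?thesis unfolding prime_chain_to_def
    by (rule exI[of _ "c(Suc h := Q)"]) (use c assms in \<open>auto simp: le_Suc_eq less_Suc_eq\<close>)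
qed

text \<open>The variables outside \<open>Y\<close> are freed one after another; each elimination
  adds one strictly smaller prime at the bottom of the chain.\<close>

lemma prime_chain_of_maxindep:
  fixes P :: "('n::finite, 'k::field) mpoly set"
  assumes "is_prime_ideal P" "maxindep_mod P Y"
  shows "prime_chain_to P (card (- Y))"
  using assms
proof (induction "card (- Y)" arbitrary: P Y)
  case 0
  then show ?case by (auto simp: prime_chain_to_def)
next
  case (Suc n)
  then have "- Y \<noteq> {}" by (metis card.empty nat.distinct(1))
  then obtain i where i: "i \<notin> Y" by auto
  have "- Y = insert i (- insert i Y)" using i by auto
  then have n: "card (- Y) = Suc (card (- insert i Y))" by (metis ComplD card_insert_disjoint finite insertI1)
  then have "prime_chain_to (drop_var i P) (card (- insert i Y))"
    using Suc prime_drop_var(1)[OF Suc.prems(1)] drop_var_step[OF Suc.prems i] by (intro Suc) auto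
  then show ?case unfolding n
    by (rule prime_chain_to_Suc[OF _ drop_var_step(1)[OF Suc.prems i] Suc.prems(1)])
qed

lemma prime_chain_vdim:
  fixes P :: "('n::finite, 'k::field) mpoly set"
  assumes "prime_chain_to P h"
  shows "h + vdim P \<le> CARD('n)"
proof -
  obtain c where c: "\<forall>i\<le>h. is_prime_ideal (c i)" "\<forall>i<h. c i \<subset> c (Suc i)" "c h = P"
    using assms by (auto simp: prime_chain_to_def)
  have "i + vdim (c i) \<le> CARD('n)" if "i \<le> h" for i
    using that
  proof (induction i)
    case 0
    then show ?case using c vdim_le by auto
  next
    case (Suc i)
    then have "vdim (c (Suc i)) < vdim (c i)" using c by (intro vdim_strict_mono) auto
    then show ?case using Suc by simp
  qed
  then show ?thesis using c by blast
qed

text \<open>Along a chain of primes the dimension falls strictly, which bounds the height from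
  above. Successive eliminations of variables give a chain of exactly this length.\<close>

theorem height_eq_codim:
  fixes P :: "('n::finite, 'k::field) mpoly set"
  assumes P: "is_prime_ideal P"
  shows "height P = enat (CARD('n) - vdim P)"
proof (rule antisym)
  show "height P \<le> enat (CARD('n) - vdim P)"
    unfolding height_def using prime_chain_vdim by (fastforce intro!: SUP_least)
  obtain Y where Y: "maxindep_mod P Y" "card Y = vdim P" using vdim_attained[OF P] by blast
  then have "card (- Y) = CARD('n) - vdim P" by (simp add: Compl_eq_Diff_UNIV card_Diff_subset)
  then have "prime_chain_to P (CARD('n) - vdim P)" using prime_chain_of_maxindep[OF P Y(1)] by simp
  then show "enat (CARD('n) - vdim P) \<le> height P" unfolding height_def by (intro SUP_upper) simp
qed

section \<open>Derivatives and symbolic powers\<close>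

text \<open>The formal partial derivative. Truncated subtraction of exponents is harmless, since a
  monomial free of \<open>i\<close> receives the coefficient 0.\<close>

definition pd :: "'n \<Rightarrow> ('n, 'k::comm_ring_1) mpoly \<Rightarrow> ('n, 'k) mpoly" where
  "pd i p = (\<Sum>\<gamma>\<in>ks p. sgl (\<gamma> - sgl i 1) (lk p \<gamma> * of_nat (lk \<gamma> i)))"

lemma pd_superset:
  assumes "finite F" "ks p \<subseteq> F"
  shows "pd i p = (\<Sum>\<gamma>\<in>F. sgl (\<gamma> - sgl i 1) (lk p \<gamma> * of_nat (lk \<gamma> i)))"
  unfolding pd_def using assms
  by (intro sum.mono_neutral_left) (auto simp: in_keys_iff)

lemma pd_add: "pd i (p + q) = pd i p + pd i q"
proof -
  let ?F = "ks p \<union> ks q"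
  have "finite ?F" "ks (p + q) \<subseteq> ?F" "ks p \<subseteq> ?F" "ks q \<subseteq> ?F" using keys_add[of p q] by auto
  then show ?thesis
    by (simp add: pd_superset[of ?F] sum.distrib[symmetric] lookup_add single_add[symmetric] distrib_right)
qed

lemma pd_single:
  "pd i (sgl \<gamma> c) = sgl (\<gamma> - sgl i 1) (c * of_nat (lk \<gamma> i))"
  by (auto simp: pd_def)

lemma pd_mult: "pd i (p * q) = pd i p * q + p * pd i q"
  for p q :: "('n, 'k::comm_ring_1) mpoly"
proof (induction p arbitrary: q rule: mpoly_induct)
  case (add p p')
  then show ?case by (simp add: distrib_right pd_add)
next
  case (single \<gamma> c)
  show ?case
  proof (induction q rule: mpoly_induct)
    case (add p p')
    then show ?case by (simp add: distrib_left pd_add)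
  next
    case (single \<delta> d)
    let ?s = "sgl i 1 :: 'n \<Rightarrow>\<^sub>0 nat" and ?S = sgl
    have 1: "?S (\<gamma> - ?s + \<delta>) (c * of_nat (lk \<gamma> i) * d) = ?S (\<gamma> + \<delta> - ?s) (c * d * of_nat (lk \<gamma> i))"
    proof (cases "lk \<gamma> i = 0")
      case False
      then have "\<gamma> - ?s + \<delta> = \<gamma> + \<delta> - ?s"
        by (intro poly_mapping_eqI) (auto simp: lookup_add lookup_minus lookup_single when_def)
      then show ?thesis by (simp add: ac_simps)
    qed simp
    have 2: "?S (\<gamma> + (\<delta> - ?s)) (c * (d * of_nat (lk \<delta> i))) = ?S (\<gamma> + \<delta> - ?s) (c * d * of_nat (lk \<delta> i))"
    proof (cases "lk \<delta> i = 0")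
      case False
      then have "\<gamma> + (\<delta> - ?s) = \<gamma> + \<delta> - ?s"
        by (intro poly_mapping_eqI) (auto simp: lookup_add lookup_minus lookup_single when_def)
      then show ?thesis by (simp add: mult.assoc)
    qed simp
    show ?case unfolding pd_single mult_single 1 2 single_add[symmetric]
      by (simp add: lookup_add algebra_simps)
  qed
qed

lemma lookup_pd: "lk (pd i p) \<delta> = lk p (\<delta> + sgl i 1) * of_nat (lk \<delta> i + 1)"
  for p :: "('n, 'k::comm_ring_1) mpoly"
proof (induction p rule: mpoly_induct)
  case (add p q)
  then show ?case by (simp add: pd_add lookup_add algebra_simps)
next
  case (single \<gamma> c)
  let ?s = "sgl i 1 :: 'n \<Rightarrow>\<^sub>0 nat"
  show ?case
  proof (cases "\<gamma> = \<delta> + ?s")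
    case True
    then have "\<gamma> - ?s = \<delta>" by simp
    then show ?thesis using True by (simp add: pd_single lookup_add)
  next
    case False
    have "lk \<gamma> i = 0" if "\<gamma> - ?s = \<delta>"
    proof (rule ccontr)
      assume "lk \<gamma> i \<noteq> 0"
      then have "\<gamma> = \<gamma> - ?s + ?s"
        by (intro poly_mapping_eqI) (auto simp: lookup_add lookup_minus lookup_single when_def)
      then show False using False that by simp
    qed
    then show ?thesis using False by (auto simp: pd_single lookup_single when_def)
  qed
qed

text \<open>By the product rule, differentiation leaves all but one of the factors
  untouched.\<close>

lemma pd_ipow: "a \<in> ipow Q (Suc s) \<Longrightarrow> pd i a \<in> ipow Q s"
proof (induction s arbitrary: a)
  case (Suc s)
  let ?J = "{a \<in> ipow Q (Suc (Suc s)). pd i a \<in> ipow Q (Suc s)}"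
  have "is_ideal ?J"
    unfolding is_ideal_def
  proof (intro conjI ballI allI)
    show "0 \<in> ?J" by (simp add: pd_def ideal_zero[OF is_ideal_ipow])
    fix a b assume "a \<in> ?J" "b \<in> ?J"
    then show "a + b \<in> ?J" by (simp add: pd_add ideal_add[OF is_ideal_ipow])
  next
    fix r a assume a: "a \<in> ?J"
    then have "a \<in> ipow Q (Suc s)" using ipow_Suc_subset by blast
    then show "r * a \<in> ?J" using a
      by (auto simp: pd_mult intro!: ideal_add[OF is_ideal_ipow] ideal_mult_left[OF is_ideal_ipow])
  qed
  then have "ipow Q (Suc (Suc s)) \<subseteq> ?J"
  proof (rule ipow_Suc_least)
    fix a b assume ab: "a \<in> Q" "b \<in> ipow Q (Suc s)"
    then have "pd i a * b \<in> ipow Q (Suc s)" "a * pd i b \<in> ipow Q (Suc s)"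
      using Suc.IH[of b] by (auto intro: ideal_mult_left[OF is_ideal_ipow] ipow_Suc_mult)
    then show "a * b \<in> ?J" using ab by (auto simp: pd_mult intro!: ideal_add[OF is_ideal_ipow] ipow_Suc_mult)
  qed
  then show ?case using Suc.prems by blast
qed simp

text \<open>In characteristic zero a nonconstant polynomial has a nonzero partial derivative of
  smaller degree, while differentiation costs only one order along \<open>Q\<close>. After at most
  \<open>d\<close> steps a nonzero constant would lie in \<open>Q\<close>.\<close>

lemma symbolic_power_degree:
  fixes Q :: "('n::finite, 'k::field_char_0) mpoly set"
  assumes Q: "is_prime_ideal Q"
  shows "f \<noteq> 0 \<Longrightarrow> deg_le UNIV d f \<Longrightarrow> d < S \<Longrightarrow> h \<notin> Q \<Longrightarrow> h * f \<notin> ipow Q S"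
proof (induction d arbitrary: f S h)
  case 0
  show ?case
  proof
    assume "h * f \<in> ipow Q S"
    then have "h * f \<in> Q" using 0 ipow_antimono[of 1 S Q] ipow_1[OF prime_is_ideal[OF Q]] by auto
    then have "f \<in> Q" using 0 prime_ideal_mult[OF Q] by blast
    then show False using indep_mod_empty[OF Q] 0 by (auto simp: indep_mod_def)
  qed
next
  case (Suc d)
  show ?case
  proof (cases "deg_le UNIV d f")
    case True
    then show ?thesis using Suc by simp
  next
    case False
    then obtain \<gamma> where \<gamma>: "\<gamma> \<in> ks f" "vdeg UNIV \<gamma> > d" by (auto simp: deg_le_def not_le)
    then obtain i where i: "lk \<gamma> i \<noteq> 0" unfolding vdeg_def by (metis gr_implies_not0 sum.neutral)
    let ?s = "sgl i 1 :: 'n \<Rightarrow>\<^sub>0 nat"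
    have g: "\<gamma> - ?s + ?s = \<gamma>"
      using i by (intro poly_mapping_eqI) (auto simp: lookup_add lookup_minus lookup_single when_def)
    have "lk (pd i f) (\<gamma> - ?s) \<noteq> 0"
      unfolding lookup_pd g using \<gamma> by (simp add: in_keys_iff del: of_nat_add of_nat_Suc)
    then have nz: "pd i f \<noteq> 0" by auto
    have dg: "deg_le UNIV d (pd i f)"
      unfolding deg_le_def
    proof
      fix \<delta> assume "\<delta> \<in> ks (pd i f)"
      then have "\<delta> + ?s \<in> ks f" by (auto simp: in_keys_iff lookup_pd)
      then have "vdeg UNIV (\<delta> + ?s) \<le> Suc d" using Suc.prems unfolding deg_le_def by blast
      then show "vdeg UNIV \<delta> \<le> d" by simp
    qed
    obtain S' where S': "S = Suc S'" "d < S'" using Suc.prems by (cases S) auto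
    show ?thesis
    proof
      assume hf: "h * f \<in> ipow Q S"
      \<comment> \<open>This combination eliminates the derivative of \<open>h\<close>; the price is
        that the multiplier becomes \<open>h * h\<close>, still outside \<open>Q\<close>.\<close>
      have "h * pd i (h * f) - pd i h * (h * f) \<in> ipow Q S'"
        using hf pd_ipow[of "h * f" Q S' i] ipow_Suc_subset[of Q S'] unfolding S'
        by (intro ideal_diff[OF is_ideal_ipow]; rule_tac ideal_mult_left[OF is_ideal_ipow]) auto
      also have "h * pd i (h * f) - pd i h * (h * f) = (h * h) * pd i f"
        by (simp add: pd_mult algebra_simps)
      finally show False
        using Suc.IH[OF nz dg S'(2), of "h * h"] Suc.prems prime_ideal_mult[OF Q] by blast
    qed
  qed
qed

section \<open>Minimal primes and the associated graded ring\<close>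

text \<open>Otherwise the multiplicative set generated by \<open>q\<close> and the complement of
  \<open>Q\<close> avoids \<open>I\<close>. An ideal over \<open>I\<close> maximal among those
  avoiding it is a prime inside \<open>Q\<close> that misses \<open>q\<close>, against
  minimality.\<close>

lemma nilpotent_of_minimal_prime:
  assumes Q: "is_prime_ideal Q" and I: "is_ideal I"
    and min: "\<And>P. is_prime_ideal P \<Longrightarrow> I \<subseteq> P \<Longrightarrow> P \<subseteq> Q \<Longrightarrow> P = Q" and q: "q \<in> Q"
  shows "\<exists>h e. h \<notin> Q \<and> h * q ^ e \<in> I"
proof (rule ccontr)
  assume neg: "\<not> ?thesis"
  define M where "M = {h * q ^ e | h e. h \<notin> Q}"
  have M1: "h \<in> M" if "h \<notin> Q" for h unfolding M_def using that by (intro CollectI exI[of _ h] exI[of _ 0]) simp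
  have Mq: "q \<in> M" unfolding M_def using prime_ideal_one[OF Q] by (auto intro!: exI[of _ 1])
  have Mm: "x * y \<in> M" if "x \<in> M" "y \<in> M" for x y
  proof -
    obtain h e h' e' where "x = h * q ^ e" "y = h' * q ^ e'" "h \<notin> Q" "h' \<notin> Q" using \<open>x \<in> M\<close> \<open>y \<in> M\<close> by (auto simp: M_def)
    then show ?thesis unfolding M_def using prime_ideal_mult[OF Q]
      by (intro CollectI exI[of _ "h * h'"] exI[of _ "e + e'"]) (auto simp: power_add algebra_simps)
  qed
  define \<A> where "\<A> = {J. is_ideal J \<and> I \<subseteq> J \<and> J \<inter> M = {}}"
  have "I \<in> \<A>" unfolding \<A>_def M_def using I neg by auto
  have "\<exists>P\<in>\<A>. \<forall>X\<in>\<A>. P \<subseteq> X \<longrightarrow> X = P"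
  proof (rule subset_Zorn_nonempty)
    show "\<A> \<noteq> {}" using \<open>I \<in> \<A>\<close> by auto
    fix \<C> assume C: "\<C> \<noteq> {}" "subset.chain \<A> \<C>"
    then have CA: "\<C> \<subseteq> \<A>" by (auto simp: subset_chain_def)
    have "is_ideal (\<Union>\<C>)"
      unfolding is_ideal_def
    proof (intro conjI ballI allI)
      show "0 \<in> \<Union>\<C>" using C(1) CA ideal_zero unfolding \<A>_def by blast
      fix a b assume "a \<in> \<Union>\<C>" "b \<in> \<Union>\<C>"
      then obtain X X' where X: "X \<in> \<C>" "a \<in> X" "X' \<in> \<C>" "b \<in> X'" by auto
      then have "X \<subseteq> X' \<or> X' \<subseteq> X" using C by (auto simp: subset_chain_def)
      then obtain W where "W \<in> \<C>" "a \<in> W" "b \<in> W" using X by blast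
      then show "a + b \<in> \<Union>\<C>" using CA ideal_add unfolding \<A>_def by blast
    next
      fix r a assume "a \<in> \<Union>\<C>"
      then show "r * a \<in> \<Union>\<C>" using CA ideal_mult_left unfolding \<A>_def by blast
    qed
    then show "\<Union>\<C> \<in> \<A>" using C CA unfolding \<A>_def by blast
  qed
  then obtain P where P: "is_ideal P" "I \<subseteq> P" "P \<inter> M = {}"
    and Pmax: "\<And>X. X \<in> \<A> \<Longrightarrow> P \<subseteq> X \<Longrightarrow> X = P" unfolding \<A>_def by auto
  have PQ: "P \<subseteq> Q" using P M1 by blast
  have "is_prime_ideal P"
    unfolding is_prime_ideal_def
  proof (intro conjI allI impI)
    show "is_ideal P" by (rule P)
    show "P \<noteq> UNIV" using PQ Q by (auto simp: is_prime_ideal_def)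
    fix a b assume ab: "a * b \<in> P"
    have ext: "\<exists>p\<in>P. \<exists>r. p + r * x \<in> M" if x: "x \<notin> P" for x
    proof (rule ccontr)
      assume n: "\<not> ?thesis"
      define X where "X = {p + r * x | p r. p \<in> P}"
      have "is_ideal X"
        unfolding is_ideal_def
      proof (intro conjI ballI allI)
        show "0 \<in> X" unfolding X_def using ideal_zero[OF P(1)] by (auto intro!: exI[of _ 0])
        fix u v assume "u \<in> X" "v \<in> X"
        then obtain p r p' r' where "u = p + r * x" "v = p' + r' * x" "p \<in> P" "p' \<in> P" by (auto simp: X_def)
        then show "u + v \<in> X" unfolding X_def using ideal_add[OF P(1)]
          by (intro CollectI exI[of _ "p + p'"] exI[of _ "r + r'"]) (auto simp: algebra_simps)
      next
        fix s u assume "u \<in> X"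
        then obtain p r where "u = p + r * x" "p \<in> P" by (auto simp: X_def)
        then show "s * u \<in> X" unfolding X_def using ideal_mult_left[OF P(1)]
          by (intro CollectI exI[of _ "s * p"] exI[of _ "s * r"]) (auto simp: algebra_simps)
      qed
      moreover have PX: "P \<subseteq> X"
      proof
        fix p assume "p \<in> P"
        then show "p \<in> X" unfolding X_def by (intro CollectI exI[of _ p] exI[of _ 0]) auto
      qed
      moreover have "X \<inter> M = {}" using n by (auto simp: X_def)
      ultimately have "X = P" using Pmax P unfolding \<A>_def by blast
      moreover have "x \<in> X" unfolding X_def using ideal_zero[OF P(1)] by (intro CollectI exI[of _ 0] exI[of _ 1]) auto
      ultimately show False using x by blast
    qed
    show "a \<in> P \<or> b \<in> P"
    proof (rule ccontr)
      assume "\<not> (a \<in> P \<or> b \<in> P)"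
      then obtain p r p' r' where pr: "p \<in> P" "p + r * a \<in> M" "p' \<in> P" "p' + r' * b \<in> M"
        using ext by meson
      have "(p + r * a) * (p' + r' * b) = (p' + r' * b) * p + (r * a) * p' + (r * r') * (a * b)"
        by (simp add: algebra_simps)
      also have "\<dots> \<in> P" using pr ab by (intro ideal_add[OF P(1)]; rule_tac ideal_mult_left[OF P(1)])
      finally show False using Mm[OF pr(2,4)] P by blast
    qed
  qed
  then have "P = Q" using min P PQ by blast
  then show False using q Mq P by blast
qed

text \<open>Elements of the \<open>s\<close>-th power of \<open>I\<close> whose class in the graded ring of \<open>I\<close> becomes nilpotent
  after localization at \<open>Q\<close>.\<close>

definition Nset :: "'a::comm_ring_1 set \<Rightarrow> 'a set \<Rightarrow> nat \<Rightarrow> 'a set" where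
  "Nset Q I s = {f \<in> ipow I s. \<exists>h e. h \<notin> Q \<and> h * f ^ e \<in> ipow I (e * s + 1)}"

text \<open>Sums are handled as for a nilradical: in each term of the binomial expansion of exponent
  \<open>e + e'\<close>, either the first element occurs at least \<open>e\<close> times or the
  second at least \<open>e'\<close> times, and this gains the extra order.\<close>

lemma is_ideal_Nset:
  assumes Q: "is_prime_ideal Q"
  shows "is_ideal (Nset Q I s)"
  unfolding is_ideal_def
proof (intro conjI ballI allI)
  note II = is_ideal_ipow[of I]
  show "0 \<in> Nset Q I s"
    unfolding Nset_def using prime_ideal_one[OF Q] ideal_zero[OF II] by (auto intro!: exI[of _ 1])
  fix r f assume f: "f \<in> Nset Q I s"
  then obtain h e where he: "f \<in> ipow I s" "h \<notin> Q" "h * f ^ e \<in> ipow I (e * s + 1)" by (auto simp: Nset_def)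
  have "h * (r * f) ^ e = r ^ e * (h * f ^ e)" by (simp add: power_mult_distrib algebra_simps)
  then have "h * (r * f) ^ e \<in> ipow I (e * s + 1)" using he ideal_mult_left[OF II] by simp
  then show "r * f \<in> Nset Q I s" unfolding Nset_def using he ideal_mult_left[OF II] by blast
next
  note II = is_ideal_ipow[of I]
  fix f f' assume "f \<in> Nset Q I s" "f' \<in> Nset Q I s"
  then obtain h e h' e' where f: "f \<in> ipow I s" "h \<notin> Q" "h * f ^ e \<in> ipow I (e * s + 1)"
     and f': "f' \<in> ipow I s" "h' \<notin> Q" "h' * f' ^ e' \<in> ipow I (e' * s + 1)" by (auto simp: Nset_def)
  have "(h * h') * (f + f') ^ (e + e') = (\<Sum>k\<le>e + e'. of_nat ((e + e') choose k) * (h * h' * (f ^ k * f' ^ (e + e' - k))))"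
    unfolding binomial_ring by (simp add: sum_distrib_left algebra_simps)
  also have "\<dots> \<in> ipow I ((e + e') * s + 1)"
  proof (rule ideal_sum[OF II], rule ideal_mult_left[OF II])
    fix k assume k: "k \<in> {..e + e'}"
    show "h * h' * (f ^ k * f' ^ (e + e' - k)) \<in> ipow I ((e + e') * s + 1)"
    proof (cases "e \<le> k")
      case True
      then have "f ^ k = f ^ e * f ^ (k - e)" by (simp add: power_add[symmetric])
      then have "h * h' * (f ^ k * f' ^ (e + e' - k)) = h' * ((h * f ^ e) * (f ^ (k - e) * f' ^ (e + e' - k)))"
        by (simp add: algebra_simps)
      also have "\<dots> \<in> ipow I ((e * s + 1) + ((k - e) * s + (e + e' - k) * s))"
        by (rule ideal_mult_left[OF II], intro ipow_mult ipow_power f f')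
      also have "(e * s + 1) + ((k - e) * s + (e + e' - k) * s) = (e + e') * s + 1"
        using True k by (simp add: add_mult_distrib[symmetric])
      finally show ?thesis .
    next
      case False
      then have k': "e' \<le> e + e' - k" by simp
      then have "f' ^ (e + e' - k) = f' ^ e' * f' ^ (e + e' - k - e')"
        unfolding power_add[symmetric] by (intro arg_cong[of _ _ "(^) f'"]) linarith
      then have "h * h' * (f ^ k * f' ^ (e + e' - k)) = h * ((h' * f' ^ e') * (f ^ k * f' ^ (e + e' - k - e')))"
        by (simp add: algebra_simps)
      also have "\<dots> \<in> ipow I ((e' * s + 1) + (k * s + (e + e' - k - e') * s))"
        by (rule ideal_mult_left[OF II], intro ipow_mult ipow_power f f')
      also have "(e' * s + 1) + (k * s + (e + e' - k - e') * s) = (e + e') * s + 1"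
        using False by (simp add: add_mult_distrib[symmetric])
      finally show ?thesis .
    qed
  qed
  finally have "(h * h') * (f + f') ^ (e + e') \<in> ipow I ((e + e') * s + 1)" .
  moreover have "h * h' \<notin> Q" using f f' prime_ideal_mult[OF Q] by blast
  ultimately show "f + f' \<in> Nset Q I s"
    unfolding Nset_def using ideal_add[OF II f(1) f'(1)] by blast
qed

lemma Nset_cancel:
  assumes Q: "is_prime_ideal Q" and "b \<notin> Q" "f \<in> ipow I s" "b * f \<in> Nset Q I s"
  shows "f \<in> Nset Q I s"
proof -
  obtain h e where he: "h \<notin> Q" "h * (b * f) ^ e \<in> ipow I (e * s + 1)" using assms by (auto simp: Nset_def)
  then have "h * b ^ e * f ^ e \<in> ipow I (e * s + 1)" by (simp add: power_mult_distrib mult.assoc)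
  moreover have "h * b ^ e \<notin> Q" using he assms prime_ideal_mult[OF Q] prime_ideal_power[OF Q] by blast
  ultimately show ?thesis unfolding Nset_def using assms by blast
qed

lemma ipow_Suc_Nset:
  assumes Q: "is_prime_ideal Q"
  shows "ipow I (Suc s) \<subseteq> Nset Q I s"
proof
  fix f assume f: "f \<in> ipow I (Suc s)"
  then have "1 * f ^ 1 \<in> ipow I (1 * s + 1)" by simp
  then show "f \<in> Nset Q I s" unfolding Nset_def
    using prime_ideal_one[OF Q] f ipow_Suc_subset[of I s] by blast
qed

text \<open>When all of \<open>Q\<close> is nilpotent modulo \<open>I\<close> near \<open>Q\<close>,
  coefficients of forms of order \<open>s\<close> matter only modulo \<open>Q\<close>.\<close>

lemma Nset_mult_nil:
  assumes "h \<notin> Q" "h * q ^ e \<in> I" "f \<in> ipow I s"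
  shows "q * f \<in> Nset Q I s"
proof -
  have "(h * q ^ e) * f ^ e \<in> ipow I (Suc (e * s))" by (intro ipow_Suc_mult assms ipow_power)
  then have "h * (q * f) ^ e \<in> ipow I (e * s + 1)" by (simp add: power_mult_distrib mult.assoc)
  then show ?thesis unfolding Nset_def using assms ideal_mult_left[OF is_ideal_ipow] by blast
qed

section \<open>Leading forms of relations between generators\<close>

text \<open>Rewriting rules require explicit finite sums, whereas ideals are defined as
  intersections; this is the passage from one to the other.\<close>

lemma ideal_gen_image_repr:
  assumes "x \<in> ideal_gen (f ` X)"
  shows "\<exists>V c. finite V \<and> V \<subseteq> X \<and> x = (\<Sum>\<nu>\<in>V. c \<nu> * f \<nu>)"
proof -
  let ?J = "{x. \<exists>V c. finite V \<and> V \<subseteq> X \<and> x = (\<Sum>\<nu>\<in>V. c \<nu> * f \<nu>)}"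
  have "is_ideal ?J"
    unfolding is_ideal_def
  proof (intro conjI ballI allI)
    show "0 \<in> ?J" by (intro CollectI exI[of _ "{}"]) auto
    fix a b assume "a \<in> ?J" "b \<in> ?J"
    then obtain V c V' c' where a: "finite V" "V \<subseteq> X" "a = (\<Sum>\<nu>\<in>V. c \<nu> * f \<nu>)"
      and b: "finite V'" "V' \<subseteq> X" "b = (\<Sum>\<nu>\<in>V'. c' \<nu> * f \<nu>)" by auto
    let ?c = "\<lambda>\<nu>. (if \<nu> \<in> V then c \<nu> else 0) + (if \<nu> \<in> V' then c' \<nu> else 0)"
    have "(\<Sum>\<nu>\<in>V \<union> V'. ?c \<nu> * f \<nu>) =
      (\<Sum>\<nu>\<in>V \<union> V'. (if \<nu> \<in> V then c \<nu> * f \<nu> else 0)) + (\<Sum>\<nu>\<in>V \<union> V'. (if \<nu> \<in> V' then c' \<nu> * f \<nu> else 0))"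
      unfolding sum.distrib[symmetric] by (intro sum.cong) (auto simp: distrib_right)
    also have "(\<Sum>\<nu>\<in>V \<union> V'. (if \<nu> \<in> V then c \<nu> * f \<nu> else 0)) = a"
      unfolding a(3) using a b by (simp add: sum.inter_restrict[symmetric] Int_absorb1)
    also have "(\<Sum>\<nu>\<in>V \<union> V'. (if \<nu> \<in> V' then c' \<nu> * f \<nu> else 0)) = b"
      unfolding b(3) using a b by (simp add: sum.inter_restrict[symmetric] Int_absorb1)
    finally show "a + b \<in> ?J"
      using a b by (intro CollectI exI[of _ "V \<union> V'"] exI[of _ ?c]) auto
  next
    fix r a assume "a \<in> ?J"
    then obtain V c where a: "finite V" "V \<subseteq> X" "a = (\<Sum>\<nu>\<in>V. c \<nu> * f \<nu>)" by auto
    then show "r * a \<in> ?J"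
      by (intro CollectI exI[of _ V] exI[of _ "\<lambda>\<nu>. r * c \<nu>"]) (auto simp: sum_distrib_left mult.assoc)
  qed
  moreover have "f ` X \<subseteq> ?J"
  proof
    fix y assume "y \<in> f ` X"
    then obtain \<nu> where "\<nu> \<in> X" "y = f \<nu>" by auto
    then show "y \<in> ?J" by (intro CollectI exI[of _ "{\<nu>}"] exI[of _ "\<lambda>_. 1"]) auto
  qed
  ultimately have "ideal_gen (f ` X) \<subseteq> ?J" by (rule ideal_gen_least)
  with assms show ?thesis by (rule_tac CollectD[OF subsetD])
qed

lemma ideal_gen_mult:
  assumes J: "is_ideal J" and ST: "\<And>s t. s \<in> S \<Longrightarrow> t \<in> T \<Longrightarrow> s * t \<in> J"
    and "x \<in> ideal_gen S" "y \<in> ideal_gen T"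
  shows "x * y \<in> J"
proof -
  have "ideal_gen T \<subseteq> {t. s * t \<in> J}" if "s \<in> S" for s
  proof (rule ideal_gen_least)
    show "is_ideal {t. s * t \<in> J}" using ideal_colon[OF J, of s] by (simp add: mult.commute)
  qed (use ST that in blast)
  then have "ideal_gen S \<subseteq> {s. s * y \<in> J}"
    using assms(4) by (intro ideal_gen_least ideal_colon[OF J]) auto
  then show ?thesis using assms(3) by blast
qed

lemma ipow_gp:
  assumes fin: "finite J"
  shows "ipow (ideal_gen (g ` J)) s \<subseteq> ideal_gen (gp J g ` {\<nu> \<in> exps J. lev J \<nu> = s})"
proof (induction s)
  case 0
  have "gp J g (\<lambda>_. 0) \<in> ideal_gen (gp J g ` {\<nu> \<in> exps J. lev J \<nu> = 0})"
    by (rule ideal_gen_superset[THEN subsetD], rule imageI) (simp add: exps_def)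
  then have "1 \<in> ideal_gen (gp J g ` {\<nu> \<in> exps J. lev J \<nu> = 0})" by simp
  then have "x * 1 \<in> ideal_gen (gp J g ` {\<nu> \<in> exps J. lev J \<nu> = 0})" for x
    by (rule ideal_mult_left[OF is_ideal_ideal_gen])
  then show ?case by auto
next
  case (Suc s)
  show ?case
  proof (rule ipow_Suc_least[OF is_ideal_ideal_gen])
    fix a b assume a: "a \<in> ideal_gen (g ` J)" and b: "b \<in> ipow (ideal_gen (g ` J)) s"
    show "a * b \<in> ideal_gen (gp J g ` {\<nu> \<in> exps J. lev J \<nu> = Suc s})"
    proof (rule ideal_gen_mult[OF is_ideal_ideal_gen _ a])
      show "b \<in> ideal_gen (gp J g ` {\<nu> \<in> exps J. lev J \<nu> = s})" using Suc b by blast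
      fix u v assume "u \<in> g ` J" "v \<in> gp J g ` {\<nu> \<in> exps J. lev J \<nu> = s}"
      then obtain j \<nu> where j: "j \<in> J" "u = g j" and \<nu>: "\<nu> \<in> exps J" "lev J \<nu> = s" "v = gp J g \<nu>" by auto
      let ?\<nu> = "\<lambda>i. (if i = j then 1 else 0) + \<nu> i"
      have "u * v = gp J g ?\<nu>" unfolding gp_add gp_unit[OF fin j(1)] by (simp add: j \<nu>)
      moreover have "?\<nu> \<in> exps J" using j \<nu> by (auto simp: exps_def)
      moreover have "lev J ?\<nu> = Suc s" unfolding wt_add wt_unit[OF fin j(1)] \<nu>(2) by simp
      ultimately show "u * v \<in> ideal_gen (gp J g ` {\<nu> \<in> exps J. lev J \<nu> = Suc s})"
        by (intro ideal_gen_superset[THEN subsetD]) auto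
    qed
  qed
qed

text \<open>Collects what may stand below a leading power product of order \<open>s\<close> and
  weight \<open>m\<close>.\<close>

definition lower_forms :: "'b set \<Rightarrow> ('b \<Rightarrow> 'a::comm_ring_1) \<Rightarrow> ('b \<Rightarrow> nat) \<Rightarrow> nat \<Rightarrow> nat \<Rightarrow> 'a set" where
  "lower_forms J g w s m = ideal_gen (gp J g ` {\<nu> \<in> exps J. lev J \<nu> = s \<and> wt J w \<nu> < m})"

text \<open>Both weight bounds are strict, so the weights add up to at most
  \<open>m + m' - 2\<close>; this accounts for the \<open>+ 1\<close>.\<close>

lemma lower_forms_mult:
  assumes "x \<in> lower_forms J g w s m" "y \<in> lower_forms J g w s' m'" "m + m' \<le> M + 1"
  shows "x * y \<in> lower_forms J g w (s + s') M"
  unfolding lower_forms_def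
proof (rule ideal_gen_mult[OF is_ideal_ideal_gen _ assms(1,2)[unfolded lower_forms_def]])
  fix u v assume "u \<in> gp J g ` {\<nu> \<in> exps J. lev J \<nu> = s \<and> wt J w \<nu> < m}"
    "v \<in> gp J g ` {\<nu> \<in> exps J. lev J \<nu> = s' \<and> wt J w \<nu> < m'}"
  then obtain \<nu> \<nu>' where \<nu>: "\<nu> \<in> exps J" "lev J \<nu> = s" "wt J w \<nu> < m" "u = gp J g \<nu>"
    "\<nu>' \<in> exps J" "lev J \<nu>' = s'" "wt J w \<nu>' < m'" "v = gp J g \<nu>'" by auto
  let ?\<nu> = "\<lambda>i. \<nu> i + \<nu>' i"
  have "u * v = gp J g ?\<nu>" "?\<nu> \<in> exps J" using \<nu> by (auto simp: gp_add intro: exps_add)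
  moreover have "lev J ?\<nu> = s + s'" "wt J w ?\<nu> < M" unfolding wt_add using \<nu> assms(3) by auto
  ultimately show "u * v \<in> ideal_gen (gp J g ` {\<nu> \<in> exps J. lev J \<nu> = s + s' \<and> wt J w \<nu> < M})"
    by (intro ideal_gen_superset[THEN subsetD]) auto
qed

lemma lower_forms_mono: "m \<le> m' \<Longrightarrow> lower_forms J g w s m \<subseteq> lower_forms J g w s m'"
  unfolding lower_forms_def
  by (rule ideal_gen_least[OF is_ideal_ideal_gen]) (auto intro!: ideal_gen_superset[THEN subsetD])

text \<open>Leading power products multiply, and every other product in the expansion has at least
  one factor of smaller weight.\<close>

lemma leading_form_power:
  assumes \<alpha>: "\<alpha> \<in> exps J" "lev J \<alpha> = s" and l: "l \<in> lower_forms J g w s (wt J w \<alpha>)"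
  shows "\<exists>l'\<in>lower_forms J g w (e * s) (e * wt J w \<alpha>).
     (c * gp J g \<alpha> + l) ^ e = c ^ e * gp J g (\<lambda>i. e * \<alpha> i) + l'"
proof (induction e)
  case 0
  show ?case by (rule bexI[of _ 0]) (auto simp: lower_forms_def ideal_zero is_ideal_ideal_gen)
next
  case (Suc e)
  let ?L = "lower_forms J g w" and ?m = "wt J w \<alpha>" and ?G = "gp J g"
  obtain l' where l': "l' \<in> ?L (e * s) (e * ?m)" "(c * ?G \<alpha> + l) ^ e = c ^ e * ?G (\<lambda>i. e * \<alpha> i) + l'"
    using Suc by blast
  have id: "is_ideal (?L s m)" for s m unfolding lower_forms_def by (rule is_ideal_ideal_gen)
  have wm: "wt J v (\<lambda>i. e * \<alpha> i) = e * wt J v \<alpha>" for v by (simp add: wt_def sum_distrib_left algebra_simps)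
  have g0: "?G \<alpha> \<in> ?L s (?m + 1)" unfolding lower_forms_def
    using \<alpha> by (intro ideal_gen_superset[THEN subsetD]) auto
  have ge: "?G (\<lambda>i. e * \<alpha> i) \<in> ?L (e * s) (e * ?m + 1)" unfolding lower_forms_def
    using \<alpha> wm by (intro ideal_gen_superset[THEN subsetD]) (auto simp: exps_def)
  have "(c * ?G \<alpha> + l) ^ Suc e = (c * ?G \<alpha> + l) * (c ^ e * ?G (\<lambda>i. e * \<alpha> i) + l')" using l' by simp
  also have "\<dots> = c ^ Suc e * (?G \<alpha> * ?G (\<lambda>i. e * \<alpha> i)) + ((c * ?G \<alpha> + l) * l' + c ^ e * (l * ?G (\<lambda>i. e * \<alpha> i)))"
    by (simp add: algebra_simps)
  also have "?G \<alpha> * ?G (\<lambda>i. e * \<alpha> i) = ?G (\<lambda>i. Suc e * \<alpha> i)"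
    unfolding gp_add[symmetric] by simp
  finally have eq: "(c * ?G \<alpha> + l) ^ Suc e = c ^ Suc e * ?G (\<lambda>i. Suc e * \<alpha> i) + ((c * ?G \<alpha> + l) * l' + c ^ e * (l * ?G (\<lambda>i. e * \<alpha> i)))" .
  have F: "c * ?G \<alpha> + l \<in> ?L s (?m + 1)"
    using l lower_forms_mono[of ?m "?m + 1" J g w s] g0 by (intro ideal_add[OF id] ideal_mult_left[OF id]) auto
  have "(c * ?G \<alpha> + l) * l' \<in> ?L (s + e * s) (Suc e * ?m)"
    by (rule lower_forms_mult[OF F l'(1)]) simp
  moreover have "l * ?G (\<lambda>i. e * \<alpha> i) \<in> ?L (s + e * s) (Suc e * ?m)"
    by (rule lower_forms_mult[OF l ge]) simp
  ultimately have "(c * ?G \<alpha> + l) * l' + c ^ e * (l * ?G (\<lambda>i. e * \<alpha> i)) \<in> ?L (Suc e * s) (Suc e * ?m)"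
    by (auto intro!: ideal_add[OF id] ideal_mult_left[OF id])
  with eq show ?case by blast
qed

lemma power_add_expand: "\<exists>z. (x + y) ^ n = x ^ n + y * (z :: 'a::comm_ring_1)"
proof (induction n)
  case 0
  show ?case by (auto intro: exI[of _ 0])
next
  case (Suc n)
  then obtain z where "(x + y) ^ n = x ^ n + y * z" by blast
  then have "(x + y) ^ Suc n = x ^ Suc n + y * (x * z + x ^ n + y * z)" by (simp add: algebra_simps)
  then show ?case by blast
qed

text \<open>A power of the relation, times some \<open>h\<close> outside \<open>Q\<close>, has order
  one higher than expected. Its leading power product belongs to the exponent
  \<open>\<alpha>\<close> of greatest weight, unique by injectivity. The leading coefficient is then
  traded for an element of k[Y] by \<open>algebraic_mod_prime\<close> and the nilpotency of
  \<open>Q\<close>; what results is a rule with head \<open>e * \<alpha>\<close>.\<close>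

lemma relation_rule:
  fixes g :: "'b \<Rightarrow> ('n::finite, 'k::field) mpoly"
  assumes Q: "is_prime_ideal Q" and Y: "maxindep_mod Q Y" and fin: "finite J"
    and nil: "\<forall>q\<in>Q. \<exists>h e. h \<notin> Q \<and> h * q ^ e \<in> ideal_gen (g ` J)"
    and V: "finite V" "V \<noteq> {}" "V \<subseteq> exps J" "\<And>\<alpha>. \<alpha> \<in> V \<Longrightarrow> lev J \<alpha> = s" "\<And>\<alpha>. \<alpha> \<in> V \<Longrightarrow> c \<alpha> \<notin> Q"
    and N: "(\<Sum>\<alpha>\<in>V. c \<alpha> * gp J g \<alpha>) \<in> Nset Q (ideal_gen (g ` J)) s"
    and inj: "inj_on (wt J w) V"
  shows "\<exists>\<alpha>\<in>V. \<exists>e A H E. deg_le (- Y) 0 A \<and> A \<notin> Q \<and> H \<notin> Q \<and>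
     (\<forall>K>E. rwrule Y J g (\<lambda>i. K * w i) A H (0, \<lambda>i. e * \<alpha> i))"
proof -
  let ?I = "ideal_gen (g ` J)" and ?G = "gp J g"
  note II = is_ideal_ipow[of ?I]
  have ind: "indep_mod Q Y" using Y by (simp add: maxindep_mod_def)
  define m where "m = Max (wt J w ` V)"
  have "m \<in> wt J w ` V" unfolding m_def using V by (intro Max_in) auto
  then obtain \<alpha> where \<alpha>: "\<alpha> \<in> V" "wt J w \<alpha> = m" by auto
  have lt: "wt J w \<beta> < m" if "\<beta> \<in> V - {\<alpha>}" for \<beta>
  proof -
    have "wt J w \<beta> \<le> m" unfolding m_def using V that by (intro Max_ge) auto
    moreover have "wt J w \<beta> \<noteq> m" using inj \<alpha> that by (auto simp: inj_on_def)
    ultimately show ?thesis by simp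
  qed
  define l where "l = (\<Sum>\<beta>\<in>V - {\<alpha>}. c \<beta> * ?G \<beta>)"
  have "l \<in> lower_forms J g w s m" unfolding l_def lower_forms_def
    using V lt by (intro ideal_sum[OF is_ideal_ideal_gen] ideal_mult_left[OF is_ideal_ideal_gen]
        ideal_gen_superset[THEN subsetD]) auto
  then have l: "l \<in> lower_forms J g w s (wt J w \<alpha>)" using \<alpha> by simp
  have F: "(\<Sum>\<alpha>\<in>V. c \<alpha> * ?G \<alpha>) = c \<alpha> * ?G \<alpha> + l" unfolding l_def using \<alpha> V by (subst sum.remove[of _ \<alpha>]) auto
  obtain h e where h: "h \<notin> Q" "h * (c \<alpha> * ?G \<alpha> + l) ^ e \<in> ipow ?I (e * s + 1)"
    using N unfolding F Nset_def by blast
  obtain l' where l': "l' \<in> lower_forms J g w (e * s) (e * wt J w \<alpha>)"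
     "(c \<alpha> * ?G \<alpha> + l) ^ e = c \<alpha> ^ e * ?G (\<lambda>i. e * \<alpha> i) + l'"
    using leading_form_power[OF _ _ l] \<alpha> V by blast
  let ?\<mu> = "\<lambda>i. e * \<alpha> i"
  define a where "a = h * c \<alpha> ^ e"
  have aQ: "a \<notin> Q" unfolding a_def
    using h V(5)[OF \<alpha>(1)] prime_ideal_mult[OF Q] prime_ideal_power[OF Q] by blast
  have rel: "a * ?G ?\<mu> + h * l' \<in> ipow ?I (e * s + 1)"
    using h(2) unfolding l'(2) a_def by (simp add: algebra_simps)
  obtain d a' where d: "deg_le (- Y) 0 d" "d \<noteq> 0" "d + a * a' \<in> Q" using algebraic_mod_prime[OF Q Y aQ] by blast
  obtain H m' where H: "H \<notin> Q" "H * (d + a * a') ^ m' \<in> ?I" using bspec[OF nil d(3)] by blast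
  obtain z where z: "(d + a * a') ^ m' = d ^ m' + a * a' * z" using power_add_expand by blast
  \<comment> \<open>Only a multiple of a power of \<open>d + a * a'\<close> lies in
    \<open>I\<close>. Expanded, it says that \<open>H * A\<close> and
    \<open>- H * a * a' * z\<close> agree modulo \<open>I\<close>.\<close>
  define A where "A = d ^ m'"
  have dQ: "d \<notin> Q" using ind d by (auto simp: indep_mod_def)
  have A: "deg_le (- Y) 0 A" "A \<notin> Q"
    using deg_le_power[OF d(1), of m'] dQ prime_ideal_power[OF Q] by (auto simp: A_def)
  have wm: "wt J v ?\<mu> = e * wt J v \<alpha>" for v by (simp add: wt_def sum_distrib_left algebra_simps)
  have lev\<mu>: "lev J ?\<mu> = e * s" using wm V(4)[OF \<alpha>(1)] by simp
  define x where "x = a' * z * (h * l')"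
  define y where "y = A * H * ?G ?\<mu> - H * x"
  \<comment> \<open>Two replacements, each with an error of order \<open>e * s + 1\<close>: first
    \<open>H * A\<close> by \<open>- H * a * a' * z\<close>, then \<open>a\<close> times the head by
    \<open>- h * l'\<close>.\<close>
  have "y = H * (A + a * a' * z) * ?G ?\<mu> - (H * a' * z) * (a * ?G ?\<mu> + h * l')"
    unfolding y_def x_def by (simp add: algebra_simps)
  moreover have "H * (A + a * a' * z) * ?G ?\<mu> \<in> ipow ?I (Suc (e * s))"
    using H(2) z gp_mem_ipow[OF fin, of g ?\<mu>] unfolding A_def lev\<mu> by (intro ipow_Suc_mult) auto
  ultimately have "y \<in> ipow ?I (Suc (e * s))"
    using rel by (auto intro!: ideal_diff[OF II] ideal_mult_left[OF II])
  then have "y \<in> ideal_gen (?G ` {\<nu> \<in> exps J. lev J \<nu> = Suc (e * s)})"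
    using ipow_gp[OF fin] by blast
  then obtain V2 c2 where V2: "finite V2" "V2 \<subseteq> {\<nu> \<in> exps J. lev J \<nu> = Suc (e * s)}" "y = (\<Sum>\<nu>\<in>V2. c2 \<nu> * ?G \<nu>)"
    by (elim ideal_gen_image_repr[elim_format] exE conjE)
  have "x \<in> lower_forms J g w (e * s) (e * wt J w \<alpha>)" unfolding x_def
    using l'(1) unfolding lower_forms_def by (intro ideal_mult_left[OF is_ideal_ideal_gen])
  then obtain V1 c1 where V1: "finite V1" "V1 \<subseteq> {\<nu> \<in> exps J. lev J \<nu> = e * s \<and> wt J w \<nu> < e * wt J w \<alpha>}"
     "x = (\<Sum>\<nu>\<in>V1. c1 \<nu> * ?G \<nu>)"
    unfolding lower_forms_def by (elim ideal_gen_image_repr[elim_format] exE conjE)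
  have "finite (c1 ` V1)" using V1 by simp
  from finite_deg_bound[OF this] obtain E where E: "\<And>\<nu>. \<nu> \<in> V1 \<Longrightarrow> deg_le UNIV E (c1 \<nu>)" by blast
  \<comment> \<open>The weight drops by at least 1, the scaled weight by at least \<open>K\<close>;
    this outweighs the degree, at most \<open>E\<close>, that the new coefficients bring in.\<close>
  have "rwrule Y J g (\<lambda>i. K * w i) A H (0, ?\<mu>)" if K: "K > E" for K
    unfolding rwrule_def
  proof (intro exI conjI)
    show "finite V1" "finite V2" "V1 \<subseteq> exps J" "V2 \<subseteq> exps J" using V1 V2 by auto
    show "A * H * (mon (fst (0, ?\<mu>)) * ?G (snd (0, ?\<mu>))) = H * (\<Sum>\<nu>\<in>V1. c1 \<nu> * ?G \<nu>) + (\<Sum>\<nu>\<in>V2. c2 \<nu> * ?G \<nu>)"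
      unfolding V1(3)[symmetric] V2(3)[symmetric] y_def by simp
    show "\<forall>\<nu>\<in>V2. lev J \<nu> = Suc (lev J (snd (0, ?\<mu>)))" using V2 lev\<mu> by auto
    have wK: "wt J (\<lambda>i. K * w i) \<nu> = K * wt J w \<nu>" for \<nu> by (simp add: wt_def sum_distrib_left algebra_simps)
    show "\<forall>\<nu>\<in>V1. lev J \<nu> = lev J (snd (0, ?\<mu>)) \<and>
        (\<forall>\<kappa>\<in>ks (c1 \<nu>). vdeg (- Y) \<kappa> + wt J (\<lambda>i. K * w i) \<nu> <
           vdeg (- Y) (fst (0, ?\<mu>)) + wt J (\<lambda>i. K * w i) (snd (0, ?\<mu>)))"
    proof (intro ballI conjI)
      fix \<nu> assume \<nu>: "\<nu> \<in> V1"
      show "lev J \<nu> = lev J (snd (0, ?\<mu>))" using V1(2) \<nu> lev\<mu> by auto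
      fix \<kappa> assume "\<kappa> \<in> ks (c1 \<nu>)"
      then have "vdeg (- Y) \<kappa> \<le> E" using E[OF \<nu>] vdeg_mono[of "- Y" UNIV \<kappa>] by (auto simp: deg_le_def intro: le_trans)
      moreover have "wt J w \<nu> + 1 \<le> wt J w ?\<mu>" using V1(2) \<nu> by (auto simp: wm)
      then have "K * (wt J w \<nu> + 1) \<le> K * wt J w ?\<mu>" by (rule mult_left_mono) simp
      ultimately show "vdeg (- Y) \<kappa> + wt J (\<lambda>i. K * w i) \<nu> <
           vdeg (- Y) (fst (0, ?\<mu>)) + wt J (\<lambda>i. K * w i) (snd (0, ?\<mu>))"
        using K unfolding wK by simp
    qed
  qed
  then show ?thesis using \<alpha>(1) A H(1) by blast
qed

text \<open>The head comes from a power of the relation between \<open>i\<close> and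
  \<open>Y\<close>, since only a power of it falls into the ideal after multiplication by
  \<open>H\<close>. The lower terms contain no generators, so the rule is valid for every choice of
  weights.\<close>

lemma variable_rule:
  fixes g :: "'b \<Rightarrow> ('n::finite, 'k::field) mpoly"
  assumes Q: "is_prime_ideal Q" and Y: "maxindep_mod Q Y" and fin: "finite J" and i: "i \<notin> Y"
    and nil: "\<forall>q\<in>Q. \<exists>h e. h \<notin> Q \<and> h * q ^ e \<in> ideal_gen (g ` J)"
  shows "\<exists>e A H. deg_le (- Y) 0 A \<and> A \<notin> Q \<and> H \<notin> Q \<and>
     (\<forall>w. rwrule Y J g w A H (sgl i e, \<lambda>_. 0))"
proof -
  let ?I = "ideal_gen (g ` J)" and ?G = "gp J g" and ?X = "\<lambda>e. mon (sgl i e) :: ('n, 'k) mpoly"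
  have ind: "indep_mod Q Y" using Y by (simp add: maxindep_mod_def)
  obtain p where p: "p \<in> Q" "p \<noteq> 0" "deg_le (- insert i Y) 0 p" using Y i by (auto simp: maxindep_mod_def)
  obtain e a l where al: "p = a * ?X e + l" "a \<noteq> 0" "deg_le (- Y) 0 a" "deg_lt (- Y) e l"
    using leading_term[OF p(2,3) i] by blast
  obtain H m where H: "H \<notin> Q" "H * p ^ m \<in> ?I" using bspec[OF nil p(1)] by blast
  obtain l' where l': "p ^ m = a ^ m * ?X (m * e) + l'" "deg_lt (- Y) (m * e) l'"
    using leading_term_power[OF al(3,4) i] unfolding al(1) by blast
  have aQ: "a \<notin> Q" using ind al by (auto simp: indep_mod_def)
  have A: "deg_le (- Y) 0 (a ^ m)" "a ^ m \<notin> Q"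
    using deg_le_power[OF al(3), of m] aQ prime_ideal_power[OF Q] by auto
  have "H * p ^ m \<in> ideal_gen (?G ` {\<nu> \<in> exps J. lev J \<nu> = Suc 0})"
    using H(2) ipow_gp[OF fin, of g "Suc 0"] ipow_1[OF is_ideal_ideal_gen, of "g ` J"] by blast
  then obtain V2 c2 where V2: "finite V2" "V2 \<subseteq> {\<nu> \<in> exps J. lev J \<nu> = Suc 0}" "H * p ^ m = (\<Sum>\<nu>\<in>V2. c2 \<nu> * ?G \<nu>)"
    by (elim ideal_gen_image_repr[elim_format] exE conjE)
  let ?h = "(sgl i (m * e), \<lambda>_::'b. 0::nat)"
  have "rwrule Y J g w (a ^ m) H ?h" for w
    unfolding rwrule_def
  proof (intro exI conjI)
    show "finite {\<lambda>_::'b. 0::nat}" "finite V2" "{\<lambda>_::'b. 0::nat} \<subseteq> exps J" "V2 \<subseteq> exps J"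
      using V2 by (auto simp: exps_def)
    show "a ^ m * H * (mon (fst ?h) * ?G (snd ?h)) =
        H * (\<Sum>\<nu>\<in>{\<lambda>_::'b. 0::nat}. (- l') * ?G \<nu>) + (\<Sum>\<nu>\<in>V2. c2 \<nu> * ?G \<nu>)"
      unfolding V2(3)[symmetric] l'(1) by (simp add: algebra_simps)
    show "\<forall>\<nu>\<in>{\<lambda>_::'b. 0}. lev J \<nu> = lev J (snd ?h) \<and>
        (\<forall>\<kappa>\<in>ks (- l'). vdeg (- Y) \<kappa> + wt J w \<nu> < vdeg (- Y) (fst ?h) + wt J w (snd ?h))"
      using i deg_lt_uminus[OF l'(2)] by (auto simp: deg_lt_def)
    show "\<forall>\<nu>\<in>V2. lev J \<nu> = Suc (lev J (snd ?h))" using V2 by auto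
  qed
  then show ?thesis using A H(1) by blast
qed

section \<open>Analytically independent generators\<close>

text \<open>The weights are powers of \<open>B\<close>, so the exponents are the digits of the
  weight in base \<open>B\<close>.\<close>

lemma separating_weights:
  assumes "finite J"
  shows "\<exists>w. \<forall>\<alpha> \<beta>. (\<forall>i\<in>J. \<alpha> i < B \<and> \<beta> i < B) \<longrightarrow> wt J w \<alpha> = wt J w \<beta> \<longrightarrow> (\<forall>i\<in>J. \<alpha> i = \<beta> i)"
  using assms
proof (induction J rule: finite_induct)
  case (insert j J)
  then obtain w where w: "\<And>\<alpha> \<beta>. (\<forall>i\<in>J. \<alpha> i < B \<and> \<beta> i < B) \<Longrightarrow> wt J w \<alpha> = wt J w \<beta> \<Longrightarrow> (\<forall>i\<in>J. \<alpha> i = \<beta> i)"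
    by blast
  let ?w = "\<lambda>i. if i = j then 1 else B * w i"
  have W: "wt (insert j J) ?w \<alpha> = \<alpha> j + B * wt J w \<alpha>" for \<alpha>
  proof -
    have "wt J ?w \<alpha> = B * wt J w \<alpha>"
      unfolding wt_def sum_distrib_left using insert by (intro sum.cong) auto
    then show ?thesis using insert by (simp add: wt_def)
  qed
  show ?case
  proof (intro exI[of _ ?w] allI impI)
    fix \<alpha> \<beta> assume lt: "\<forall>i\<in>insert j J. \<alpha> i < B \<and> \<beta> i < B"
      and eq: "wt (insert j J) ?w \<alpha> = wt (insert j J) ?w \<beta>"
    have eq': "\<alpha> j + B * wt J w \<alpha> = \<beta> j + B * wt J w \<beta>" using eq unfolding W .
    have "(\<alpha> j + B * wt J w \<alpha>) mod B = (\<beta> j + B * wt J w \<beta>) mod B" using eq' by (rule arg_cong)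
    then have j: "\<alpha> j = \<beta> j" using lt by simp
    then have "B * wt J w \<alpha> = B * wt J w \<beta>" using eq' by simp
    moreover have "B > 0" using lt by auto
    ultimately have "wt J w \<alpha> = wt J w \<beta>" by simp
    then show "\<forall>i\<in>insert j J. \<alpha> i = \<beta> i" using w[of \<alpha> \<beta>] lt j by auto
  qed
qed simp

lemma exps_box:
  assumes "finite J"
  shows "finite {\<alpha> \<in> exps J. \<forall>i\<in>J. \<alpha> i < b i}"
    and "card {\<alpha> \<in> exps J. \<forall>i\<in>J. \<alpha> i < b i} \<le> (\<Prod>i\<in>J. b i)"
proof -
  let ?X = "{\<alpha> \<in> exps J. \<forall>i\<in>J. \<alpha> i < b i}" and ?P = "PiE J (\<lambda>i. {..<b i})"
  have fin: "finite ?P" using assms by (simp add: finite_PiE)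
  have inj: "inj_on (\<lambda>\<alpha>. restrict \<alpha> J) ?X"
  proof (rule inj_onI)
    fix \<alpha> \<beta> assume ab: "\<alpha> \<in> ?X" "\<beta> \<in> ?X" and r: "restrict \<alpha> J = restrict \<beta> J"
    show "\<alpha> = \<beta>"
    proof
      fix i show "\<alpha> i = \<beta> i" using ab fun_cong[OF r, of i] by (cases "i \<in> J") (auto simp: exps_def)
    qed
  qed
  have sub: "(\<lambda>\<alpha>. restrict \<alpha> J) ` ?X \<subseteq> ?P" by auto
  show "finite ?X" by (rule finite_imageD[OF finite_subset[OF sub fin] inj])
  show "card ?X \<le> (\<Prod>i\<in>J. b i)" using card_inj_on_le[OF inj sub fin] assms by (simp add: card_PiE)
qed

text \<open>For each possible set of large coordinates, fewer than \<open>j\<close> of them range up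
  to \<open>S\<close> and all others only up to the constant \<open>\<beta>\<close>. As a function
  of \<open>S\<close> the count has order \<open>S ^ (j - 1)\<close>.\<close>

lemma few_large_count:
  assumes fin: "finite J" and \<beta>: "\<beta> \<ge> 1" and S: "S \<ge> 1"
  shows "finite {\<alpha> \<in> exps J. (\<forall>i. \<alpha> i < S) \<and> card {i\<in>J. \<beta> \<le> \<alpha> i} < j}"
    and "card {\<alpha> \<in> exps J. (\<forall>i. \<alpha> i < S) \<and> card {i\<in>J. \<beta> \<le> \<alpha> i} < j} \<le> 2 ^ card J * (S ^ (j - 1) * \<beta> ^ card J)"
proof -
  let ?G = "{\<alpha> \<in> exps J. (\<forall>i. \<alpha> i < S) \<and> card {i\<in>J. \<beta> \<le> \<alpha> i} < j}"
  let ?X = "{X. X \<subseteq> J \<and> card X < j}"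
  let ?B = "\<lambda>X. {\<alpha> \<in> exps J. \<forall>i\<in>J. \<alpha> i < (if i \<in> X then S else \<beta>)}"
  have sub: "?G \<subseteq> (\<Union>X\<in>?X. ?B X)"
  proof
    fix \<alpha> assume "\<alpha> \<in> ?G"
    then show "\<alpha> \<in> (\<Union>X\<in>?X. ?B X)"
      by (intro UN_I[of "{i\<in>J. \<beta> \<le> \<alpha> i}"]) auto
  qed
  have finX: "finite ?X" using fin by simp
  have finB: "finite (?B X)" for X by (rule exps_box(1)[OF fin])
  have cB: "card (?B X) \<le> S ^ (j - 1) * \<beta> ^ card J" if X: "X \<in> ?X" for X
  proof -
    have "card (?B X) \<le> (\<Prod>i\<in>J. if i \<in> X then S else \<beta>)" by (rule exps_box(2)[OF fin])
    also have "\<dots> = (\<Prod>i\<in>X. if i \<in> X then S else \<beta>) * (\<Prod>i\<in>J - X. if i \<in> X then S else \<beta>)"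
      using X fin by (subst prod.subset_diff[of X]) (auto simp: mult.commute)
    also have "\<dots> = S ^ card X * \<beta> ^ card (J - X)" by simp
    also have "\<dots> \<le> S ^ (j - 1) * \<beta> ^ card J"
      using X \<beta> S fin by (intro mult_mono power_increasing card_mono) auto
    finally show ?thesis .
  qed
  show "finite ?G" by (rule finite_subset[OF sub]) (use finX finB in blast)
  have "card ?G \<le> card (\<Union>X\<in>?X. ?B X)" by (rule card_mono[OF _ sub]) (use finX finB in blast)
  also have "\<dots> \<le> (\<Sum>X\<in>?X. card (?B X))" by (rule card_UN_le[OF finX])
  also have "\<dots> \<le> card ?X * (S ^ (j - 1) * \<beta> ^ card J)"
    using sum_bounded_above[of ?X "\<lambda>X. card (?B X)"] cB by simp
  also have "card ?X \<le> card (Pow J)" using fin by (intro card_mono) auto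
  also have "card (Pow J) = 2 ^ card J" by (rule card_Pow[OF fin])
  finally show "card ?G \<le> 2 ^ card J * (S ^ (j - 1) * \<beta> ^ card J)" by simp
qed

text \<open>Algebraic independence of the generators indexed by \<open>A\<close> in the reduced
  fibre at \<open>Q\<close> of the graded ring of the ideal: a form becomes nilpotent there only if
  all its coefficients lie in \<open>Q\<close>. The ideal comes from all of \<open>J\<close>; only
  the exponents are confined to \<open>A\<close>.\<close>

definition analytic_indep :: "('n, 'k::comm_ring_1) mpoly set \<Rightarrow> 'b set \<Rightarrow> ('b \<Rightarrow> ('n, 'k) mpoly) \<Rightarrow> 'b set \<Rightarrow> bool" where
  "analytic_indep Q J g A \<longleftrightarrow> (\<forall>s V c. finite V \<longrightarrow> V \<subseteq> exps A \<longrightarrow> (\<forall>\<alpha>\<in>V. lev J \<alpha> = s) \<longrightarrow>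
     (\<Sum>\<alpha>\<in>V. c \<alpha> * gp J g \<alpha>) \<in> Nset Q (ideal_gen (g ` J)) s \<longrightarrow> (\<forall>\<alpha>\<in>V. c \<alpha> \<in> Q))"

text \<open>Terms with coefficient in \<open>Q\<close> already belong to \<open>Nset\<close> and are
  dropped, which leaves a relation of the kind that \<open>relation_rule\<close> accepts.\<close>

lemma not_analytic_indepD:
  fixes g :: "'b \<Rightarrow> ('n, 'k::comm_ring_1) mpoly"
  assumes Q: "is_prime_ideal Q" and fin: "finite J" and n: "\<not> analytic_indep Q J g A"
    and nil: "\<forall>q\<in>Q. \<exists>h e. h \<notin> Q \<and> h * q ^ e \<in> ideal_gen (g ` J)"
  shows "\<exists>s V c. finite V \<and> V \<noteq> {} \<and> V \<subseteq> exps A \<and> (\<forall>\<alpha>\<in>V. lev J \<alpha> = s \<and> c \<alpha> \<notin> Q) \<and>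
     (\<Sum>\<alpha>\<in>V. c \<alpha> * gp J g \<alpha>) \<in> Nset Q (ideal_gen (g ` J)) s"
proof -
  let ?N = "Nset Q (ideal_gen (g ` J))"
  obtain s V c where V: "finite V" "V \<subseteq> exps A" "\<forall>\<alpha>\<in>V. lev J \<alpha> = s"
    "(\<Sum>\<alpha>\<in>V. c \<alpha> * gp J g \<alpha>) \<in> ?N s" "\<exists>\<alpha>\<in>V. c \<alpha> \<notin> Q"
    using n unfolding analytic_indep_def by blast
  let ?V = "{\<alpha>\<in>V. c \<alpha> \<notin> Q}"
  have "c \<alpha> * gp J g \<alpha> \<in> ?N s" if "\<alpha> \<in> V - ?V" for \<alpha>
  proof -
    have "c \<alpha> \<in> Q" "lev J \<alpha> = s" using that V by auto
    then show ?thesis using nil gp_mem_ipow[OF fin, of g \<alpha>] Nset_mult_nil by metis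
  qed
  then have "(\<Sum>\<alpha>\<in>V - ?V. c \<alpha> * gp J g \<alpha>) \<in> ?N s" by (rule ideal_sum[OF is_ideal_Nset[OF Q]])
  from ideal_diff[OF is_ideal_Nset[OF Q] V(4) this]
  have "(\<Sum>\<alpha>\<in>?V. c \<alpha> * gp J g \<alpha>) \<in> ?N s"
    using sum.subset_diff[of ?V V "\<lambda>\<alpha>. c \<alpha> * gp J g \<alpha>"] V(1) by simp
  then show ?thesis using V by (intro exI[of _ s] exI[of _ ?V] exI[of _ c]) auto
qed

text \<open>The order of choices matters. One weight must separate the exponents in all relations
  before the heads are known; then one scale \<open>K\<close> must exceed all the degree bounds; the
  variable rules hold for any weights and are added last.\<close>

lemma dependent_rules:
  fixes g :: "'b \<Rightarrow> ('n::finite, 'k::field) mpoly"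
  assumes Q: "is_prime_ideal Q" and Y: "maxindep_mod Q Y" and fin: "finite J"
    and nil: "\<forall>q\<in>Q. \<exists>h e. h \<notin> Q \<and> h * q ^ e \<in> ideal_gen (g ` J)"
    and \<A>: "\<forall>A\<in>\<A>. A \<subseteq> J \<and> \<not> analytic_indep Q J g A"
  shows "\<exists>w \<mu> et A H. deg_le (- Y) 0 A \<and> A \<notin> Q \<and> H \<notin> Q \<and> (\<forall>B\<in>\<A>. \<mu> B \<in> exps B) \<and>
     (\<forall>h\<in>(\<lambda>i. (sgl i (et i), \<lambda>_. 0)) ` (- Y) \<union> (\<lambda>B. (0, \<mu> B)) ` \<A>. rwrule Y J g w A H h)"
proof -
  let ?N = "Nset Q (ideal_gen (g ` J))"
  have ind: "indep_mod Q Y" using Y by (simp add: maxindep_mod_def)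
  have fA: "finite \<A>" by (rule finite_subset[of _ "Pow J"]) (use \<A> fin in auto)
  define R where "R = (\<lambda>A s V c. finite V \<and> V \<noteq> {} \<and> V \<subseteq> exps A \<and> (\<forall>\<alpha>\<in>V. lev J \<alpha> = s \<and> c \<alpha> \<notin> Q) \<and>
     (\<Sum>\<alpha>\<in>V. c \<alpha> * gp J g \<alpha>) \<in> ?N s)"
  have "\<forall>A\<in>\<A>. \<exists>s V c. R A s V c"
  proof
    fix A assume "A \<in> \<A>"
    then have "\<not> analytic_indep Q J g A" using \<A> by simp
    from not_analytic_indepD[OF Q fin this nil] show "\<exists>s V c. R A s V c" unfolding R_def .
  qed
  from bchoice[OF this] obtain s where "\<forall>A\<in>\<A>. \<exists>V c. R A (s A) V c" ..
  from bchoice[OF this] obtain V where "\<forall>A\<in>\<A>. \<exists>c. R A (s A) (V A) c" ..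
  from bchoice[OF this] obtain c where "\<forall>A\<in>\<A>. R A (s A) (V A) (c A)" ..
  note V = this[unfolded R_def]
  have "finite (\<Union>A\<in>\<A>. \<Union>\<alpha>\<in>V A. \<alpha> ` J)" using fA V fin by auto
  then obtain B where B: "\<forall>x\<in>(\<Union>A\<in>\<A>. \<Union>\<alpha>\<in>V A. \<alpha> ` J). x < B"
    unfolding finite_nat_set_iff_bounded ..
  have B: "\<alpha> i < B" if "A \<in> \<A>" "\<alpha> \<in> V A" "i \<in> J" for A \<alpha> i
    by (rule bspec[OF B]) (use that in blast)
  obtain w where w: "\<And>\<alpha> \<beta>. (\<forall>i\<in>J. \<alpha> i < B \<and> \<beta> i < B) \<Longrightarrow> wt J w \<alpha> = wt J w \<beta> \<Longrightarrow> (\<forall>i\<in>J. \<alpha> i = \<beta> i)"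
    using separating_weights[OF fin] by blast
  have VG: "V A \<subseteq> exps J" if "A \<in> \<A>" for A
    using V bspec[OF \<A> that] that unfolding exps_def by blast
  have inj: "inj_on (wt J w) (V A)" if A: "A \<in> \<A>" for A
  proof (rule inj_onI)
    fix \<alpha> \<beta> assume ab: "\<alpha> \<in> V A" "\<beta> \<in> V A" "wt J w \<alpha> = wt J w \<beta>"
    then have e: "\<forall>i\<in>J. \<alpha> i = \<beta> i" using w B[OF A] by blast
    have "\<alpha> \<in> exps J" "\<beta> \<in> exps J" using VG[OF A] ab by auto
    then show "\<alpha> = \<beta>"
    proof (intro ext)
      fix i assume "\<alpha> \<in> exps J" "\<beta> \<in> exps J"
      then show "\<alpha> i = \<beta> i" using e by (cases "i \<in> J") (auto simp: exps_def)
    qed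
  qed
  define W where "W = (\<lambda>A \<mu> E. \<mu> \<in> exps A \<and> (\<exists>A1 H1. deg_le (- Y) 0 A1 \<and> A1 \<notin> Q \<and> H1 \<notin> Q \<and>
     (\<forall>K>E. rwrule Y J g (\<lambda>i. K * w i) A1 H1 (0, \<mu>))))"
  have "\<forall>A\<in>\<A>. \<exists>\<mu> E. W A \<mu> E"
  proof
    fix A assume A: "A \<in> \<A>"
    have VA: "finite (V A)" "V A \<noteq> {}" "\<And>\<alpha>. \<alpha> \<in> V A \<Longrightarrow> lev J \<alpha> = s A" "\<And>\<alpha>. \<alpha> \<in> V A \<Longrightarrow> c A \<alpha> \<notin> Q"
      "(\<Sum>\<alpha>\<in>V A. c A \<alpha> * gp J g \<alpha>) \<in> ?N (s A)" "V A \<subseteq> exps A"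
      using V A by auto
    obtain \<alpha> e A1 H1 E where r: "\<alpha> \<in> V A" "deg_le (- Y) 0 A1" "A1 \<notin> Q" "H1 \<notin> Q"
       "\<forall>K>E. rwrule Y J g (\<lambda>i. K * w i) A1 H1 (0, \<lambda>i. e * \<alpha> i)"
      using relation_rule[OF Q Y fin nil VA(1,2) VG[OF A] VA(3,4,5) inj[OF A]] by blast
    moreover have "(\<lambda>i. e * \<alpha> i) \<in> exps A" using r(1) VA(6) by (auto simp: exps_def)
    ultimately show "\<exists>\<mu> E. W A \<mu> E" unfolding W_def by blast
  qed
  from bchoice[OF this] obtain \<mu> where "\<forall>A\<in>\<A>. \<exists>E. W A (\<mu> A) E" ..
  from bchoice[OF this] obtain E where "\<forall>A\<in>\<A>. W A (\<mu> A) (E A)" ..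
  note E = this[unfolded W_def]
  obtain K where K: "\<And>A. A \<in> \<A> \<Longrightarrow> E A < K"
    using fA finite_nat_set_iff_bounded[of "E ` \<A>"] by blast
  let ?w = "\<lambda>i. K * w i"
  have "\<forall>i\<in>-Y. \<exists>e. \<exists>A H. deg_le (- Y) 0 A \<and> A \<notin> Q \<and> H \<notin> Q \<and> rwrule Y J g ?w A H (sgl i e, \<lambda>_. 0)"
    using variable_rule[OF Q Y fin _ nil] by blast
  from bchoice[OF this] obtain et where et: "\<forall>i\<in>-Y. \<exists>A H. deg_le (- Y) 0 A \<and> A \<notin> Q \<and> H \<notin> Q \<and>
     rwrule Y J g ?w A H (sgl i (et i), \<lambda>_. 0)" ..
  let ?heads = "(\<lambda>i. (sgl i (et i), \<lambda>_. 0)) ` (- Y) \<union> (\<lambda>B. (0, \<mu> B)) ` \<A>"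
  have "\<exists>A H. deg_le (- Y) 0 A \<and> A \<notin> Q \<and> H \<notin> Q \<and> (\<forall>h\<in>?heads. rwrule Y J g ?w A H h)"
  proof (rule common_rules[OF Q ind])
    show "finite ?heads" using fA by simp
    fix h assume "h \<in> ?heads"
    then show "\<exists>A H. deg_le (- Y) 0 A \<and> A \<notin> Q \<and> H \<notin> Q \<and> rwrule Y J g ?w A H h"
    proof
      assume "h \<in> (\<lambda>i. (sgl i (et i), \<lambda>_. 0)) ` (- Y)"
      then show ?thesis using et by auto
    next
      assume "h \<in> (\<lambda>B. (0, \<mu> B)) ` \<A>"
      then obtain B where B: "B \<in> \<A>" "h = (0, \<mu> B)" by auto
      then obtain A1 H1 where "deg_le (- Y) 0 A1" "A1 \<notin> Q" "H1 \<notin> Q"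
        "\<forall>K>E B. rwrule Y J g (\<lambda>i. K * w i) A1 H1 (0, \<mu> B)" using E by meson
      then show ?thesis unfolding B(2) using K[OF B(1)] by blast
    qed
  qed
  then obtain A H where AH: "deg_le (- Y) 0 A" "A \<notin> Q" "H \<notin> Q" "\<forall>h\<in>?heads. rwrule Y J g ?w A H h"
    by (elim exE conjE)
  have \<mu>: "\<forall>B\<in>\<A>. \<mu> B \<in> exps B" using E by simp
  show ?thesis
    by (rule exI[of _ ?w], rule exI[of _ \<mu>], rule exI[of _ et], rule exI[of _ A], rule exI[of _ H])
       (intro conjI AH \<mu>)
qed

text \<open>The exponent in the dimension bound is \<open>CARD('n) - 1 = card Y + (j - 1)\<close>.
  The first part counts monomials of bounded \<open>Y\<close>-degree; the second arises because a
  head for every \<open>j\<close>-subset of generators leaves at most \<open>j - 1\<close> large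
  exponents in a normal form.\<close>

theorem exists_analytic_indep:
  fixes g :: "'b \<Rightarrow> ('n::finite, 'k::field_char_0) mpoly"
  assumes Q: "is_prime_ideal Q" and Y: "maxindep_mod Q Y" "Y \<noteq> UNIV" and fin: "finite J"
    and gQ: "g ` J \<subseteq> Q"
    and nil: "\<forall>q\<in>Q. \<exists>h e. h \<notin> Q \<and> h * q ^ e \<in> ideal_gen (g ` J)"
  shows "\<exists>A\<subseteq>J. card A = card (- Y) \<and> analytic_indep Q J g A"
proof (rule ccontr)
  assume neg: "\<not> ?thesis"
  let ?I = "ideal_gen (g ` J)"
  have IQ: "?I \<subseteq> Q" by (rule ideal_gen_least[OF prime_is_ideal[OF Q] gQ])
  define j where "j = card (- Y)"
  define \<A> where "\<A> = {A. A \<subseteq> J \<and> card A = j}"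
  have fA: "finite \<A>" unfolding \<A>_def by (rule finite_subset[of _ "Pow J"]) (use fin in auto)
  have j0: "j \<ge> 1" using Y(2) unfolding j_def by (auto simp: Suc_le_eq card_gt_0_iff)
  have jn: "card Y + j = CARD('n)" unfolding j_def by (simp add: Compl_eq_Diff_UNIV card_Diff_subset card_mono)
  obtain w \<mu> et A H where A: "deg_le (- Y) 0 A" "A \<notin> Q" "H \<notin> Q" and \<mu>: "\<And>B. B \<in> \<A> \<Longrightarrow> \<mu> B \<in> exps B"
    and rw: "\<forall>h\<in>(\<lambda>i. (sgl i (et i), \<lambda>_. 0)) ` (- Y) \<union> (\<lambda>B. (0, \<mu> B)) ` \<A>. rwrule Y J g w A H h"
  proof -
    have "\<forall>B\<in>\<A>. B \<subseteq> J \<and> \<not> analytic_indep Q J g B"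
      using neg unfolding \<A>_def j_def by blast
    from dependent_rules[OF Q Y(1) fin nil this]
    show thesis by (elim exE conjE) (rule that, blast+)
  qed
  define heads where "heads = (\<lambda>i. (sgl i (et i), \<lambda>_::'b. 0::nat)) ` (- Y) \<union> (\<lambda>B. (0, \<mu> B)) ` \<A>"
  have finh: "finite heads" using fA by (simp add: heads_def)
  have hY: "vdeg Y (fst h) = 0" if "h \<in> heads" for h using that by (auto simp: heads_def)
  have rw': "rwrule Y J g w A H h" if "h \<in> heads" for h using rw that by (simp add: heads_def)
  from rewriting[OF fin finh A(1) hY rw']
  obtain C where C: "\<forall>N S \<gamma> \<alpha>. \<alpha> \<in> exps J \<longrightarrow> vdeg (- Y) \<gamma> + wt J w \<alpha> + C * (S - lev J \<alpha>) \<le> N \<longrightarrow>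
     (\<exists>z\<in>mp.span (normal_forms Y J g heads H S (vdeg Y \<gamma> + C * N)).
        A ^ N * (H ^ (S - lev J \<alpha>) * (mon \<gamma> * gp J g \<alpha>)) - z \<in> ipow ?I S)"
    by blast
  have "finite (\<Union>B\<in>\<A>. \<mu> B ` J)" using fA fin by auto
  then obtain \<beta>0 where \<beta>0: "\<And>B i. B \<in> \<A> \<Longrightarrow> i \<in> J \<Longrightarrow> \<mu> B i < \<beta>0"
    unfolding finite_nat_set_iff_bounded by blast
  define \<beta> where "\<beta> = \<beta>0 + 1"
  let ?n = "CARD('n)"
  define P where "P = (\<Prod>i\<in>-Y. et i)"
  define K where "K = ?n + (?n + C * (?n + C * (?n + 1))) + C * (?n + 1) + 2"
  define c0 where "c0 = P * (2 ^ card J * \<beta> ^ card J)"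
  \<comment> \<open>The monomials with all exponents below \<open>\<tau>\<close> have degree at most
    \<open>?n * \<tau>\<close>, and \<open>S\<close> is the next integer. Since \<open>S\<close> and
    \<open>d + 1\<close> are at most \<open>K * \<tau>\<close>, there are at most
    \<open>K ^ (?n - 1) * c0 * \<tau> ^ (?n - 1)\<close> normal forms, fewer than
    \<open>\<tau> ^ ?n\<close>.\<close>
  define \<tau> where "\<tau> = K ^ (?n - 1) * c0 + 1"
  define S where "S = ?n * \<tau> + 1"
  define N where "N = ?n * \<tau> + C * S"
  define d where "d = ?n * \<tau> + C * N"
  have \<tau>1: "\<tau> \<ge> 1" by (simp add: \<tau>_def)
  have SK: "S \<le> K * \<tau>"
  proof -
    have "S \<le> (?n + 1) * \<tau>" using \<tau>1 by (simp add: S_def)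
    also have "\<dots> \<le> K * \<tau>" by (intro mult_right_mono) (auto simp: K_def)
    finally show ?thesis .
  qed
  have dK: "d + 1 \<le> K * \<tau>"
  proof -
    have "S \<le> (?n + 1) * \<tau>" using \<tau>1 by (simp add: S_def)
    then have "C * S \<le> C * ((?n + 1) * \<tau>)" by simp
    then have "N \<le> (?n + C * (?n + 1)) * \<tau>" unfolding N_def by (simp add: algebra_simps)
    then have "C * N \<le> C * ((?n + C * (?n + 1)) * \<tau>)" by simp
    then have "d + 1 \<le> (?n + C * (?n + C * (?n + 1)) + 1) * \<tau>" using \<tau>1 unfolding d_def by (simp add: algebra_simps)
    also have "\<dots> \<le> K * \<tau>" by (intro mult_right_mono) (auto simp: K_def)
    finally show ?thesis .
  qed
  define Z where "Z = normal_forms Y J g heads H S d"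
  let ?B = "{\<gamma> :: 'n \<Rightarrow>\<^sub>0 nat. \<forall>i. lk \<gamma> i < (if i \<in> Y then d + 1 else et i)}"
  let ?G = "{\<alpha> \<in> exps J. (\<forall>i. \<alpha> i < S) \<and> card {i\<in>J. \<beta> \<le> \<alpha> i} < j}"
  have b1: "\<beta> \<ge> 1" and S1: "S \<ge> 1" by (auto simp: \<beta>_def S_def)
  have "Z \<subseteq> (\<lambda>(\<gamma>, \<alpha>). H ^ (S - lev J \<alpha>) * (mon \<gamma> * gp J g \<alpha>)) ` (?B \<times> ?G)"
  proof
    fix z assume "z \<in> Z"
    then obtain \<gamma> \<alpha> where z: "z = H ^ (S - lev J \<alpha>) * (mon \<gamma> * gp J g \<alpha>)" "\<alpha> \<in> exps J" "lev J \<alpha> < S"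
      "vdeg Y \<gamma> \<le> d" "\<not> reducible heads \<gamma> \<alpha>" unfolding Z_def normal_forms_def by blast
    have "lk \<gamma> i < et i" if "i \<notin> Y" for i
    proof (rule ccontr)
      assume "\<not> lk \<gamma> i < et i"
      then have "reducible heads \<gamma> \<alpha>"
        using that unfolding reducible_def heads_def
        by (intro bexI[of _ "(sgl i (et i), \<lambda>_. 0)"]) (auto simp: lookup_single when_def)
      then show False using z by simp
    qed
    moreover have "lk \<gamma> i < d + 1" if "i \<in> Y" for i
      using lookup_le_vdeg[OF that, of \<gamma>] z by simp
    ultimately have \<gamma>B: "\<gamma> \<in> ?B" by auto
    have "\<alpha> i < S" for i
    proof (cases "i \<in> J")
      case True
      then have "\<alpha> i \<le> lev J \<alpha>" unfolding wt_def using fin member_le_sum[of i J "\<lambda>i. 1 * \<alpha> i"] by simp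
      then show ?thesis using z by simp
    qed (use z S1 in \<open>auto simp: exps_def\<close>)
    \<comment> \<open>Were \<open>j\<close> exponents at least \<open>\<beta>\<close>, the head of a
      \<open>j\<close>-subset of these coordinates would divide the power product.\<close>
    moreover have "card {i\<in>J. \<beta> \<le> \<alpha> i} < j"
    proof (rule ccontr)
      assume "\<not> card {i\<in>J. \<beta> \<le> \<alpha> i} < j"
      then obtain B where B: "B \<subseteq> {i\<in>J. \<beta> \<le> \<alpha> i}" "card B = j"
        by (meson not_less obtain_subset_with_card_n)
      then have BA: "B \<in> \<A>" by (auto simp: \<A>_def)
      have "\<mu> B i \<le> \<alpha> i" for i
      proof (cases "i \<in> B")
        case True
        then show ?thesis using \<beta>0[OF BA, of i] B by (auto simp: \<beta>_def)
      qed (use \<mu>[OF BA] in \<open>auto simp: exps_def\<close>)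
      then have "reducible heads \<gamma> \<alpha>"
        unfolding reducible_def heads_def using BA by (intro bexI[of _ "(0, \<mu> B)"]) auto
      then show False using z by simp
    qed
    ultimately have "\<alpha> \<in> ?G" using z by blast
    then show "z \<in> (\<lambda>(\<gamma>, \<alpha>). H ^ (S - lev J \<alpha>) * (mon \<gamma> * gp J g \<alpha>)) ` (?B \<times> ?G)"
      using z(1) \<gamma>B by (intro image_eqI[of _ _ "(\<gamma>, \<alpha>)"]) simp_all
  qed
  note Zsub = this
  have finBG: "finite (?B \<times> ?G)"
    by (intro finite_cartesian_product box_card(1) few_large_count(1)[OF fin b1 S1])
  have finZ: "finite Z" by (rule finite_subset[OF Zsub finite_imageI[OF finBG]])
  have "card Z \<le> card (?B \<times> ?G)" by (rule surj_card_le[OF finBG Zsub])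
  also have "\<dots> = card ?B * card ?G" by (rule card_cartesian_product)
  also have "\<dots> \<le> ((d + 1) ^ card Y * P) * (2 ^ card J * (S ^ (j - 1) * \<beta> ^ card J))"
    by (intro mult_mono few_large_count(2)[OF fin b1 S1]) (simp_all only: box_card(2) prod_if_split P_def order_refl zero_le)
  also have "\<dots> = c0 * ((d + 1) ^ card Y * S ^ (j - 1))" by (simp add: c0_def algebra_simps)
  also have "\<dots> \<le> c0 * ((K * \<tau>) ^ card Y * (K * \<tau>) ^ (j - 1))"
    using dK SK by (intro mult_left_mono mult_mono power_mono) auto
  also have "(K * \<tau>) ^ card Y * (K * \<tau>) ^ (j - 1) = (K * \<tau>) ^ (?n - 1)"
    unfolding power_add[symmetric] using jn j0 by (intro arg_cong[of _ _ "(^) (K * \<tau>)"]) linarith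
  also have "c0 * (K * \<tau>) ^ (?n - 1) = (K ^ (?n - 1) * c0) * \<tau> ^ (?n - 1)" by (simp add: power_mult_distrib algebra_simps)
  also have "\<dots> < \<tau> * \<tau> ^ (?n - 1)" by (intro mult_strict_right_mono) (auto simp: \<tau>_def)
  also have "\<dots> = \<tau> ^ ?n" using jn j0 by (subst power_Suc[symmetric]) (intro arg_cong[of _ _ "(^) \<tau>"], linarith)
  finally have cardZ: "card Z < \<tau> ^ ?n" .
  define \<Omega> where "\<Omega> = {\<gamma> :: 'n \<Rightarrow>\<^sub>0 nat. \<forall>i. lk \<gamma> i < \<tau>}"
  have \<Omega>: "finite \<Omega>" "card \<Omega> = \<tau> ^ ?n" unfolding \<Omega>_def using box_card[of "\<lambda>_. \<tau>"] by auto
  have dO: "vdeg UNIV \<gamma> \<le> ?n * \<tau>" if "\<gamma> \<in> \<Omega>" for \<gamma>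
    unfolding vdeg_def using sum_bounded_above[of UNIV "lk \<gamma>" \<tau>] that by (auto simp: \<Omega>_def less_imp_le)
  define v where "v = (\<lambda>\<gamma>. A ^ N * (H ^ S * mon \<gamma>))"
  have "\<exists>c. (\<exists>i\<in>\<Omega>. c i \<noteq> 0) \<and> (\<Sum>i\<in>\<Omega>. psc (c i) (v i)) \<in> ipow ?I S"
  proof (rule linear_dependence_mod_subspace[OF finZ \<Omega>(1)])
    show "card Z < card \<Omega>" using cardZ \<Omega> by simp
    show "mp.subspace (ipow ?I S)" by (rule subspace_ideal[OF is_ideal_ipow])
    fix \<gamma> assume "\<gamma> \<in> \<Omega>"
    then have "vdeg (- Y) \<gamma> + C * S \<le> N" and dd: "vdeg Y \<gamma> + C * N \<le> d"
      using dO[of \<gamma>] vdeg_mono[of Y UNIV \<gamma>] vdeg_mono[of "-Y" UNIV \<gamma>] by (auto simp: N_def d_def)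
    then have "\<exists>z\<in>mp.span (normal_forms Y J g heads H S (vdeg Y \<gamma> + C * N)). v \<gamma> - z \<in> ipow ?I S"
      using C[rule_format, of "\<lambda>_. 0" \<gamma> S N] by (simp add: exps_def v_def)
    moreover have "mp.span (normal_forms Y J g heads H S (vdeg Y \<gamma> + C * N)) \<subseteq> mp.span Z"
      unfolding Z_def by (intro mp.span_mono normal_forms_mono dd)
    ultimately show "\<exists>z\<in>mp.span Z. v \<gamma> - z \<in> ipow ?I S" by blast
  qed
  then obtain c where c: "\<exists>i\<in>\<Omega>. c i \<noteq> 0" "(\<Sum>i\<in>\<Omega>. psc (c i) (v i)) \<in> ipow ?I S" by blast
  define f where "f = (\<Sum>\<gamma>\<in>\<Omega>. psc (c \<gamma>) (mon \<gamma>))"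
  have "(\<Sum>i\<in>\<Omega>. psc (c i) (v i)) = (A ^ N * H ^ S) * f"
    unfolding f_def v_def by (simp add: sum_distrib_left psc_def algebra_simps)
  then have fS: "(A ^ N * H ^ S) * f \<in> ipow Q S" using c(2) ipow_mono[OF IQ, of S] by auto
  have "f \<noteq> 0"
  proof -
    obtain \<gamma> where g: "\<gamma> \<in> \<Omega>" "c \<gamma> \<noteq> 0" using c by auto
    have "lk f \<gamma> = c \<gamma>" unfolding f_def using g \<Omega> by (simp add: lookup_sum psc_mon lookup_single when_def)
    then show ?thesis using g by auto
  qed
  moreover have "deg_le UNIV (?n * \<tau>) f"
    unfolding f_def by (intro deg_le_sum deg_le_psc) (simp add: deg_le_mon dO)
  moreover have "A ^ N * H ^ S \<notin> Q" using A prime_ideal_mult[OF Q] prime_ideal_power[OF Q] by blast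
  ultimately show False using symbolic_power_degree[OF Q, of f "?n * \<tau>" S "A ^ N * H ^ S"] fS by (simp add: S_def)
qed

section \<open>Counting minimal primes of given height\<close>

text \<open>For \<open>k = m * (n + 1)\<close>, Bernoulli's inequality makes the quotient of the two
  powers grow at least like \<open>m ^ (n + 1)\<close>, whereas the polynomial factor grows only
  like \<open>m ^ n\<close>.\<close>

lemma exponential_beats_polynomial:
  fixes a E n :: nat
  assumes a: "a \<ge> 1" and le: "\<And>k. (a + 1) ^ k \<le> a ^ k * (k * E + 1) ^ n"
  shows False
proof -
  define \<epsilon> where "\<epsilon> = 1 / real a"
  define L where "L = real ((n + 1) * E + 1)"
  have \<epsilon>: "\<epsilon> > 0" using a by (simp add: \<epsilon>_def)
  obtain m0 :: nat where m0: "L ^ n / \<epsilon> ^ (n + 1) < real m0" using reals_Archimedean2 by blast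
  define m where "m = m0 + 1"
  have m: "m \<ge> 1" "L ^ n / \<epsilon> ^ (n + 1) < real m" using m0 by (auto simp: m_def)
  let ?k = "m * (n + 1)"
  have "real ((a + 1) ^ ?k) \<le> real (a ^ ?k * (?k * E + 1) ^ n)" using le[of ?k] by (simp only: of_nat_le_iff)
  then have "(real a + 1) ^ ?k \<le> real a ^ ?k * (real ?k * real E + 1) ^ n" by (simp add: add.commute)
  then have "((real a + 1) / real a) ^ ?k \<le> (real ?k * real E + 1) ^ n"
    using a by (simp add: power_divide field_simps)
  moreover have "(real a + 1) / real a = 1 + \<epsilon>" using a by (simp add: \<epsilon>_def field_simps)
  ultimately have 1: "(1 + \<epsilon>) ^ ?k \<le> (real ?k * real E + 1) ^ n" by simp
  have "(real m * \<epsilon>) ^ (n + 1) \<le> (1 + real m * \<epsilon>) ^ (n + 1)" using \<epsilon> by (intro power_mono) auto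
  also have "\<dots> \<le> ((1 + \<epsilon>) ^ m) ^ (n + 1)"
    using Bernoulli_inequality[of \<epsilon> m] \<epsilon> by (intro power_mono) auto
  also have "\<dots> = (1 + \<epsilon>) ^ ?k" by (simp only: power_mult)
  also note 1
  also have "(real ?k * real E + 1) ^ n \<le> (real m * L) ^ n"
  proof (rule power_mono)
    have "real ?k * real E + 1 = real m * (real (n + 1) * real E) + 1" by (simp add: algebra_simps)
    also have "\<dots> \<le> real m * (real (n + 1) * real E) + real m" using m by simp
    also have "\<dots> = real m * L" by (simp add: L_def algebra_simps)
    finally show "real ?k * real E + 1 \<le> real m * L" .
  qed simp
  finally have "real m ^ n * (real m * \<epsilon> ^ (n + 1)) \<le> real m ^ n * L ^ n"
    by (simp add: power_mult_distrib algebra_simps)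
  then have "real m * \<epsilon> ^ (n + 1) \<le> L ^ n" using m by simp
  then have "real m \<le> L ^ n / \<epsilon> ^ (n + 1)" using \<epsilon> by (simp add: pos_le_divide_eq)
  then show False using m by simp
qed

text \<open>Exponents outside \<open>Y\<close> are divided by \<open>D\<close>: the quotients land
  in the weighted simplex, and there are at most \<open>D ^ card (- Y)\<close> vectors of
  remainders.\<close>

lemma weighted_simplex_card:
  fixes Y :: "'n::finite set"
  assumes D: "D \<ge> 1"
  shows "finite {\<gamma> :: 'n \<Rightarrow>\<^sub>0 nat. vdeg Y \<gamma> + D * vdeg (- Y) \<gamma> \<le> T}"
    and "card {\<gamma> :: 'n \<Rightarrow>\<^sub>0 nat. vdeg UNIV \<gamma> \<le> T} \<le>
      D ^ card (- Y) * card {\<gamma> :: 'n \<Rightarrow>\<^sub>0 nat. vdeg Y \<gamma> + D * vdeg (- Y) \<gamma> \<le> T}"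
proof -
  let ?W = "{\<gamma> :: 'n \<Rightarrow>\<^sub>0 nat. vdeg Y \<gamma> + D * vdeg (- Y) \<gamma> \<le> T}"
  let ?S = "{\<gamma> :: 'n \<Rightarrow>\<^sub>0 nat. vdeg UNIV \<gamma> \<le> T}"
  let ?R = "{\<rho> :: 'n \<Rightarrow>\<^sub>0 nat. \<forall>i. lk \<rho> i < (if i \<in> Y then 1 else D)}"
  have "?W \<subseteq> ?S"
  proof
    fix \<gamma> assume "\<gamma> \<in> ?W"
    moreover have "vdeg (- Y) \<gamma> \<le> D * vdeg (- Y) \<gamma>" using D by simp
    ultimately show "\<gamma> \<in> ?S" using vdeg_split[of \<gamma> Y] unfolding mem_Collect_eq by linarith
  qed
  then show finW: "finite ?W" by (rule finite_subset[OF _ finite_vdeg_le])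
  have cR: "card ?R = D ^ card (- Y)" unfolding box_card(2) prod_if_split by simp
  define q where "q = (\<lambda>\<gamma> :: 'n \<Rightarrow>\<^sub>0 nat. Abs_poly_mapping (\<lambda>i. if i \<in> Y then lk \<gamma> i else lk \<gamma> i div D))"
  define r where "r = (\<lambda>\<gamma> :: 'n \<Rightarrow>\<^sub>0 nat. Abs_poly_mapping (\<lambda>i. if i \<in> Y then 0 else lk \<gamma> i mod D))"
  have lq: "lk (q \<gamma>) i = (if i \<in> Y then lk \<gamma> i else lk \<gamma> i div D)" for \<gamma> i by (simp add: q_def)
  have lr: "lk (r \<gamma>) i = (if i \<in> Y then 0 else lk \<gamma> i mod D)" for \<gamma> i by (simp add: r_def)
  have inj: "inj_on (\<lambda>\<gamma>. (r \<gamma>, q \<gamma>)) ?S"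
  proof (rule inj_onI)
    fix \<gamma> \<delta> assume "(r \<gamma>, q \<gamma>) = (r \<delta>, q \<delta>)"
    then have "lk (r \<gamma>) i = lk (r \<delta>) i" "lk (q \<gamma>) i = lk (q \<delta>) i" for i by auto
    then have e: "lk \<gamma> i = lk \<delta> i \<or> lk \<gamma> i mod D = lk \<delta> i mod D \<and> lk \<gamma> i div D = lk \<delta> i div D" for i
      unfolding lq lr by (metis (full_types))
    show "\<gamma> = \<delta>"
    proof (rule poly_mapping_eqI)
      fix i show "lk \<gamma> i = lk \<delta> i" using e[of i] by (metis div_mult_mod_eq)
    qed
  qed
  have sub: "(\<lambda>\<gamma>. (r \<gamma>, q \<gamma>)) ` ?S \<subseteq> ?R \<times> ?W"
  proof
    fix x assume "x \<in> (\<lambda>\<gamma>. (r \<gamma>, q \<gamma>)) ` ?S"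
    then obtain \<gamma> where \<gamma>: "vdeg UNIV \<gamma> \<le> T" "x = (r \<gamma>, q \<gamma>)" by auto
    have "r \<gamma> \<in> ?R" using D by (auto simp: lr)
    moreover have "vdeg Y (q \<gamma>) = vdeg Y \<gamma>" by (simp add: vdeg_def lq)
    moreover have "D * vdeg (- Y) (q \<gamma>) \<le> vdeg (- Y) \<gamma>"
      unfolding vdeg_def sum_distrib_left by (intro sum_mono) (auto simp: lq)
    ultimately show "x \<in> ?R \<times> ?W" using \<gamma> vdeg_split[of \<gamma> Y] by auto
  qed
  have "finite (?R \<times> ?W)" by (intro finite_cartesian_product box_card(1) finW)
  from card_inj_on_le[OF inj sub this]
  show "card ?S \<le> D ^ card (- Y) * card ?W" unfolding card_cartesian_product cR .
qed

text \<open>In a relation, take the least order \<open>s\<close> with a nonzero coefficient and a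
  prime \<open>Q\<close> at which it occurs. Modulo \<open>Nset\<close> at \<open>Q\<close>, the
  terms of other primes vanish because their factor \<open>b\<close> lies in \<open>Q\<close>, and
  terms of \<open>Q\<close> of higher order vanish as well. What remains concerns \<open>Q\<close>
  alone.\<close>

lemma product_system_independent:
  fixes g :: "'b \<Rightarrow> ('n::finite, 'k::field) mpoly" and \<Q> :: "('n, 'k) mpoly set set"
  assumes fin: "finite J" and prime: "\<And>Q. Q \<in> \<Q> \<Longrightarrow> is_prime_ideal Q"
    and nil: "\<And>Q. Q \<in> \<Q> \<Longrightarrow> \<forall>q\<in>Q. \<exists>h e. h \<notin> Q \<and> h * q ^ e \<in> ideal_gen (g ` J)"
    and Y: "\<And>Q. Q \<in> \<Q> \<Longrightarrow> indep_mod Q (Y Q)"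
    and A: "\<And>Q. Q \<in> \<Q> \<Longrightarrow> A Q \<subseteq> J" "\<And>Q. Q \<in> \<Q> \<Longrightarrow> analytic_indep Q J g (A Q)"
    and b: "\<And>Q Q'. Q \<in> \<Q> \<Longrightarrow> Q' \<in> \<Q> \<Longrightarrow> b Q \<in> Q' \<longleftrightarrow> Q \<noteq> Q'"
    and \<Omega>: "finite \<Omega>" "\<And>w. w \<in> \<Omega> \<Longrightarrow> q w \<in> \<Q> \<and> \<alpha> w \<in> exps (A (q w)) \<and> vdeg (- Y (q w)) (\<beta> w) = 0"
    and inj: "inj_on (\<lambda>w. (q w, \<alpha> w, \<beta> w)) \<Omega>"
    and zero: "(\<Sum>w\<in>\<Omega>. psc (c w) (b (q w) * (mon (\<beta> w) * gp J g (\<alpha> w)))) = 0"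
  shows "\<forall>w\<in>\<Omega>. c w = 0"
proof (rule ccontr)
  assume "\<not> ?thesis"
  then have ne: "{w\<in>\<Omega>. c w \<noteq> 0} \<noteq> {}" by auto
  let ?I = "ideal_gen (g ` J)" and ?G = "gp J g" and ?l = "\<lambda>w. lev J (\<alpha> w)"
  define s where "s = Min (?l ` {w\<in>\<Omega>. c w \<noteq> 0})"
  have "s \<in> ?l ` {w\<in>\<Omega>. c w \<noteq> 0}" unfolding s_def using ne \<Omega>(1) by (intro Min_in) auto
  then obtain w0 where w0: "w0 \<in> \<Omega>" "c w0 \<noteq> 0" "?l w0 = s" by auto
  have smin: "s \<le> ?l w" if "w \<in> \<Omega>" "c w \<noteq> 0" for w
    unfolding s_def using that \<Omega>(1) by (intro Min_le) auto
  define Q where "Q = q w0"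
  have Q\<Q>: "Q \<in> \<Q>" using \<Omega>(2)[OF w0(1)] by (simp add: Q_def)
  note Q = prime[OF Q\<Q>]
  note NI = is_ideal_Nset[OF Q, of ?I s]
  define t where "t = (\<lambda>w. psc (c w) (b (q w) * (mon (\<beta> w) * ?G (\<alpha> w))))"
  define \<Omega>0 where "\<Omega>0 = {w\<in>\<Omega>. q w = Q \<and> ?l w = s}"
  have f0: "finite \<Omega>0" "\<Omega>0 \<subseteq> \<Omega>" using \<Omega>(1) by (auto simp: \<Omega>0_def)
  have other: "t w \<in> Nset Q ?I s" if w: "w \<in> \<Omega> - \<Omega>0" for w
  proof (cases "c w = 0")
    case True
    then show ?thesis using ideal_zero[OF NI] by (simp add: t_def)
  next
    case False
    have ls: "s \<le> ?l w" using smin w False by simp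
    have gl: "?G (\<alpha> w) \<in> ipow ?I (?l w)" by (rule gp_mem_ipow[OF fin])
    show ?thesis
    proof (cases "q w = Q")
      case True
      then have "Suc s \<le> ?l w" using ls w by (auto simp: \<Omega>0_def)
      then have "?G (\<alpha> w) \<in> ipow ?I (Suc s)" using gl ipow_antimono by blast
      then have "?G (\<alpha> w) \<in> Nset Q ?I s" using ipow_Suc_Nset[OF Q] by blast
      then have "(cst (c w) * b (q w) * mon (\<beta> w)) * ?G (\<alpha> w) \<in> Nset Q ?I s" by (rule ideal_mult_left[OF NI])
      then show ?thesis by (simp add: t_def psc_def mult.assoc)
    next
      case False
      have "q w \<in> \<Q>" using \<Omega>(2) w by blast
      then have "b (q w) \<in> Q" using b[OF _ Q\<Q>] False by blast
      then obtain h e where "h \<notin> Q" "h * b (q w) ^ e \<in> ?I" using nil[OF Q\<Q>] by blast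
      moreover have "?G (\<alpha> w) \<in> ipow ?I s" using gl ipow_antimono[OF ls] by blast
      ultimately have "b (q w) * ?G (\<alpha> w) \<in> Nset Q ?I s" by (rule Nset_mult_nil)
      then have "(cst (c w) * mon (\<beta> w)) * (b (q w) * ?G (\<alpha> w)) \<in> Nset Q ?I s" by (rule ideal_mult_left[OF NI])
      then show ?thesis by (simp add: t_def psc_def algebra_simps)
    qed
  qed
  have "(\<Sum>w\<in>\<Omega> - \<Omega>0. t w) \<in> Nset Q ?I s" by (rule ideal_sum[OF NI other])
  moreover have "(\<Sum>w\<in>\<Omega> - \<Omega>0. t w) + (\<Sum>w\<in>\<Omega>0. t w) = 0"
    using zero sum.subset_diff[OF f0(2) \<Omega>(1), of t] by (simp add: t_def)
  then have "(\<Sum>w\<in>\<Omega>0. t w) = - (\<Sum>w\<in>\<Omega> - \<Omega>0. t w)" by (simp add: eq_neg_iff_add_eq_0 add.commute)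
  ultimately have N0: "(\<Sum>w\<in>\<Omega>0. t w) \<in> Nset Q ?I s" using ideal_uminus[OF NI] by simp
  define F where "F = (\<Sum>w\<in>\<Omega>0. psc (c w) (mon (\<beta> w)) * ?G (\<alpha> w))"
  have "(\<Sum>w\<in>\<Omega>0. t w) = b Q * F"
    unfolding F_def sum_distrib_left by (intro sum.cong) (auto simp: t_def \<Omega>0_def psc_def algebra_simps)
  moreover have "F \<in> ipow ?I s"
    unfolding F_def using gp_mem_ipow[OF fin, of g]
    by (intro ideal_sum[OF is_ideal_ipow] ideal_mult_left[OF is_ideal_ipow]) (auto simp: \<Omega>0_def)
  moreover have "b Q \<notin> Q" using b[OF Q\<Q> Q\<Q>] by simp
  ultimately have FN: "F \<in> Nset Q ?I s" using N0 Nset_cancel[OF Q] by metis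
  define V where "V = \<alpha> ` \<Omega>0"
  \<comment> \<open>Grouping by the exponent of the generators leaves coefficients in k[Y]. Analytic
    independence puts them into \<open>Q\<close>, and independence of the variables then makes them
    zero.\<close>
  define C where "C = (\<lambda>a. \<Sum>w\<in>{w\<in>\<Omega>0. \<alpha> w = a}. psc (c w) (mon (\<beta> w)))"
  have "(\<Sum>a\<in>V. C a * ?G a) = (\<Sum>a\<in>V. \<Sum>w\<in>{w\<in>\<Omega>0. \<alpha> w = a}. psc (c w) (mon (\<beta> w)) * ?G (\<alpha> w))"
    unfolding C_def sum_distrib_right by (intro sum.cong) auto
  also have "\<dots> = F" unfolding F_def V_def by (rule sum.group[OF f0(1)]) (use f0 in auto)
  finally have "(\<Sum>a\<in>V. C a * ?G a) \<in> Nset Q ?I s" using FN by simp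
  moreover have "finite V" "V \<subseteq> exps (A Q)" "\<forall>a\<in>V. lev J a = s"
    using f0 \<Omega>(2) by (auto simp: V_def \<Omega>0_def)
  ultimately have CQ: "\<forall>a\<in>V. C a \<in> Q" using A(2)[OF Q\<Q>] unfolding analytic_indep_def by blast
  have w00: "w0 \<in> \<Omega>0" using w0 by (auto simp: \<Omega>0_def Q_def)
  let ?a = "\<alpha> w0"
  have "C ?a \<in> Q" using CQ w00 by (auto simp: V_def)
  moreover have "deg_le (- Y Q) 0 (C ?a)"
    unfolding C_def using \<Omega>(2) by (intro deg_le_sum deg_le_psc) (auto simp: deg_le_mon \<Omega>0_def)
  ultimately have "C ?a = 0" using Y[OF Q\<Q>] by (auto simp: indep_mod_def)
  moreover have "lk (C ?a) (\<beta> w0) = c w0"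
  proof -
    have "lk (C ?a) (\<beta> w0) = (\<Sum>w\<in>{w\<in>\<Omega>0. \<alpha> w = ?a}. if w = w0 then c w else 0)"
      unfolding C_def lookup_sum
    proof (rule sum.cong)
      fix w assume "w \<in> {w\<in>\<Omega>0. \<alpha> w = ?a}"
      then have "\<beta> w = \<beta> w0 \<longleftrightarrow> w = w0"
        using inj w0(1) by (auto simp: \<Omega>0_def Q_def inj_on_def)
      then show "lk (psc (c w) (mon (\<beta> w))) (\<beta> w0) = (if w = w0 then c w else 0)"
        by (simp add: psc_mon lookup_single when_def)
    qed simp
    then show ?thesis using w00 f0 by simp
  qed
  ultimately show False using w0 by simp
qed

text \<open>A Bezout bound. Each prime contributes its own system of products, in which the
  \<open>j\<close> variables outside \<open>Y Q\<close> are replaced by \<open>j\<close> generators;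
  since a generator has degree at most \<open>D\<close>, this costs a factor \<open>D ^ j\<close> in
  number.\<close>

theorem minimal_primes_count:
  fixes g :: "'b \<Rightarrow> ('n::finite, 'k::field_char_0) mpoly" and \<Q> :: "('n, 'k) mpoly set set"
  assumes fin: "finite J" "finite \<Q>" and D: "D \<ge> 1" and j: "j \<ge> 1"
    and deg: "\<And>i. i \<in> J \<Longrightarrow> deg_le UNIV D (g i)"
    and prime: "\<And>Q. Q \<in> \<Q> \<Longrightarrow> is_prime_ideal Q"
    and dim: "\<And>Q. Q \<in> \<Q> \<Longrightarrow> vdim Q + j = CARD('n)"
    and sub: "\<And>Q. Q \<in> \<Q> \<Longrightarrow> g ` J \<subseteq> Q"
    and min: "\<And>Q P. Q \<in> \<Q> \<Longrightarrow> is_prime_ideal P \<Longrightarrow> g ` J \<subseteq> P \<Longrightarrow> P \<subseteq> Q \<Longrightarrow> P = Q"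
  shows "card \<Q> \<le> D ^ j"
proof -
  let ?I = "ideal_gen (g ` J)"
  have nil: "\<forall>q\<in>Q. \<exists>h e. h \<notin> Q \<and> h * q ^ e \<in> ?I" if "Q \<in> \<Q>" for Q
  proof
    fix q assume q: "q \<in> Q"
    show "\<exists>h e. h \<notin> Q \<and> h * q ^ e \<in> ?I"
    proof (rule nilpotent_of_minimal_prime[OF prime[OF that] is_ideal_ideal_gen _ q])
      fix P assume P: "is_prime_ideal P" "?I \<subseteq> P" "P \<subseteq> Q"
      then have "g ` J \<subseteq> P" using ideal_gen_superset[of "g ` J"] by blast
      then show "P = Q" using min[OF that] P by blast
    qed
  qed
  have "\<forall>Q\<in>\<Q>. \<exists>Y. maxindep_mod Q Y \<and> card (- Y) = j"
  proof
    fix Q assume Q: "Q \<in> \<Q>"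
    obtain Y where Y: "maxindep_mod Q Y" "card Y = vdim Q" using vdim_attained[OF prime[OF Q]] by blast
    then have "card (- Y) = j" using dim[OF Q] by (simp add: Compl_eq_Diff_UNIV card_Diff_subset)
    then show "\<exists>Y. maxindep_mod Q Y \<and> card (- Y) = j" using Y by blast
  qed
  from bchoice[OF this] obtain Y where Y: "\<And>Q. Q \<in> \<Q> \<Longrightarrow> maxindep_mod Q (Y Q)" "\<And>Q. Q \<in> \<Q> \<Longrightarrow> card (- Y Q) = j"
    by blast
  have "\<forall>Q\<in>\<Q>. \<exists>A. A \<subseteq> J \<and> card A = j \<and> analytic_indep Q J g A"
  proof
    fix Q assume Q: "Q \<in> \<Q>"
    have "Y Q \<noteq> UNIV" using Y(2)[OF Q] j by auto
    from exists_analytic_indep[OF prime[OF Q] Y(1)[OF Q] this fin(1) sub[OF Q] nil[OF Q]]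
    show "\<exists>A. A \<subseteq> J \<and> card A = j \<and> analytic_indep Q J g A" unfolding Y(2)[OF Q] .
  qed
  from bchoice[OF this] obtain A where A: "\<And>Q. Q \<in> \<Q> \<Longrightarrow> A Q \<subseteq> J" "\<And>Q. Q \<in> \<Q> \<Longrightarrow> card (A Q) = j"
     "\<And>Q. Q \<in> \<Q> \<Longrightarrow> analytic_indep Q J g (A Q)" by blast
  have "\<forall>Q\<in>\<Q>. \<exists>\<phi>. bij_betw \<phi> (A Q) (- Y Q)"
    by (intro ballI finite_same_card_bij finite_subset[OF A(1) fin(1)]) (simp_all add: A(2) Y(2))
  from bchoice[OF this] obtain \<phi> where \<phi>: "\<And>Q. Q \<in> \<Q> \<Longrightarrow> bij_betw (\<phi> Q) (A Q) (- Y Q)" by blast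
  \<comment> \<open>Primes of equal dimension are incomparable, so each other prime offers an
    element outside \<open>Q\<close>; their product separates \<open>Q\<close> from the
    rest.\<close>
  have "\<forall>Q\<in>\<Q>. \<exists>b. \<forall>Q'\<in>\<Q>. b \<in> Q' \<longleftrightarrow> Q \<noteq> Q'"
  proof
    fix Q assume Q: "Q \<in> \<Q>"
    have "\<forall>Q'\<in>\<Q> - {Q}. \<exists>r. r \<in> Q' \<and> r \<notin> Q"
    proof
      fix Q' assume Q': "Q' \<in> \<Q> - {Q}"
      have "\<not> Q' \<subseteq> Q"
        using vdim_strict_mono[of Q' Q] prime[OF Q] prime[of Q'] dim[OF Q] dim[of Q'] Q' by auto
      then show "\<exists>r. r \<in> Q' \<and> r \<notin> Q" by blast
    qed
    from bchoice[OF this] obtain r where r: "\<And>Q'. Q' \<in> \<Q> - {Q} \<Longrightarrow> r Q' \<in> Q' \<and> r Q' \<notin> Q" by blast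
    show "\<exists>b. \<forall>Q'\<in>\<Q>. b \<in> Q' \<longleftrightarrow> Q \<noteq> Q'"
      by (rule exI[of _ "prod r (\<Q> - {Q})"])
         (use r Q fin(2) in \<open>auto simp: prime_ideal_prod[OF prime]\<close>)
  qed
  from bchoice[OF this] obtain b where b: "\<And>Q Q'. Q \<in> \<Q> \<Longrightarrow> Q' \<in> \<Q> \<Longrightarrow> b Q \<in> Q' \<longleftrightarrow> Q \<noteq> Q'" by blast
  obtain E where E: "\<And>Q. Q \<in> \<Q> \<Longrightarrow> deg_le UNIV E (b Q)" using finite_deg_bound[of "b ` \<Q>"] fin(2) by blast
  define W where "W = (\<lambda>T Q. {\<gamma> :: 'n \<Rightarrow>\<^sub>0 nat. vdeg (Y Q) \<gamma> + D * vdeg (- Y Q) \<gamma> \<le> T})"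
  define s where "s = (\<lambda>T. card {\<gamma> :: 'n \<Rightarrow>\<^sub>0 nat. vdeg UNIV \<gamma> \<le> T})"
  \<comment> \<open>All products together are independent and of degree at most
    \<open>T + E\<close>, where \<open>E\<close> is the cost of the separating factor.\<close>
  have step: "card \<Q> * s T \<le> D ^ j * s (T + E)" for T
  proof -
    define \<Omega> where "\<Omega> = Sigma \<Q> (W T)"
    have fW: "finite (W T Q)" for Q unfolding W_def by (rule weighted_simplex_card(1)[OF D])
    have f\<Omega>: "finite \<Omega>" unfolding \<Omega>_def using fin(2) fW by (intro finite_SigmaI) auto
    define \<alpha> where "\<alpha> = (\<lambda>(Q, \<gamma>). \<lambda>i. if i \<in> A Q then lk \<gamma> (\<phi> Q i) else 0 :: nat)"
    define \<beta> where "\<beta> = (\<lambda>(Q, \<gamma>). Abs_poly_mapping (\<lambda>i. if i \<in> Y Q then lk \<gamma> i else 0 :: nat))"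
    have l\<beta>: "lk (\<beta> (Q, \<gamma>)) i = (if i \<in> Y Q then lk \<gamma> i else 0)" for Q \<gamma> i by (simp add: \<beta>_def)
    have l\<alpha>: "lev J (\<alpha> (Q, \<gamma>)) = vdeg (- Y Q) \<gamma>" if "Q \<in> \<Q>" for Q \<gamma>
    proof -
      have "lev J (\<alpha> (Q, \<gamma>)) = (\<Sum>i\<in>J. if i \<in> A Q then lk \<gamma> (\<phi> Q i) else 0)"
        unfolding wt_def \<alpha>_def by (intro sum.cong) auto
      also have "\<dots> = (\<Sum>i\<in>A Q. lk \<gamma> (\<phi> Q i))"
        using A(1)[OF that] fin(1) by (simp add: sum.inter_restrict[symmetric] Int_absorb1)
      also have "\<dots> = vdeg (- Y Q) \<gamma>" unfolding vdeg_def by (rule sum.reindex_bij_betw[OF \<phi>[OF that]])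
      finally show ?thesis .
    qed
    define t where "t = (\<lambda>w. b (fst w) * (mon (\<beta> w) * gp J g (\<alpha> w)))"
    let ?Z = "mon ` {\<gamma> :: 'n \<Rightarrow>\<^sub>0 nat. vdeg UNIV \<gamma> \<le> T + E} :: ('n, 'k) mpoly set"
    have fZ: "finite ?Z" and cZ: "card ?Z \<le> s (T + E)"
      unfolding s_def by (intro finite_imageI finite_vdeg_le, intro card_image_le finite_vdeg_le)
    have "card \<Omega> \<le> card ?Z"
    proof (rule ccontr)
      assume "\<not> card \<Omega> \<le> card ?Z"
      then have "card ?Z < card \<Omega>" by simp
      then have "\<exists>c. (\<exists>w\<in>\<Omega>. c w \<noteq> 0) \<and> (\<Sum>w\<in>\<Omega>. psc (c w) (t w)) \<in> {0}"
      proof (rule linear_dependence_mod_subspace[OF fZ f\<Omega>])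
        show "mp.subspace {0 :: ('n, 'k) mpoly}" by simp
        fix w assume "w \<in> \<Omega>"
        then obtain Q \<gamma> where w: "w = (Q, \<gamma>)" "Q \<in> \<Q>" "\<gamma> \<in> W T Q" by (auto simp: \<Omega>_def)
        have "deg_le UNIV (\<Sum>i\<in>J. \<alpha> w i * D) (gp J g (\<alpha> w))"
          unfolding gp_def by (intro deg_le_prod deg_le_power deg)
        moreover have "(\<Sum>i\<in>J. \<alpha> w i * D) = D * vdeg (- Y Q) \<gamma>"
          using l\<alpha>[OF w(2), of \<gamma>] by (simp add: w(1) wt_def sum_distrib_left[symmetric] mult.commute)
        moreover have "vdeg UNIV (\<beta> w) = vdeg (Y Q) \<gamma>"
          unfolding vdeg_def w(1) l\<beta> by (simp add: sum.inter_restrict[symmetric])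
        then have "deg_le UNIV (vdeg (Y Q) \<gamma>) (mon (\<beta> w) :: ('n, 'k) mpoly)" by (simp add: deg_le_mon)
        ultimately have "deg_le UNIV (E + (vdeg (Y Q) \<gamma> + D * vdeg (- Y Q) \<gamma>)) (t w)"
          unfolding t_def using E[OF w(2)] w(1) by (intro deg_le_mult) auto
        then have "deg_le UNIV (T + E) (t w)" using w(3) by (auto simp: W_def elim: deg_le_weaken)
        from mem_span_mon[OF this] show "\<exists>z\<in>mp.span ?Z. t w - z \<in> {0}" by auto
      qed
      then obtain c where c: "\<exists>w\<in>\<Omega>. c w \<noteq> 0" "(\<Sum>w\<in>\<Omega>. psc (c w) (t w)) = 0" by blast
      have "\<forall>w\<in>\<Omega>. c w = 0"
      proof (rule product_system_independent[where J = J and g = g and \<Q> = \<Q> and Y = Y and A = A and b = b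
            and q = fst and \<alpha> = \<alpha> and \<beta> = \<beta>])
        show "finite J" "finite \<Omega>" by (fact fin f\<Omega>)+
        show "(\<Sum>w\<in>\<Omega>. psc (c w) (b (fst w) * (mon (\<beta> w) * gp J g (\<alpha> w)))) = 0" using c(2) by (simp add: t_def)
        show "inj_on (\<lambda>w. (fst w, \<alpha> w, \<beta> w)) \<Omega>"
        proof (rule inj_onI)
          fix w w' assume eq: "w \<in> \<Omega>" "w' \<in> \<Omega>" "(fst w, \<alpha> w, \<beta> w) = (fst w', \<alpha> w', \<beta> w')"
          then obtain Q \<gamma> \<delta> where w: "w = (Q, \<gamma>)" "w' = (Q, \<delta>)" "Q \<in> \<Q>" by (auto simp: \<Omega>_def)
          have "lk \<gamma> i = lk \<delta> i" for i
          proof (cases "i \<in> Y Q")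
            case True
            have "lk (\<beta> (Q, \<gamma>)) i = lk (\<beta> (Q, \<delta>)) i" using eq(3) w by simp
            then show ?thesis using True by (simp add: l\<beta>)
          next
            case False
            then have "i \<in> \<phi> Q ` A Q" using \<phi>[OF w(3)] by (simp add: bij_betw_def)
            then obtain a where a: "a \<in> A Q" "\<phi> Q a = i" by blast
            have "\<alpha> (Q, \<gamma>) a = \<alpha> (Q, \<delta>) a" using eq(3) w by simp
            then show ?thesis using a by (simp add: \<alpha>_def)
          qed
          then show "w = w'" using w by (simp add: poly_mapping_eqI)
        qed
        fix w assume "w \<in> \<Omega>"
        then obtain Q \<gamma> where w: "w = (Q, \<gamma>)" "Q \<in> \<Q>" by (auto simp: \<Omega>_def)
        have "vdeg (- Y Q) (\<beta> (Q, \<gamma>)) = 0" by (simp add: vdeg_def l\<beta>)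
        then show "fst w \<in> \<Q> \<and> \<alpha> w \<in> exps (A (fst w)) \<and> vdeg (- Y (fst w)) (\<beta> w) = 0"
          using w by (auto simp: exps_def \<alpha>_def)
      next
        fix Q assume Q: "Q \<in> \<Q>"
        show "is_prime_ideal Q" "\<forall>q\<in>Q. \<exists>h e. h \<notin> Q \<and> h * q ^ e \<in> ideal_gen (g ` J)" "A Q \<subseteq> J" "analytic_indep Q J g (A Q)"
          by (fact prime[OF Q] nil[OF Q] A(1)[OF Q] A(3)[OF Q])+
        show "indep_mod Q (Y Q)" using Y(1)[OF Q] by (simp add: maxindep_mod_def)
        fix Q' assume "Q' \<in> \<Q>"
        with Q show "b Q \<in> Q' \<longleftrightarrow> Q \<noteq> Q'" by (rule b)
      qed
      then show False using c by blast
    qed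
    then have "card \<Omega> \<le> s (T + E)" using cZ by simp
    moreover have "card \<Omega> = (\<Sum>Q\<in>\<Q>. card (W T Q))" unfolding \<Omega>_def using fin(2) fW by (intro card_SigmaI) auto
    moreover have "s T \<le> D ^ j * card (W T Q)" if "Q \<in> \<Q>" for Q
      using weighted_simplex_card(2)[OF D, of T "Y Q"] Y(2)[OF that] by (simp add: s_def W_def)
    then have "card \<Q> * s T \<le> (\<Sum>Q\<in>\<Q>. D ^ j * card (W T Q))"
      using sum_bounded_below[of \<Q> "s T" "\<lambda>Q. D ^ j * card (W T Q)"] by simp
    ultimately show ?thesis
      unfolding sum_distrib_left[symmetric] by (metis le_trans mult_le_mono2)
  qed
  show ?thesis
  proof (rule ccontr)
    assume "\<not> card \<Q> \<le> D ^ j"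
    then have M: "D ^ j + 1 \<le> card \<Q>" by simp
    \<comment> \<open>Iterating from \<open>T = 0\<close> in steps of \<open>E\<close>: one prime
      too many would give exponential growth against the polynomial bound on
      \<open>s\<close>.\<close>
    have "(D ^ j + 1) ^ k \<le> (D ^ j) ^ k * s (k * E)" for k
    proof (induction k)
      case 0
      have "card {0 :: 'n \<Rightarrow>\<^sub>0 nat} \<le> s 0" unfolding s_def by (intro card_mono finite_vdeg_le) auto
      then show ?case by simp
    next
      case (Suc k)
      have "(D ^ j + 1) ^ Suc k \<le> (D ^ j + 1) * ((D ^ j) ^ k * s (k * E))"
        unfolding power_Suc by (rule mult_left_mono[OF Suc]) simp
      also have "\<dots> \<le> (D ^ j) ^ k * (card \<Q> * s (k * E))"
        using mult_right_mono[OF M, of "(D ^ j) ^ k * s (k * E)"] by (simp add: algebra_simps)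
      also have "\<dots> \<le> (D ^ j) ^ k * (D ^ j * s (k * E + E))" by (rule mult_left_mono[OF step]) simp
      finally show ?case by (simp add: algebra_simps)
    qed
    moreover have "s (k * E) \<le> (k * E + 1) ^ CARD('n)" for k unfolding s_def by (rule card_vdeg_le)
    ultimately have "(D ^ j + 1) ^ k \<le> (D ^ j) ^ k * (k * E + 1) ^ CARD('n)" for k
      by (meson le_trans mult_le_mono2)
    then show False using exponential_beats_polynomial[of "D ^ j" E "CARD('n)"] D by simp
  qed
qed

section \<open>Evaluation and the torus action\<close>

lemma mono_val_add: "mono_val z (\<alpha> + \<beta>) = mono_val z \<alpha> * mono_val z \<beta>"
  by (simp add: mono_val_def lookup_add power_add prod.distrib)

lemma mono_val_mult: "mono_val (\<lambda>i. z i * w i) \<alpha> = mono_val z \<alpha> * mono_val w \<alpha>"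
  by (simp add: mono_val_def power_mult_distrib prod.distrib)

lemma mono_val_1 [simp]: "mono_val (\<lambda>_. 1) \<alpha> = 1"
  by (simp add: mono_val_def)

lemma mono_val_zero [simp]: "mono_val z 0 = 1"
  by (simp add: mono_val_def)

lemma mono_val_nonzero: "(\<And>i. z i \<noteq> (0::'k::field)) \<Longrightarrow> mono_val z \<alpha> \<noteq> 0"
  by (simp add: mono_val_def)

lemma meval_superset:
  assumes "finite F" "ks g \<subseteq> F"
  shows "meval g z = (\<Sum>\<alpha>\<in>F. lk g \<alpha> * mono_val z \<alpha>)"
  unfolding meval_def using assms by (intro sum.mono_neutral_left) (auto simp: in_keys_iff)

lemma meval_add: "meval (p + q) z = meval p z + meval q z"
proof -
  let ?F = "ks p \<union> ks q"
  have "finite ?F" "ks (p + q) \<subseteq> ?F" "ks p \<subseteq> ?F" "ks q \<subseteq> ?F" using keys_add[of p q] by auto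
  then show ?thesis
    by (simp add: meval_superset[of ?F] sum.distrib[symmetric] lookup_add distrib_right)
qed

lemma meval_single: "meval (sgl \<gamma> c) z = c * mono_val z \<gamma>"
  by (auto simp: meval_def)

lemma meval_zero [simp]: "meval 0 z = 0"
  by (simp add: meval_def)

lemma meval_mult: "meval (p * q) z = meval p z * meval q z"
  for p q :: "('n::finite, 'k::comm_ring_1) mpoly"
proof (induction p arbitrary: q rule: mpoly_induct)
  case (add p p')
  then show ?case by (simp add: distrib_right meval_add)
next
  case (single \<gamma> c)
  show ?case
  proof (induction q rule: mpoly_induct)
    case (add p p')
    then show ?case by (simp add: distrib_left meval_add)
  next
    case (single \<delta> d)
    then show ?case by (simp add: mult_single meval_single mono_val_add algebra_simps)
  qed
qed

lemma lookup_act: "lk (act z g) \<alpha> = lk g \<alpha> * mono_val z \<alpha>"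
  by (simp add: act_def lookup_mapp when_def in_keys_iff)

lemma keys_act: "(\<And>i. z i \<noteq> (0::'k::field)) \<Longrightarrow> ks (act z g) = ks g"
  by (auto simp: in_keys_iff lookup_act mono_val_nonzero)

lemma act_add: "act z (p + q) = act z p + act z q"
  by (rule poly_mapping_eqI) (simp add: lookup_act lookup_add distrib_right)

lemma act_zero [simp]: "act z 0 = 0"
  by (rule poly_mapping_eqI) (simp add: lookup_act)

lemma act_single: "act z (sgl \<gamma> c) = sgl \<gamma> (c * mono_val z \<gamma>)"
  by (rule poly_mapping_eqI) (simp add: lookup_act lookup_single when_def)

lemma act_mult: "act z (p * q) = act z p * act z q"
  for p q :: "('n::finite, 'k::comm_ring_1) mpoly"
proof (induction p arbitrary: q rule: mpoly_induct)
  case (add p p')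
  then show ?case by (simp add: distrib_right act_add)
next
  case (single \<gamma> c)
  show ?case
  proof (induction q rule: mpoly_induct)
    case (add p p')
    then show ?case by (simp add: distrib_left act_add)
  next
    case (single \<delta> d)
    then show ?case by (simp add: mult_single act_single mono_val_add algebra_simps)
  qed
qed

lemma act_act: "act z (act w g) = act (\<lambda>i. z i * w i) g"
  by (rule poly_mapping_eqI) (simp add: lookup_act mono_val_mult algebra_simps)

lemma act_1 [simp]: "act (\<lambda>_. 1) g = g"
  by (rule poly_mapping_eqI) (simp add: lookup_act)

lemma meval_act: "meval (act z g) w = meval g (\<lambda>i. z i * w i)"
proof -
  have "ks (act z g) \<subseteq> ks g" by (auto simp: in_keys_iff lookup_act)
  then have "meval (act z g) w = (\<Sum>\<alpha>\<in>ks g. lk (act z g) \<alpha> * mono_val w \<alpha>)" by (intro meval_superset) auto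
  then show ?thesis by (simp add: lookup_act meval_def mono_val_mult mult.assoc)
qed

lemma prime_act_image:
  fixes P :: "('n::finite, 'k::field) mpoly set"
  assumes P: "is_prime_ideal P" and z: "\<And>i. z i \<noteq> 0"
  shows "is_prime_ideal (act z ` P)"
proof -
  let ?w = "\<lambda>i. inverse (z i)"
  have inv: "act z (act ?w p) = p" "act ?w (act z p) = p" for p
    using z by (simp_all add: act_act)
  have mem: "p \<in> act z ` P \<longleftrightarrow> act ?w p \<in> P" for p
    using inv by (metis image_iff)
  note PI = prime_is_ideal[OF P]
  show ?thesis
    unfolding is_prime_ideal_def is_ideal_def
  proof (intro conjI ballI allI impI)
    show "act z ` P \<noteq> UNIV"
    proof
      assume "act z ` P = UNIV"
      then have "act z p \<in> act z ` P" for p by simp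
      then have "p \<in> P" for p using mem inv by simp
      then show False using P by (auto simp: is_prime_ideal_def)
    qed
  qed (auto simp: mem act_add act_mult ideal_zero[OF PI] ideal_add[OF PI] ideal_mult_left[OF PI]
      prime_ideal_mult[OF P] simp del: image_iff)
qed

text \<open>The torus rescales coefficients by nonzero factors, so a polynomial keeps its monomials
  and with them the variables it involves.\<close>

lemma vdim_act_image:
  fixes P :: "('n::finite, 'k::field) mpoly set"
  assumes z: "\<And>i. z i \<noteq> 0"
  shows "vdim (act z ` P) = vdim P"
proof -
  have "act z p = 0 \<longleftrightarrow> p = 0" for p using keys_act[of z p] z by (metis keys_eq_empty act_zero)
  moreover have "deg_le V d (act z p) \<longleftrightarrow> deg_le V d p" for V d p using keys_act[of z p] z by (simp add: deg_le_def)
  ultimately have "indep_mod (act z ` P) Y = indep_mod P Y" for Y by (auto simp: indep_mod_def)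
  then show ?thesis by (simp add: vdim_def)
qed

definition vanishing :: "('n::finite \<Rightarrow> 'k::comm_ring_1) \<Rightarrow> ('n, 'k) mpoly set" where
  "vanishing z = {p. meval p z = 0}"

lemma prime_vanishing: "is_prime_ideal (vanishing (z :: 'n::finite \<Rightarrow> 'k::field))"
proof -
  have "meval 1 z = 1" using meval_single[of 0 1 z] by simp
  then have "1 \<notin> vanishing z" by (simp add: vanishing_def)
  then have "vanishing z \<noteq> UNIV" by blast
  then show ?thesis
    by (auto simp: is_prime_ideal_def is_ideal_def vanishing_def meval_add meval_mult)
qed

text \<open>Modulo the ideal every variable is congruent to 1, hence every polynomial to its value
  at the point 1.\<close>

lemma vanishing_one_subset:
  "vanishing (\<lambda>_. 1) \<subseteq> (max_ideal_one :: ('n::finite, 'k::field) mpoly set)"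
proof
  let ?M = "max_ideal_one :: ('n, 'k) mpoly set"
  have MI: "is_ideal ?M" unfolding max_ideal_one_def by (rule is_ideal_ideal_gen)
  have var: "mvar i - 1 \<in> ?M" for i
    unfolding max_ideal_one_def by (rule ideal_gen_superset[THEN subsetD]) simp
  have mult: "a * b - 1 \<in> ?M" if "a - 1 \<in> ?M" "b - 1 \<in> ?M" for a b
  proof -
    have "a * b - 1 = b * (a - 1) + (b - 1)" by (simp add: algebra_simps)
    also have "\<dots> \<in> ?M" using that by (intro ideal_add[OF MI] ideal_mult_left[OF MI])
    finally show ?thesis .
  qed
  have pow: "a ^ k - 1 \<in> ?M" if "a - 1 \<in> ?M" for a k
    by (induction k) (auto simp: ideal_zero[OF MI] intro: mult that)
  have prod: "prod a F - 1 \<in> ?M" if "\<And>i. i \<in> F \<Longrightarrow> a i - 1 \<in> ?M" for a :: "'n \<Rightarrow> _" and F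
    using that by (induction F rule: infinite_finite_induct) (auto simp: ideal_zero[OF MI] intro: mult)
  have mvp: "mvar i ^ k = (mon (sgl i k) :: ('n, 'k) mpoly)" for i k
  proof (induction k)
    case (Suc k)
    then show ?case by (simp add: mvar_def mon_def mult_single single_add[symmetric])
  qed simp
  have monM: "mon \<gamma> - 1 \<in> ?M" for \<gamma>
  proof -
    have "mon (\<Sum>i\<in>F. sgl i (lk \<gamma> i)) = (\<Prod>i\<in>F. mvar i ^ lk \<gamma> i :: ('n, 'k) mpoly)" for F
      by (induction F rule: infinite_finite_induct) (auto simp: mon_add mvp)
    moreover have "(\<Sum>i\<in>UNIV. sgl i (lk \<gamma> i)) = \<gamma>"
      by (rule poly_mapping_eqI) (simp add: lookup_sum lookup_single when_def)
    ultimately have "mon \<gamma> = (\<Prod>i\<in>UNIV. mvar i ^ lk \<gamma> i :: ('n, 'k) mpoly)" by metis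
    then show ?thesis using prod[of UNIV "\<lambda>i. mvar i ^ lk \<gamma> i"] pow[OF var] by simp
  qed
  have red: "p - cst (meval p (\<lambda>_. 1)) \<in> ?M" for p
  proof (induction p rule: mpoly_induct)
    case (single \<gamma> c)
    have "sgl \<gamma> c - cst (meval (sgl \<gamma> c) (\<lambda>_. 1)) = cst c * (mon \<gamma> - 1)"
      by (simp add: meval_single cst_def mon_def algebra_simps mult_single)
    then show ?case using ideal_mult_left[OF MI monM] by simp
  next
    case (add p q)
    have "p + q - cst (meval (p + q) (\<lambda>_. 1)) = (p - cst (meval p (\<lambda>_. 1))) + (q - cst (meval q (\<lambda>_. 1)))"
      by (simp add: meval_add cst_def single_add)
    then show ?case using ideal_add[OF MI add] by (simp only:)
  qed
  fix p :: "('n, 'k) mpoly" assume "p \<in> vanishing (\<lambda>_. 1)"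
  then have "meval p (\<lambda>_. 1) = 0" by (simp add: vanishing_def)
  then show "p \<in> ?M" using red[of p] by (simp add: cst_def)
qed

section \<open>Ranks of sets of integer vectors\<close>

text \<open>Pigeonhole in the manner of Siegel's lemma: among the combinations with coefficients in
  \<open>{0..int K}\<close> two coincide. The bound also guarantees that the greatest cardinality in
  \<open>zrank\<close> exists.\<close>

lemma int_lin_indep_card:
  fixes B :: "('m::finite \<Rightarrow> int) set"
  assumes fin: "finite B" and ind: "int_lin_indep B"
  shows "card B \<le> CARD('m)"
proof (rule ccontr)
  assume neg: "\<not> card B \<le> CARD('m)"
  let ?m = "CARD('m)"
  define s where "s = (\<Sum>b\<in>B. \<Sum>i\<in>UNIV. nat \<bar>b i\<bar>)"
  \<comment> \<open>Chosen so that the number of possible values, at most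
    \<open>((2 * s + 1) * (K + 1)) ^ ?m\<close>, equals \<open>K * (K + 1) ^ ?m\<close> and stays
    below \<open>(K + 1) ^ Suc ?m\<close>.\<close>
  define K where "K = (2 * s + 1) ^ ?m"
  define F where "F = PiE B (\<lambda>_. {0..int K})"
  define \<phi> where "\<phi> = (\<lambda>c i. \<Sum>b\<in>B. c b * b i)"
  have cF: "card F = (K + 1) ^ card B" unfolding F_def using fin by (simp add: card_PiE nat_add_distrib)
  have fF: "finite F" unfolding F_def using fin by (simp add: finite_PiE)
  let ?R = "PiE (UNIV :: 'm set) (\<lambda>_. {- int (K * s)..int (K * s)})"
  have "\<phi> ` F \<subseteq> ?R"
  proof
    fix y assume "y \<in> \<phi> ` F"
    then obtain c where c: "c \<in> F" "y = \<phi> c" by auto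
    have "\<bar>y i\<bar> \<le> int (K * s)" for i
    proof -
      have "\<bar>y i\<bar> \<le> (\<Sum>b\<in>B. \<bar>c b * b i\<bar>)" unfolding c \<phi>_def by (rule sum_abs)
      also have "\<dots> \<le> (\<Sum>b\<in>B. int K * (\<Sum>i\<in>UNIV. \<bar>b i\<bar>))"
      proof (rule sum_mono)
        fix b assume "b \<in> B"
        then have "0 \<le> c b" "c b \<le> int K" using c by (auto simp: F_def PiE_iff)
        moreover have "\<bar>b i\<bar> \<le> (\<Sum>i\<in>UNIV. \<bar>b i\<bar>)" by (rule member_le_sum) auto
        ultimately show "\<bar>c b * b i\<bar> \<le> int K * (\<Sum>i\<in>UNIV. \<bar>b i\<bar>)" unfolding abs_mult by (intro mult_mono) auto
      qed
      also have "\<dots> = int (K * s)" by (simp add: s_def sum_distrib_left)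
      finally show ?thesis .
    qed
    then show "y \<in> ?R" by (auto simp: PiE_iff abs_le_iff) (metis minus_le_iff)
  qed
  then have "card (\<phi> ` F) \<le> card ?R" by (intro card_mono finite_PiE) auto
  also have "\<dots> = (2 * (K * s) + 1) ^ ?m" by (simp add: card_PiE nat_add_distrib nat_mult_distrib)
  also have "\<dots> \<le> ((2 * s + 1) * (K + 1)) ^ ?m" by (intro power_mono) (auto simp: algebra_simps)
  also have "\<dots> = K * (K + 1) ^ ?m" by (simp only: power_mult_distrib K_def[symmetric])
  also have "\<dots> < (K + 1) * (K + 1) ^ ?m" by (intro mult_strict_right_mono) auto
  also have "\<dots> = (K + 1) ^ Suc ?m" by simp
  also have "\<dots> \<le> (K + 1) ^ card B" using neg by (intro power_increasing) auto
  finally have "card (\<phi> ` F) < card F" using cF by simp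
  then have "\<not> inj_on \<phi> F" by (rule pigeonhole)
  then obtain c c' where c: "c \<in> F" "c' \<in> F" "c \<noteq> c'" "\<phi> c = \<phi> c'" by (auto simp: inj_on_def)
  have "(\<Sum>b\<in>B. (c b - c' b) * b i) = 0" for i
    using fun_cong[OF c(4), of i] by (simp add: \<phi>_def left_diff_distrib sum_subtractf)
  then have "\<forall>b\<in>B. c b - c' b = 0"
    using ind[unfolded int_lin_indep_def, THEN spec, of "\<lambda>b. c b - c' b"] by simp
  then have "c = c'" using c(1,2) unfolding F_def by (intro PiE_ext[of c B _ c']) auto
  then show False using c by simp
qed

lemma zrank_ge:
  fixes S :: "('m::finite \<Rightarrow> int) set"
  assumes "B \<subseteq> S" "finite B" "int_lin_indep B"
  shows "card B \<le> zrank S"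
  unfolding zrank_def
  by (rule Greatest_le_nat[where b = "CARD('m)"]) (use assms int_lin_indep_card in auto)

lemma zrank_le: "zrank (S :: ('m::finite \<Rightarrow> int) set) \<le> CARD('m)"
proof -
  have "\<exists>B\<subseteq>S. finite B \<and> card B = zrank S \<and> int_lin_indep B"
    unfolding zrank_def
  proof (rule GreatestI_nat[where b = "CARD('m)" and k = 0])
    show "\<exists>B\<subseteq>S. finite B \<and> card B = 0 \<and> int_lin_indep B"
      by (intro exI[of _ "{}"]) (simp add: int_lin_indep_def)
  qed (use int_lin_indep_card in auto)
  then show ?thesis using int_lin_indep_card by metis
qed

text \<open>\<open>C\<close> is a largest set of coordinates supporting no nonzero vector of
  \<open>S\<close>. Each coordinate outside \<open>C\<close> then yields a vector of
  \<open>S\<close> that, apart from entries in \<open>C\<close>, is nonzero only there; these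
  vectors are independent, so \<open>- C\<close> has at most \<open>zrank S\<close>
  elements.\<close>

lemma free_coordinates:
  fixes S :: "('m::finite \<Rightarrow> int) set"
  shows "\<exists>C. CARD('m) \<le> card C + zrank S \<and> (\<forall>v\<in>S. (\<forall>i. i \<notin> C \<longrightarrow> v i = 0) \<longrightarrow> v = (\<lambda>_. 0))"
proof -
  define free where "free = (\<lambda>C. \<forall>v\<in>S. (\<forall>i. i \<notin> C \<longrightarrow> v i = 0) \<longrightarrow> v = (\<lambda>_. 0))"
  have "free {}" by (auto simp: free_def)
  then have ne: "{C. free C} \<noteq> {}" by auto
  obtain C where C: "free C" "\<And>C'. free C' \<Longrightarrow> card C' \<le> card C"
  proof -
    have "Max (card ` {C. free C}) \<in> card ` {C. free C}" using ne by (intro Max_in) auto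
    then obtain C where "free C" "card C = Max (card ` {C. free C})" by auto
    moreover have "card C' \<le> Max (card ` {C. free C})" if "free C'" for C' using that by (intro Max_ge) auto
    ultimately show thesis using that by metis
  qed
  have "\<forall>i\<in>-C. \<exists>v. v \<in> S \<and> v i \<noteq> 0 \<and> (\<forall>k. k \<notin> insert i C \<longrightarrow> v k = 0)"
  proof
    fix i assume i: "i \<in> - C"
    have "\<not> free (insert i C)" using C(2)[of "insert i C"] i by auto
    then obtain v where v: "v \<in> S" "\<forall>k. k \<notin> insert i C \<longrightarrow> v k = 0" "v \<noteq> (\<lambda>_. 0)" by (auto simp: free_def)
    have "v i \<noteq> 0"
    proof
      assume "v i = 0"
      then have "\<forall>k. k \<notin> C \<longrightarrow> v k = 0" using v(2) by auto
      then show False using C(1) v unfolding free_def by blast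
    qed
    then show "\<exists>v. v \<in> S \<and> v i \<noteq> 0 \<and> (\<forall>k. k \<notin> insert i C \<longrightarrow> v k = 0)" using v by blast
  qed
  from bchoice[OF this] obtain v where v: "\<And>i. i \<in> -C \<Longrightarrow> v i \<in> S" "\<And>i. i \<in> -C \<Longrightarrow> v i i \<noteq> 0"
    "\<And>i k. i \<in> -C \<Longrightarrow> k \<notin> insert i C \<Longrightarrow> v i k = 0" by blast
  have inj: "inj_on v (- C)"
  proof (rule inj_onI)
    fix i k assume ik: "i \<in> -C" "k \<in> -C" "v i = v k"
    show "i = k"
    proof (rule ccontr)
      assume "i \<noteq> k"
      then have "v i k = 0" using ik by (intro v(3)) auto
      then show False using v(2)[OF ik(2)] unfolding ik(3) by simp
    qed
  qed
  have "int_lin_indep (v ` (- C))"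
    unfolding int_lin_indep_def
  proof (intro allI impI ballI)
    fix c b assume z: "\<forall>i. (\<Sum>b\<in>v ` (- C). c b * b i) = 0" and "b \<in> v ` (- C)"
    then obtain i where i: "i \<in> - C" "b = v i" by auto
    have "(\<Sum>b\<in>v ` (- C). c b * b i) = (\<Sum>k\<in>-C. c (v k) * v k i)" by (simp add: sum.reindex[OF inj])
    also have "\<dots> = (\<Sum>k\<in>-C. if k = i then c (v i) * v i i else 0)"
      using v(3) i by (intro sum.cong) auto
    also have "\<dots> = c (v i) * v i i" using i by simp
    finally show "c b = 0" using z v(2)[OF i(1)] i by simp
  qed
  then have "card (v ` (- C)) \<le> zrank S" using v(1) by (intro zrank_ge) auto
  then have "card (- C) \<le> zrank S" by (simp add: card_image[OF inj])
  moreover have "card (- C) = CARD('m) - card C" by (simp add: Compl_eq_Diff_UNIV card_Diff_subset)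
  ultimately show ?thesis using C(1) unfolding free_def by (intro exI[of _ C]) auto
qed

section \<open>The zero estimate\<close>

lemma xpow_nonzero: "(\<And>i j. x i j \<noteq> 0) \<Longrightarrow> xpow x a j \<noteq> 0"
  by (simp add: xpow_def)

lemma xpow_zero [simp]: "xpow x (\<lambda>_. 0) = (\<lambda>_. 1)"
  by (simp add: xpow_def)

lemma xpow_add: "(\<And>i j. x i j \<noteq> 0) \<Longrightarrow> xpow x (\<lambda>i. a i + b i) j = xpow x a j * xpow x b j"
  by (simp add: xpow_def power_int_add prod.distrib)

section \<open>Boxes of exponents and translates of a prime\<close>

definition int_box :: "nat \<Rightarrow> ('m \<Rightarrow> int) set" where
  "int_box U = {a. \<forall>i. 0 \<le> a i \<and> a i \<le> int U}"

lemma finite_int_box: "finite (int_box U :: ('m::finite \<Rightarrow> int) set)"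
proof -
  have "int_box U = (PiE UNIV (\<lambda>_. {0..int U}) :: ('m \<Rightarrow> int) set)" by (auto simp: int_box_def PiE_iff)
  then show ?thesis by (simp add: finite_PiE)
qed

lemma int_box_add: "a \<in> int_box U \<Longrightarrow> b \<in> int_box W \<Longrightarrow> (\<lambda>i. a i + b i) \<in> int_box (U + W)"
  by (auto simp: int_box_def intro: add_mono)

lemma int_box_supported_card:
  fixes C :: "'m::finite set"
  shows "(U + 1) ^ card C \<le> card {b \<in> int_box U. \<forall>i. i \<notin> C \<longrightarrow> b i = 0}"
proof -
  let ?f = "\<lambda>b i. if i \<in> C then b i else (0 :: int)"
  have inj: "inj_on ?f (PiE C (\<lambda>_. {0..int U}))"
  proof (rule inj_onI)
    fix b b' assume b: "b \<in> PiE C (\<lambda>_. {0..int U})" "b' \<in> PiE C (\<lambda>_. {0..int U})" and e: "?f b = ?f b'"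
    have "b i = b' i" if "i \<in> C" for i using fun_cong[OF e, of i] that by simp
    then show "b = b'" using b by (intro PiE_ext[of b C _ b']) auto
  qed
  have sub: "?f ` PiE C (\<lambda>_. {0..int U}) \<subseteq> {b \<in> int_box U. \<forall>i. i \<notin> C \<longrightarrow> b i = 0}"
    by (auto simp: int_box_def PiE_iff)
  have "card (PiE C (\<lambda>_. {0..int U})) \<le> card {b \<in> int_box U. \<forall>i. i \<notin> C \<longrightarrow> b i = 0}"
    by (rule card_inj_on_le[OF inj sub]) (simp add: finite_int_box)
  then show ?thesis by (simp add: card_PiE nat_add_distrib)
qed

text \<open>For the least \<open>j\<close> such that \<open>Fam j\<close> contains a prime of
  codimension at most \<open>j\<close>, everything in the preceding family has codimension at least
  \<open>j\<close>. The translates of the prime found lie in that family and have its codimension,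
  so both bounds are attained; this is what makes them minimal.\<close>

lemma prime_with_many_translates:
  fixes x :: "'m::finite \<Rightarrow> 'n::finite \<Rightarrow> 'k::field_char_0" and f :: "('n, 'k) mpoly"
  assumes x: "\<And>i j. x i j \<noteq> 0" and f: "f \<noteq> 0"
    and van: "\<And>a. a \<in> int_box (\<Sum>d=1..CARD('n). T d) \<Longrightarrow> meval f (xpow x a) = 0"
    and D: "deg_le UNIV D f" "D \<ge> 1"
  shows "\<exists>j P a. 1 \<le> j \<and> j \<le> CARD('n) \<and> is_prime_ideal P \<and> P \<subseteq> vanishing (xpow x a) \<and>
     vdim P + j = CARD('n) \<and> card ((\<lambda>b. act (xpow x (\<lambda>i. - b i)) ` P) ` int_box (T j)) \<le> D ^ j"
proof -
  let ?n = "CARD('n)"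
  define U where "U = (\<lambda>j. \<Sum>d=1..j. T d)"
  define g where "g = (\<lambda>a. act (xpow x a) f)"
  \<comment> \<open>The box generating the ideal and the box of admissible points share the side
    \<open>U ?n\<close>. Lowering the index by one takes \<open>T j\<close> from the first and gives
    it to the second, which leaves room for the translations.\<close>
  define Fam where "Fam = (\<lambda>j. {P. is_prime_ideal P \<and> g ` int_box (U j) \<subseteq> P \<and>
     (\<exists>a\<in>int_box (U ?n - U j). P \<subseteq> vanishing (xpow x a))})"
  define cod where "cod = (\<lambda>P :: ('n, 'k) mpoly set. ?n - vdim P)"
  have xz: "xpow x a l \<noteq> 0" for a l by (rule xpow_nonzero) (rule x)
  have Umono: "U i \<le> U j" if "i \<le> j" for i j unfolding U_def using that by (intro sum_mono2) auto
  have zbox: "(\<lambda>_. 0) \<in> int_box u" for u by (simp add: int_box_def)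
  have "g ` int_box (U ?n) \<subseteq> vanishing (\<lambda>_. 1)"
  proof
    fix y assume "y \<in> g ` int_box (U ?n)"
    then obtain a where "a \<in> int_box (U ?n)" "y = act (xpow x a) f" by (auto simp: g_def)
    then show "y \<in> vanishing (\<lambda>_. 1)" using van by (simp add: vanishing_def meval_act U_def)
  qed
  \<comment> \<open>The ideal of the point 1 shows that the index \<open>?n\<close> qualifies, as no
    codimension exceeds \<open>?n\<close>.\<close>
  then have "vanishing (\<lambda>_. 1) \<in> Fam ?n"
    unfolding Fam_def using prime_vanishing[of "\<lambda>_. 1"] zbox[of 0] by (auto intro!: bexI[of _ "\<lambda>_. 0"])
  then have ex: "\<exists>j. \<exists>P\<in>Fam j. cod P \<le> j" by (auto simp: cod_def intro!: exI[of _ ?n])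
  define j where "j = (LEAST j. \<exists>P\<in>Fam j. cod P \<le> j)"
  have jn: "j \<le> ?n" unfolding j_def
    using \<open>vanishing (\<lambda>_. 1) \<in> Fam ?n\<close> by (intro Least_le) (auto simp: cod_def)
  obtain P where P: "P \<in> Fam j" "cod P \<le> j" using LeastI_ex[OF ex] unfolding j_def by blast
  have notless: "\<not> (\<exists>P\<in>Fam i. cod P \<le> i)" if "i < j" for i using not_less_Least that unfolding j_def by blast
  \<comment> \<open>A prime of codimension 0 is the zero ideal, which cannot contain
    \<open>f\<close>.\<close>
  have "j \<noteq> 0"
  proof
    assume j0: "j = 0"
    have Pp: "is_prime_ideal P" and gP: "g ` int_box (U j) \<subseteq> P" using P by (auto simp: Fam_def)
    have "vdim P = ?n" using P(2) vdim_le[OF Pp] by (simp add: cod_def j0)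
    then obtain Y where Y: "maxindep_mod P Y" "card Y = ?n" using vdim_attained[OF Pp] by metis
    then have "Y = UNIV" by (metis card_subset_eq finite subset_UNIV)
    then have "\<forall>p\<in>P. p = 0" using Y(1) by (auto simp: maxindep_mod_def indep_mod_def deg_le_def vdeg_def)
    moreover have "f \<in> P" using gP zbox[of "U j"] by (force simp: g_def)
    ultimately show False using f by blast
  qed
  then obtain i where ji: "j = Suc i" by (cases j) auto
  have Uj: "U j = U i + T j" by (simp add: ji U_def)
  have Pp: "is_prime_ideal P" using P by (auto simp: Fam_def)
  obtain a where a: "a \<in> int_box (U ?n - U j)" "P \<subseteq> vanishing (xpow x a)" using P by (auto simp: Fam_def)
  let ?tr = "\<lambda>b. act (xpow x (\<lambda>i. - b i)) ` P"
  have codi: "Suc i \<le> cod R" if "R \<in> Fam i" for R using notless[of i] that ji by auto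
  have trFam: "?tr b \<in> Fam i" if b: "b \<in> int_box (T j)" for b
  proof -
    \<comment> \<open>Acting with exponent \<open>- b\<close> turns the translate of
      \<open>f\<close> by \<open>b + c\<close> into the one by \<open>c\<close>, and moves the
      admissible point from \<open>a\<close> to \<open>b + a\<close>.\<close>
    have inv: "(\<lambda>l. xpow x (\<lambda>i. - b i) l * xpow x (\<lambda>i. b i + c i) l) = xpow x c" for c
    proof
      fix l
      have "xpow x (\<lambda>i. - b i) l * xpow x (\<lambda>i. b i + c i) l = xpow x (\<lambda>i. - b i + (b i + c i)) l"
        by (rule xpow_add[symmetric]) (rule x)
      then show "xpow x (\<lambda>i. - b i) l * xpow x (\<lambda>i. b i + c i) l = xpow x c l" by simp
    qed
    have "is_prime_ideal (?tr b)" by (rule prime_act_image[OF Pp xz])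
    moreover have "g ` int_box (U i) \<subseteq> ?tr b"
    proof
      fix y assume "y \<in> g ` int_box (U i)"
      then obtain c where c: "c \<in> int_box (U i)" "y = g c" by auto
      have "g (\<lambda>i. b i + c i) \<in> P" using int_box_add[OF b c(1)] P by (auto simp: Fam_def Uj add.commute)
      moreover have "act (xpow x (\<lambda>i. - b i)) (g (\<lambda>i. b i + c i)) = y"
        unfolding c(2) g_def act_act inv ..
      ultimately show "y \<in> ?tr b" by (metis imageI)
    qed
    moreover have "(\<lambda>i. b i + a i) \<in> int_box (U ?n - U i)"
    proof -
      have "T j + (U ?n - U j) = U ?n - U i" using Umono[OF jn] by (simp add: Uj)
      then show ?thesis using int_box_add[OF b a(1)] by simp
    qed
    moreover have "?tr b \<subseteq> vanishing (xpow x (\<lambda>i. b i + a i))"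
      using a(2) by (auto simp: vanishing_def meval_act inv)
    ultimately show ?thesis unfolding Fam_def by blast
  qed
  have vtr: "vdim (?tr b) = vdim P" for b by (rule vdim_act_image[OF xz])
  have codP: "cod P = j"
    using codi[OF trFam[OF zbox]] P(2) vtr[of "\<lambda>_. 0"] by (simp add: cod_def ji)
  then have vP: "vdim P + j = ?n" using vdim_le[OF Pp] \<open>j \<noteq> 0\<close> by (simp add: cod_def)
  have "card (?tr ` int_box (T j)) \<le> D ^ j"
  proof (rule minimal_primes_count[where g = g and J = "int_box (U i)"])
    show "finite (int_box (U i) :: ('m \<Rightarrow> int) set)" "finite (?tr ` int_box (T j))" by (auto intro: finite_int_box)
    show "1 \<le> D" "1 \<le> j" using D \<open>j \<noteq> 0\<close> by auto
    show "deg_le UNIV D (g c)" for c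
      using D(1) keys_act[of "xpow x c" f] xz by (simp add: deg_le_def g_def)
    fix Q assume "Q \<in> ?tr ` int_box (T j)"
    then obtain b where b: "b \<in> int_box (T j)" "Q = ?tr b" by auto
    have QF: "Q \<in> Fam i" using trFam[OF b(1)] b(2) by simp
    then show Q: "is_prime_ideal Q" "g ` int_box (U i) \<subseteq> Q" by (auto simp: Fam_def)
    show "vdim Q + j = ?n" using vP vtr b by simp
    fix R assume R: "is_prime_ideal R" "g ` int_box (U i) \<subseteq> R" "R \<subseteq> Q"
    \<comment> \<open>The family is closed under passing to smaller primes over the same ideal, so
      \<open>R\<close> also has codimension at least \<open>j\<close>. It then has the dimension of
      \<open>Q\<close> and cannot be strictly smaller.\<close>
    then have "R \<in> Fam i" using QF unfolding Fam_def by blast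
    then have "j \<le> cod R" using codi ji by simp
    then have "vdim R \<le> vdim Q" using vP vtr[of b] b(2) vdim_le[OF R(1)] by (simp add: cod_def)
    then show "R = Q" using vdim_strict_mono[OF R(1) Q(1)] R(3) by fastforce
  qed
  then show ?thesis using \<open>j \<noteq> 0\<close> jn Pp a(2) vP by (intro exI[of _ j] exI[of _ P] exI[of _ a]) auto
qed

text \<open>If two box points produce the same translate, their difference stabilizes
  \<open>P\<close>. Among points supported on the free coordinates of the stabilizer this difference
  is 0, so these points give distinct translates.\<close>

lemma translates_card:
  fixes x :: "'m::finite \<Rightarrow> 'n::finite \<Rightarrow> 'k::field"
  assumes x: "\<And>i j. x i j \<noteq> 0"
  shows "(T + 1) ^ (CARD('m) - zrank (Stab x P)) \<le> card ((\<lambda>b. act (xpow x (\<lambda>i. - b i)) ` P) ` int_box T)"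
proof -
  let ?tr = "\<lambda>b. act (xpow x (\<lambda>i. - b i)) ` P"
  obtain C where C: "CARD('m) \<le> card C + zrank (Stab x P)"
    "\<forall>v\<in>Stab x P. (\<forall>i. i \<notin> C \<longrightarrow> v i = 0) \<longrightarrow> v = (\<lambda>_. 0)"
    using free_coordinates by blast
  let ?B = "{b \<in> int_box T. \<forall>i. i \<notin> C \<longrightarrow> b i = 0} :: ('m \<Rightarrow> int) set"
  have "(\<lambda>l. xpow x a l * xpow x b l) = xpow x (\<lambda>i. a i + b i)" for a b
    by (rule ext, rule xpow_add[symmetric]) (rule x)
  then have aa: "act (xpow x a) (act (xpow x b) p) = act (xpow x (\<lambda>i. a i + b i)) p" for a b p
    by (simp only: act_act)
  have tt: "act (xpow x a) ` (act (xpow x b) ` P) = act (xpow x (\<lambda>i. a i + b i)) ` P" for a b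
    unfolding image_image aa ..
  have inj: "inj_on ?tr ?B"
  proof (rule inj_onI)
    fix b b' assume b: "b \<in> ?B" "b' \<in> ?B" and e: "?tr b = ?tr b'"
    have "act (xpow x b) ` ?tr b = act (xpow x b) ` ?tr b'" using e by simp
    then have "P = act (xpow x (\<lambda>i. b i + - b' i)) ` P" by (simp add: tt)
    then have "(\<lambda>i. b i + - b' i) \<in> Stab x P" by (simp add: Stab_def)
    moreover have "\<forall>i. i \<notin> C \<longrightarrow> b i + - b' i = 0" using b by simp
    ultimately have "(\<lambda>i. b i + - b' i) = (\<lambda>_. 0)" using bspec[OF C(2)] by simp
    then have "b i + - b' i = 0" for i by (rule fun_cong)
    then show "b = b'" by (intro ext) simp
  qed
  have "(T + 1) ^ (CARD('m) - zrank (Stab x P)) \<le> (T + 1) ^ card C"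
    using C(1) by (intro power_increasing) auto
  also have "\<dots> \<le> card ?B" by (rule int_box_supported_card)
  also have "\<dots> = card (?tr ` ?B)" by (rule card_image[OF inj, symmetric])
  also have "\<dots> \<le> card (?tr ` int_box T)" by (intro card_mono finite_imageI finite_int_box image_mono) auto
  finally show ?thesis .
qed

text \<open>Ranks are at most \<open>CARD('m)\<close>, so the maximum defining \<open>mprime\<close>
  is taken over a finite set.\<close>

lemma zrank_Stab_le_mprime:
  fixes x :: "'m::finite \<Rightarrow> 'n::finite \<Rightarrow> 'k::field"
  assumes "is_prime_ideal P" "P \<subseteq> max_ideal_one" "height P = enat d"
  shows "zrank (Stab x P) \<le> mprime x d"
  unfolding mprime_def
proof (rule Max_ge)
  have "{zrank (Stab x P) | P. is_prime_ideal P \<and> P \<subseteq> max_ideal_one \<and> height P = enat d} \<subseteq> {..CARD('m)}"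
    using zrank_le by auto
  then show "finite {zrank (Stab x P) | P. is_prime_ideal P \<and> P \<subseteq> max_ideal_one \<and> height P = enat d}"
    by (rule finite_subset) simp
qed (use assms in blast)

text \<open>The torus is commutative, and each of its elements acts bijectively.\<close>

lemma Stab_act_image:
  fixes x :: "'m::finite \<Rightarrow> 'n::finite \<Rightarrow> 'k::field"
  assumes z: "\<And>i. z i \<noteq> 0"
  shows "Stab x (act z ` P) = Stab x P"
proof -
  have inj: "inj (act z)"
    by (rule inj_on_inverseI[of _ "act (\<lambda>i. inverse (z i))"]) (simp add: act_act z)
  have "act w ` act z ` P = act z ` act w ` P" for w
    unfolding image_image act_act by (simp add: mult.commute)
  then show ?thesis unfolding Stab_def by (simp add: inj_image_eq_iff[OF inj])
qed

theorem theorem5p11: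
  fixes x :: "'m::finite \<Rightarrow> 'n::finite \<Rightarrow> 'k::field_char_0"
    and f :: "('n, 'k) mpoly"
  assumes x_units: "\<And>i j. x i j \<noteq> 0"
    and rank_lt: "\<And>d. 1 \<le> d \<Longrightarrow> d \<le> CARD('n) \<Longrightarrow> mprime x d < CARD('m)"
    and f_nz: "f \<noteq> 0"
  shows "\<exists>a :: 'm \<Rightarrow> int.
           (\<forall>i. 0 \<le> a i \<and> real_of_int (a i) \<le>
              (\<Sum>d=1..CARD('n). real (total_degree f) powr
                  (real d / real (CARD('m) - mprime x d))))
         \<and> meval f (xpow x a) \<noteq> 0"
proof (cases "total_degree f = 0")
  \<comment> \<open>In degree 0 the bound itself is 0, because \<open>0 powr y = 0\<close>. The
    exponent 0 works, as \<open>f\<close> is a nonzero constant. The counting bound applies only to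
    \<open>D \<ge> 1\<close>.\<close>
  case True
  have "meval f (xpow x (\<lambda>_. 0)) \<noteq> 0"
  proof
    assume "meval f (xpow x (\<lambda>_. 0)) = 0"
    then have "f \<in> vanishing (\<lambda>_. 1)" by (simp add: vanishing_def)
    moreover have "deg_le (- {}) 0 f" using deg_le_total_degree[of f] True by simp
    ultimately show False
      using indep_mod_empty[OF prime_vanishing] f_nz unfolding indep_mod_def by blast
  qed
  then show ?thesis by (intro exI[of _ "\<lambda>_. 0"]) (simp add: sum_nonneg)
next
  case False
  define D where "D = total_degree f"
  have D: "D \<ge> 1" "deg_le UNIV D f" using False deg_le_total_degree by (auto simp: D_def)
  let ?r = "\<lambda>d. real D powr (real d / real (CARD('m) - mprime x d))"
  \<comment> \<open>Rounding each summand down keeps the box inside the allowed one, and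
    \<open>T d + 1\<close> still exceeds \<open>?r d\<close>.\<close>
  define T where "T = (\<lambda>d. nat \<lfloor>?r d\<rfloor>)"
  show ?thesis
  proof (rule ccontr)
    assume neg: "\<not> ?thesis"
    have van: "meval f (xpow x a) = 0" if a: "a \<in> int_box (\<Sum>d=1..CARD('n). T d)" for a
    proof -
      have "real_of_int (a i) \<le> (\<Sum>d=1..CARD('n). ?r d)" for i
      proof -
        have "a i \<le> int (\<Sum>d=1..CARD('n). T d)" using a by (auto simp: int_box_def)
        then have "real_of_int (a i) \<le> real (\<Sum>d=1..CARD('n). T d)" by linarith
        also have "\<dots> = (\<Sum>d=1..CARD('n). real (T d))" by simp
        also have "\<dots> \<le> (\<Sum>d=1..CARD('n). ?r d)" by (intro sum_mono) (simp add: T_def)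
        finally show ?thesis .
      qed
      moreover have "0 \<le> a i" for i using a by (auto simp: int_box_def)
      ultimately show ?thesis using neg unfolding D_def by blast
    qed
    obtain j P a where j: "1 \<le> j" "j \<le> CARD('n)" and P: "is_prime_ideal P" "P \<subseteq> vanishing (xpow x a)"
      "vdim P + j = CARD('n)" and up: "card ((\<lambda>b. act (xpow x (\<lambda>i. - b i)) ` P) ` int_box (T j)) \<le> D ^ j"
      using prime_with_many_translates[OF x_units f_nz van D(2,1)] by blast
    have xz: "xpow x a l \<noteq> 0" for a l by (rule xpow_nonzero) (rule x_units)
    \<comment> \<open>\<open>mprime\<close> speaks only of primes inside the ideal of the point 1.
      The translation by \<open>x^a\<close> moves \<open>P\<close> there without changing its height
      or its stabilizer.\<close>
    let ?P = "act (xpow x a) ` P"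
    have "?P \<subseteq> vanishing (\<lambda>_. 1)" using P(2) by (auto simp: vanishing_def meval_act)
    then have "?P \<subseteq> max_ideal_one" using vanishing_one_subset by blast
    moreover have P': "is_prime_ideal ?P" by (rule prime_act_image[OF P(1) xz])
    moreover have "height ?P = enat j"
      unfolding height_eq_codim[OF P'] vdim_act_image[OF xz] using P(3) by simp
    ultimately have "zrank (Stab x ?P) \<le> mprime x j" by (intro zrank_Stab_le_mprime)
    then have r: "zrank (Stab x P) \<le> mprime x j" unfolding Stab_act_image[OF xz] .
    define e where "e = CARD('m) - mprime x j"
    have e0: "e > 0" using rank_lt[OF j] by (simp add: e_def)
    have "(T j + 1) ^ e \<le> (T j + 1) ^ (CARD('m) - zrank (Stab x P))"
      using r by (intro power_increasing) (auto simp: e_def)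
    also have "\<dots> \<le> D ^ j" using translates_card[of x "T j" P, OF x_units] up by simp
    finally have "real ((T j + 1) ^ e) \<le> real (D ^ j)" by (simp only: of_nat_le_iff)
    moreover have "real (D ^ j) < real ((T j + 1) ^ e)"
    proof -
      \<comment> \<open>Raising this strict inequality to the power \<open>e\<close> cancels the
        denominator of the exponent and contradicts the upper bound \<open>D ^ j\<close>.\<close>
      have "real D powr (real j / real e) < real (T j + 1)"
        unfolding T_def e_def by linarith
      then have "(real D powr (real j / real e)) ^ e < real (T j + 1) ^ e"
        using e0 by (intro power_strict_mono) auto
      moreover have "(real D powr (real j / real e)) ^ e = real D powr (real j / real e * real e)"
        using D(1) by (simp add: powr_powr powr_realpow[symmetric])
      moreover have "\<dots> = real D ^ j" using e0 D(1) by (simp add: powr_realpow)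
      ultimately show ?thesis by simp
    qed
    ultimately show False by simp
  qed
qed

end
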